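(* Let $X$ be a hyperelliptic curve of genus $g$ over a perfect field $F$ of characteristic not equal to $2$, with affine model $y^2=f(x)$, $\deg f=2g+1$. Whenever $\ell>g$, $2\ell-g\equiv1\pmod4$, and $\det M(\ell,g)$ is nonzero in $F$, the local Euler index in $\mathrm{GW}(F)$ of the complete linear series $|2\ell\infty_X|$, with basis $$\lambda=(1,y,\dots,x^{\ell-g-1},x^{\ell-g-1}y;\,x^{\ell-g},x^{\ell-g+1},\dots,x^\ell),$$ at a ramification point $(\gamma,0)\in R_\pi\setminus\{\infty_X\}$ of the hyperelliptic projection $\pi:X\to\mathbb{P}^1$ is $$\mathrm{ind}_{(\gamma,0)}w(\lambda)=\begin{cases}\mathrm{Tr}_{k(\gamma)/F}\left(\frac12\binom{g+1}2\cdot\mathbb{H}\right)&\text{if $\ell$ is even and }g\equiv3\pmod4\\[4pt]\mathrm{Tr}_{k(\gamma)/F}\left(\frac{\binom{g+1}2-1}2\cdot\mathbb{H}+\left\langle2(\det M(\ell,g))(D^1f)(\gamma)\right\rangle\right)&\text{if $\ell$ is odd and }g\equiv1\pmod4.\end{cases}$$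
   Context: $X$ is smooth and projective, $\pi$ is $(x,y)\mapsto x$, $\infty_X=\pi^{-1}(\infty)$, $R_\pi$ is the ramification divisor, consisting of $\infty_X$ and the points $(\gamma,0)$ with $f(\gamma)=0$; $k(\gamma)=F(\gamma)$; $D^1f$ is the derivative of $f$. $M(\ell,g)$ is the $(g+1)\times(g+1)$ matrix with entries $M_{ij}=\binom{\ell-g+j}{2j-i}$, $0\le i,j\le g$ (binomials with lower index negative or exceeding the upper index are $0$). $\mathrm{GW}(F)$ is the Grothendieck--Witt group of nondegenerate symmetric bilinear forms, $\langle a\rangle$ the class of $(u,v)\mapsto auv$, $\mathbb{H}=\langle1\rangle+\langle-1\rangle$, and $\mathrm{Tr}_{k/F}:\mathrm{GW}(k)\to\mathrm{GW}(F)$ is post-composition of a bilinear form with the field trace. Hasse derivatives: for an étale coordinate $t$ on an open $U\subset X$, $D^k_t:\mathcal{O}_U\to\mathcal{O}_U$ are the unique $F$-linear maps with $D^0_t=\mathrm{id}$, $D^k_t(\phi\psi)=\sum_iD^i_t\phi\,D^{k-i}_t\psi$, $D^k_tt^n=\binom nkt^{n-k}$. Hasse Wronskian: with $L=\mathcal{O}_X(2\ell\infty_X)$ and $r+1=h^0(L)=2\ell-g+1$, $w(\lambda)$ is the section of $\det J^{r+1}(L)\cong L^{\otimes(r+1)}\otimes K_X^{\otimes\binom{r+1}2}$ (with $J^{r+1}(L)$ the bundle of order-$r$ principal parts) represented, for a local generator $s$ of $L$ and étale coordinate $t$, by $\det(D^i_t(\lambda_j/s))_{0\le i,j\le r}$.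 On $X\setminus\{\infty_X\}$ one uses $s=1$. Since $2\ell-g\equiv1\pmod4$, both $r+1$ and $\binom{r+1}2+1$ are even, so $\mathcal{H}om(T_X,\det J^{r+1}(L))\cong L^{\otimes(r+1)}\otimes K_X^{\otimes(\binom{r+1}2+1)}$ is canonically a tensor square; this is the relative orientation, and the trivializations given by $s$ and $dt$ are compatible with it. Local Euler index at a closed point $p\ne\infty_X$ that is an isolated zero of $w(\lambda)$: choose $t=ax+by$ ($a,b\in F$) étale near $p$ with $k(t(p))\cong k(p)$ (a Nisnevich coordinate), put $\phi=\det(D^i_t\lambda_j)$, choose $n$ with $\mathfrak{m}_p^n\subset(\phi)$ and $G\in F[t]$ with $G-\phi\in\mathfrak{m}_p^{2n}$, and let $A=\mathcal{O}_{X,p}/(\phi)\cong F[t]_{t(p)}/(G)$. Write the image of $\frac{G(t_1)-G(t_2)}{t_1-t_2}$ in $A\otimes_FA$ as $\sum a_i\otimes b_i$; there is a unique $F$-linear $\eta:A\to F$ with $\sum\eta(a_i)b_i=1$, and $\mathrm{ind}_pw(\lambda)\in\mathrm{GW}(F)$ is the class of $(a,b)\mapsto\eta(ab)$ (known to be independent of choices). *)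

theory Defs
  imports
    "Jordan_Normal_Form.Determinant"
begin

section \<open>The Grothendieck-Witt group\<close>

text \<open>A nondegenerate symmetric bilinear form on a finite-dimensional \<open>F\<close>-space is represented by its
  Gram matrix in a basis, so the underlying space is always \<open>F\<^sup>n\<close>. The rank 0 form is the
  \<open>0 \<times> 0\<close> matrix.\<close>

definition nondeg_sym_form :: "'a::field mat \<Rightarrow> bool" where
  "nondeg_sym_form A \<longleftrightarrow>
     A \<in> carrier_mat (dim_row A) (dim_row A) \<and> transpose_mat A = A \<and> det A \<noteq> 0"

definition isometric :: "'a::field mat \<Rightarrow> 'a mat \<Rightarrow> bool" where
  "isometric A B \<longleftrightarrow> nondeg_sym_form A \<and> nondeg_sym_form B \<and> dim_row A = dim_row B \<and>
     (\<exists>P \<in> carrier_mat (dim_row A) (dim_row A). det P \<noteq> 0 \<and> B = transpose_mat P * A * P)"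

definition orthogonal_sum :: "'a::field mat \<Rightarrow> 'a mat \<Rightarrow> 'a mat" where
  "orthogonal_sum A B =
     four_block_mat A (0\<^sub>m (dim_row A) (dim_col B)) (0\<^sub>m (dim_row B) (dim_col A)) B"

lemma nondeg_sym_formD:
  assumes "nondeg_sym_form A" "dim_row A = n"
  shows "A \<in> carrier_mat n n" "transpose_mat A = A" "det A \<noteq> 0"
  using assms by (auto simp: nondeg_sym_form_def)

lemma isometricI:
  assumes "nondeg_sym_form A" "nondeg_sym_form B" "A \<in> carrier_mat n n" "B \<in> carrier_mat n n"
    "P \<in> carrier_mat n n" "det P \<noteq> 0" "B = transpose_mat P * A * P"
  shows "isometric A B"
  unfolding isometric_def
proof (intro conjI)
  have "dim_row A = n" "dim_row B = n" using assms(3,4) by auto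
  then show "dim_row A = dim_row B" by simp
  show "\<exists>P \<in> carrier_mat (dim_row A) (dim_row A). det P \<noteq> 0 \<and> B = transpose_mat P * A * P"
    using assms(5-7) \<open>dim_row A = n\<close> by metis
qed (rule assms)+

lemma isometricE:
  assumes "isometric A B"
  obtains n P where "nondeg_sym_form A" "nondeg_sym_form B"
    "A \<in> carrier_mat n n" "B \<in> carrier_mat n n"
    "P \<in> carrier_mat n n" "det P \<noteq> 0" "B = transpose_mat P * A * P"
proof -
  from assms obtain P where *: "nondeg_sym_form A" "nondeg_sym_form B" "dim_row A = dim_row B"
    "P \<in> carrier_mat (dim_row A) (dim_row A)" "det P \<noteq> 0" "B = transpose_mat P * A * P"
    unfolding isometric_def by blast
  show thesis
    by (rule that[OF *(1,2) nondeg_sym_formD(1)[OF *(1) refl]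
          nondeg_sym_formD(1)[OF *(2) *(3)[symmetric]] *(4-6)])
qed

lemma isometric_refl:
  assumes "nondeg_sym_form A"
  shows "isometric A A"
proof -
  obtain n where n: "dim_row A = n" by blast
  note A = nondeg_sym_formD(1)[OF assms n]
  have "A = transpose_mat (1\<^sub>m n) * A * 1\<^sub>m n"
    using A left_mult_one_mat[OF A] right_mult_one_mat[OF A] by simp
  with isometricI[OF assms assms A A one_carrier_mat[of n]] show ?thesis
    by simp
qed

lemma isometric_sym:
  assumes "isometric A B"
  shows "isometric B A"
proof -
  from assms obtain n P where A: "nondeg_sym_form A" and B: "nondeg_sym_form B"
    and cA: "A \<in> carrier_mat n n" and cB: "B \<in> carrier_mat n n"
    and P: "P \<in> carrier_mat n n" and dP: "det P \<noteq> 0"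
    and eq: "B = transpose_mat P * A * P"
    by (rule isometricE)
  obtain Q where Q: "Q \<in> carrier_mat n n" and QP: "Q * P = 1\<^sub>m n" and PQ: "P * Q = 1\<^sub>m n"
    using det_non_zero_imp_unit[OF P dP, of "undefined :: unit"]
    by (auto simp: Units_def ring_mat_def)
  have dQ: "det Q \<noteq> 0"
  proof
    assume "det Q = 0"
    then have "det (P * Q) = 0" using det_mult[OF P Q] by simp
    then show False using PQ by simp
  qed
  have "transpose_mat Q * B * Q = transpose_mat Q * (transpose_mat P * (A * P)) * Q"
    unfolding eq using P cA by (simp add: assoc_mult_mat[of _ n n _ n _ n])
  also have "\<dots> = (transpose_mat Q * transpose_mat P) * (A * (P * Q))"
    using P cA Q by (simp add: assoc_mult_mat[of _ n n _ n _ n])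
  also have "\<dots> = transpose_mat (P * Q) * (A * (P * Q))"
    using transpose_mult[OF P Q] by simp
  also have "\<dots> = A" unfolding PQ using cA by simp
  finally show ?thesis
    using isometricI[OF B A cB cA Q dQ] by simp
qed

lemma isometric_trans:
  assumes "isometric A B" "isometric B C"
  shows "isometric A C"
proof -
  from assms(1) obtain n P where A: "nondeg_sym_form A"
    and cA: "A \<in> carrier_mat n n" and cB: "B \<in> carrier_mat n n"
    and P: "P \<in> carrier_mat n n" and dP: "det P \<noteq> 0"
    and eq: "B = transpose_mat P * A * P"
    by (rule isometricE)
  from assms(2) obtain n' Q where C: "nondeg_sym_form C"
    and B': "B \<in> carrier_mat n' n'" and C': "C \<in> carrier_mat n' n'"
    and Q': "Q \<in> carrier_mat n' n'" and dQ: "det Q \<noteq> 0"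
    and eq2: "C = transpose_mat Q * B * Q"
    by (rule isometricE)
  have "n' = n" using cB B' by (metis carrier_matD(1))
  with C' Q' have cC: "C \<in> carrier_mat n n" and Q: "Q \<in> carrier_mat n n" by simp_all
  have "C = transpose_mat (P * Q) * A * (P * Q)"
    unfolding eq2 eq transpose_mult[OF P Q]
    using P Q cA by (simp add: assoc_mult_mat[of _ n n _ n _ n])
  moreover have "det (P * Q) \<noteq> 0" using dP dQ det_mult[OF P Q] by simp
  ultimately show ?thesis
    using isometricI[OF A C cA cC mult_carrier_mat[OF P Q]] by blast
qed

lemma nondeg_sym_form_zero: "nondeg_sym_form (0\<^sub>m 0 0)"
  by (auto simp: nondeg_sym_form_def)

lemma orthogonal_sum_carrier:
  "A \<in> carrier_mat n n \<Longrightarrow> B \<in> carrier_mat m m \<Longrightarrow> orthogonal_sum A B \<in> carrier_mat (n + m) (n + m)"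
  unfolding orthogonal_sum_def by auto

lemma orthogonal_sum_det:
  assumes "A \<in> carrier_mat n n" "B \<in> carrier_mat m m"
  shows "det (orthogonal_sum A B) = det A * det B"
  using det_four_block_mat_lower_left_zero[OF assms(1) _ _ assms(2), of "0\<^sub>m n m" "0\<^sub>m m n"] assms
  unfolding orthogonal_sum_def by auto

lemma orthogonal_sum_transpose:
  assumes "A \<in> carrier_mat n n" "B \<in> carrier_mat m m"
  shows "transpose_mat (orthogonal_sum A B) = orthogonal_sum (transpose_mat A) (transpose_mat B)"
  using assms unfolding orthogonal_sum_def by (auto intro!: eq_matI)

lemma orthogonal_sum_mult:
  assumes "A \<in> carrier_mat n n" "B \<in> carrier_mat m m" "C \<in> carrier_mat n n" "D \<in> carrier_mat m m"
  shows "orthogonal_sum A B * orthogonal_sum C D = orthogonal_sum (A * C) (B * D)"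
  using assms unfolding orthogonal_sum_def
  by (subst mult_four_block_mat[of _ n n _ m _ m _ _ n _ m]) auto

lemma nondeg_sym_form_sum:
  assumes "nondeg_sym_form A" "nondeg_sym_form B"
  shows "nondeg_sym_form (orthogonal_sum A B)"
proof -
  have A: "A \<in> carrier_mat (dim_row A) (dim_row A)" and B: "B \<in> carrier_mat (dim_row B) (dim_row B)"
    using assms by (auto simp: nondeg_sym_form_def)
  show ?thesis
    using assms orthogonal_sum_carrier[OF A B] orthogonal_sum_det[OF A B] orthogonal_sum_transpose[OF A B]
    unfolding nondeg_sym_form_def by auto
qed

lemma isometric_sum:
  assumes "isometric A A'" "isometric B B'"
  shows "isometric (orthogonal_sum A B) (orthogonal_sum A' B')"
proof -
  from assms(1) obtain n P where A: "nondeg_sym_form A" and A': "nondeg_sym_form A'"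
    and cA: "A \<in> carrier_mat n n" and cA': "A' \<in> carrier_mat n n"
    and P: "P \<in> carrier_mat n n" and dP: "det P \<noteq> 0"
    and eq: "A' = transpose_mat P * A * P"
    by (rule isometricE)
  from assms(2) obtain m Q where B: "nondeg_sym_form B" and B': "nondeg_sym_form B'"
    and cB: "B \<in> carrier_mat m m" and cB': "B' \<in> carrier_mat m m"
    and Q: "Q \<in> carrier_mat m m" and dQ: "det Q \<noteq> 0"
    and eq2: "B' = transpose_mat Q * B * Q"
    by (rule isometricE)
  note c = cA cA' cB cB'
  have "orthogonal_sum A' B' =
      transpose_mat (orthogonal_sum P Q) * orthogonal_sum A B * orthogonal_sum P Q"
    unfolding orthogonal_sum_transpose[OF P Q] eq eq2
    using P Q c by (simp add: orthogonal_sum_mult[of _ n _ m])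
  then show ?thesis
    using isometricI[OF nondeg_sym_form_sum[OF A B] nondeg_sym_form_sum[OF A' B']
        orthogonal_sum_carrier[OF c(1,3)] orthogonal_sum_carrier[OF c(2,4)]
        orthogonal_sum_carrier[OF P Q]] orthogonal_sum_det[OF P Q] dP dQ by auto
qed

lemma isometric_sum_commute:
  assumes A: "nondeg_sym_form A" and B: "nondeg_sym_form B"
  shows "isometric (orthogonal_sum A B) (orthogonal_sum B A)"
proof -
  define n m where "n = dim_row A" and "m = dim_row B"
  have c: "A \<in> carrier_mat n n" "B \<in> carrier_mat m m"
    by (rule nondeg_sym_formD(1)[OF A n_def[symmetric]] nondeg_sym_formD(1)[OF B m_def[symmetric]])+
  define P :: "'a mat"
    where "P = four_block_mat (0\<^sub>m n m) (1\<^sub>m n) (1\<^sub>m m) (0\<^sub>m m n)"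
  have P: "P \<in> carrier_mat (n + m) (n + m)"
    unfolding P_def by (auto simp: add.commute)
  have Pt: "transpose_mat P = four_block_mat (0\<^sub>m m n) (1\<^sub>m m) (1\<^sub>m n) (0\<^sub>m n m)"
    unfolding P_def by (subst transpose_four_block_mat[of _ n m _ n _ m]) auto
  have "transpose_mat P * P = 1\<^sub>m (m + n)"
    unfolding Pt unfolding P_def
    by (subst mult_four_block_mat[of _ m n _ m _ n _ _ m _ n]) auto
  then have "det (transpose_mat P) * det P = 1"
    using det_mult[of "transpose_mat P" "n + m" P] P by simp
  then have dP: "det P \<noteq> 0" by auto
  have d: "dim_row A = n" "dim_col A = n" "dim_row B = m" "dim_col B = m"
    using c by auto
  have 1: "transpose_mat P * orthogonal_sum A B = four_block_mat (0\<^sub>m m n) B A (0\<^sub>m n m)"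
    unfolding Pt orthogonal_sum_def d using c
    by (subst mult_four_block_mat[of _ m n _ m _ n _ _ n _ m]) auto
  have "transpose_mat P * orthogonal_sum A B * P = orthogonal_sum B A"
    unfolding 1 unfolding P_def orthogonal_sum_def d using c
    by (subst mult_four_block_mat[of _ m n _ m _ n _ _ m _ n]) auto
  note eq = this[symmetric]
  have "orthogonal_sum B A \<in> carrier_mat (n + m) (n + m)"
    using orthogonal_sum_carrier[OF c(2,1)] by (simp only: add.commute)
  from isometricI[OF nondeg_sym_form_sum[OF A B] nondeg_sym_form_sum[OF B A]
      orthogonal_sum_carrier[OF c] this P dP eq]
  show ?thesis .
qed

lemma orthogonal_sum_assoc:
  "orthogonal_sum (orthogonal_sum A B) C = orthogonal_sum A (orthogonal_sum B C)"
  unfolding orthogonal_sum_def by (rule assoc_four_block_mat[symmetric])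

quotient_type (overloaded) 'a form_class = "'a::field mat" / partial: isometric
  morphisms rep_form_class form_class
proof (rule part_equivpI)
  show "\<exists>A::'a mat. isometric A A"
    using isometric_refl nondeg_sym_form_zero by blast
  show "symp (isometric :: 'a mat \<Rightarrow> _)"
    by (auto intro: sympI isometric_sym)
  show "transp (isometric :: 'a mat \<Rightarrow> _)"
    by (auto intro: transpI isometric_trans)
qed

instantiation form_class :: (field) comm_monoid_add
begin

lift_definition zero_form_class :: "'a form_class" is "0\<^sub>m 0 0"
  by (rule isometric_refl[OF nondeg_sym_form_zero])

lift_definition plus_form_class :: "'a form_class \<Rightarrow> 'a form_class \<Rightarrow> 'a form_class"
  is orthogonal_sum
  by (rule isometric_sum)

instance
proof
  fix a b c :: "'a form_class"
  show "a + b + c = a + (b + c)"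
  proof (transfer)
    fix A B C :: "'a mat"
    assume "isometric A A" "isometric B B" "isometric C C"
    then have n: "nondeg_sym_form A" "nondeg_sym_form B" "nondeg_sym_form C"
      by (auto simp: isometric_def)
    then show "isometric (orthogonal_sum (orthogonal_sum A B) C)
        (orthogonal_sum A (orthogonal_sum B C))"
      unfolding orthogonal_sum_assoc
      by (intro isometric_refl nondeg_sym_form_sum)
  qed
  show "a + b = b + a"
    by transfer (rule isometric_sum_commute, auto simp: isometric_def)
  show "0 + a = a"
  proof (transfer)
    fix A :: "'a mat"
    assume "isometric A A"
    moreover have "orthogonal_sum (0\<^sub>m 0 0) A = A"
      unfolding orthogonal_sum_def by (auto intro!: eq_matI)
    ultimately show "isometric (orthogonal_sum (0\<^sub>m 0 0) A) A" by simp
  qed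
qed

end

text \<open>Group completion of a commutative monoid: the pair \<open>(a, b)\<close> stands for \<open>a - b\<close>.\<close>

definition groth_rel :: "'m::comm_monoid_add \<times> 'm \<Rightarrow> 'm \<times> 'm \<Rightarrow> bool" where
  "groth_rel p q \<longleftrightarrow> (\<exists>e. fst p + snd q + e = fst q + snd p + e)"

quotient_type (overloaded) 'm groth = "'m::comm_monoid_add \<times> 'm" / groth_rel
proof (rule equivpI)
  show "reflp (groth_rel :: 'm \<times> 'm \<Rightarrow> _)"
    by (auto intro: reflpI simp: groth_rel_def)
  show "symp (groth_rel :: 'm \<times> 'm \<Rightarrow> _)"
  proof (rule sympI)
    fix p q :: "'m \<times> 'm"
    assume "groth_rel p q"
    then obtain e where "fst p + snd q + e = fst q + snd p + e"
      unfolding groth_rel_def by blast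
    from this[symmetric] show "groth_rel q p"
      unfolding groth_rel_def by blast
  qed
  show "transp (groth_rel :: 'm \<times> 'm \<Rightarrow> _)"
  proof (rule transpI)
    fix p q r :: "'m \<times> 'm"
    assume "groth_rel p q" "groth_rel q r"
    then obtain e e' where e: "fst p + snd q + e = fst q + snd p + e"
      and e': "fst q + snd r + e' = fst r + snd q + e'"
      unfolding groth_rel_def by auto
    have "fst p + snd r + (fst q + snd q + e + e') =
        (fst p + snd q + e) + (fst q + snd r + e')"
      by (simp add: ac_simps)
    also have "\<dots> = (fst q + snd p + e) + (fst r + snd q + e')"
      unfolding e e' ..
    also have "\<dots> = fst r + snd p + (fst q + snd q + e + e')"
      by (simp add: ac_simps)
    finally show "groth_rel p r" unfolding groth_rel_def by blast
  qed
qed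

instantiation groth :: (comm_monoid_add) ab_group_add
begin

lift_definition zero_groth :: "'a groth" is "(0, 0)" .

lift_definition plus_groth :: "'a groth \<Rightarrow> 'a groth \<Rightarrow> 'a groth"
  is "\<lambda>p q. (fst p + fst q, snd p + snd q)"
proof -
  fix p p' q q' :: "'a \<times> 'a"
  assume "groth_rel p p'" "groth_rel q q'"
  then obtain e e' where e: "fst p + snd p' + e = fst p' + snd p + e"
      and e': "fst q + snd q' + e' = fst q' + snd q + e'"
      unfolding groth_rel_def by auto
  have "(fst p + fst q) + (snd p' + snd q') + (e + e') =
      (fst p + snd p' + e) + (fst q + snd q' + e')"
    by (simp add: ac_simps)
  also have "\<dots> = (fst p' + fst q') + (snd p + snd q) + (e + e')"
    unfolding e e' by (simp add: ac_simps)
  finally show "groth_rel (fst p + fst q, snd p + snd q) (fst p' + fst q', snd p' + snd q')"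
    unfolding groth_rel_def by auto
qed

lift_definition uminus_groth :: "'a groth \<Rightarrow> 'a groth" is "\<lambda>p. (snd p, fst p)"
proof -
  fix p q :: "'a \<times> 'a"
  assume "groth_rel p q"
  then obtain e where "fst p + snd q + e = fst q + snd p + e"
    unfolding groth_rel_def by blast
  then have "snd p + fst q + e = snd q + fst p + e"
    by (simp add: add.commute)
  then show "groth_rel (snd p, fst p) (snd q, fst q)"
    unfolding groth_rel_def by auto
qed

definition minus_groth :: "'a groth \<Rightarrow> 'a groth \<Rightarrow> 'a groth" where
  "minus_groth a b = a + (- b)"

instance
proof
  fix a b c :: "'a groth"
  show "a + b + c = a + (b + c)"
    by transfer (auto simp: groth_rel_def ac_simps)
  show "a + b = b + a"
    by transfer (auto simp: groth_rel_def ac_simps)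
  show "0 + a = a"
    by transfer (auto simp: groth_rel_def)
  show "- a + a = 0"
    by transfer (auto simp: groth_rel_def ac_simps)
  show "a - b = a + (- b)"
    by (simp add: minus_groth_def)
qed

end

lift_definition groth_of :: "'m::comm_monoid_add \<Rightarrow> 'm groth" is "\<lambda>a. (a, 0)" .

type_synonym 'a gw = "'a form_class groth"

text \<open>Meaningful only for matrices satisfying \<^const>\<open>nondeg_sym_form\<close>.\<close>

definition gw_class :: "'a::field mat \<Rightarrow> 'a gw" where
  "gw_class A = groth_of (form_class A)"

definition gw_unary :: "'a::field \<Rightarrow> 'a gw" where
  "gw_unary a = gw_class (mat 1 1 (\<lambda>_. a))"

definition gw_hyperbolic :: "'a::field gw" where
  "gw_hyperbolic = gw_unary 1 + gw_unary (- 1)"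


section \<open>Field extensions and the trace on Grothendieck-Witt groups\<close>

text \<open>An extension \<open>k/F\<close> is a field homomorphism \<open>\<kappa>\<close> from the type \<open>F\<close> to the type \<open>k\<close>.\<close>

definition perfect_field :: "'a::field itself \<Rightarrow> bool" where
  "perfect_field _ \<longleftrightarrow> (\<forall>p :: 'a poly. irreducible p \<longrightarrow> coprime p (pderiv p))"

definition field_adjoin :: "('a::field \<Rightarrow> 'c::field) \<Rightarrow> 'c \<Rightarrow> 'c set" where
  "field_adjoin \<kappa> c = \<Inter> {K. range \<kappa> \<subseteq> K \<and> c \<in> K \<and>
     (\<forall>u\<in>K. \<forall>v\<in>K. u - v \<in> K \<and> u * v \<in> K \<and> inverse u \<in> K)}"

definition basis_over :: "('a::field \<Rightarrow> 'c::field) \<Rightarrow> 'c list \<Rightarrow> bool" where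
  "basis_over \<kappa> es \<longleftrightarrow>
     (\<forall>u. \<exists>!c. c \<in> carrier_vec (length es) \<and> u = (\<Sum>i<length es. \<kappa> (c $ i) * es ! i))"

definition field_trace :: "('a::field \<Rightarrow> 'c::field) \<Rightarrow> 'c \<Rightarrow> 'a" where
  "field_trace \<kappa> a = (THE \<tau>. \<exists>es M. basis_over \<kappa> es \<and>
     (\<forall>j<length es. a * es ! j = (\<Sum>i<length es. \<kappa> (M i j) * es ! i)) \<and>
     \<tau> = (\<Sum>i<length es. M i i))"

text \<open>\<open>B\<close> is a Gram matrix, in some \<open>F\<close>-basis \<open>bs\<close> of \<open>k\<^sup>n\<close>, of the composition of the form
  \<open>(u, v) \<mapsto> u\<^sup>T A v\<close> on \<open>k\<^sup>n\<close> with the trace of \<open>k/F\<close>.\<close>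

definition trace_form :: "('a::field \<Rightarrow> 'c::field) \<Rightarrow> 'c mat \<Rightarrow> 'a mat \<Rightarrow> bool" where
  "trace_form \<kappa> A B \<longleftrightarrow> (\<exists>bs. set bs \<subseteq> carrier_vec (dim_row A) \<and>
     (\<forall>v \<in> carrier_vec (dim_row A). \<exists>!c. c \<in> carrier_vec (length bs) \<and>
        v = mat_of_cols (dim_row A) bs *\<^sub>v map_vec \<kappa> c) \<and>
     B = mat (length bs) (length bs) (\<lambda>(i, j). field_trace \<kappa> (bs ! i \<bullet> (A *\<^sub>v bs ! j))))"

text \<open>The additive extension of \<^const>\<open>trace_form\<close> to \<open>GW(k) \<rightarrow> GW(F)\<close>; it is well defined for finite
  separable \<open>k/F\<close>.\<close>

definition gw_trace :: "('a::field \<Rightarrow> 'c::field) \<Rightarrow> 'c gw \<Rightarrow> 'a gw" where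
  "gw_trace \<kappa> z = (THE w. \<exists>A A' B B'. nondeg_sym_form A \<and> nondeg_sym_form A' \<and>
     z = gw_class A - gw_class A' \<and> trace_form \<kappa> A B \<and> trace_form \<kappa> A' B' \<and>
     w = gw_class B - gw_class B')"


section \<open>The curve and its local rings\<close>

text \<open>A polynomial in \<open>F[x, y]\<close> is an element of \<^typ>\<open>'a poly poly\<close>: the outer variable is \<open>y\<close> and the
  coefficients lie in \<open>F[x]\<close>.\<close>

definition eval2 :: "('a::field \<Rightarrow> 'b::field) \<Rightarrow> 'a poly poly \<Rightarrow> 'b \<Rightarrow> 'b \<Rightarrow> 'b" where
  "eval2 \<iota> h x y = poly (map_poly (\<lambda>c. poly (map_poly \<iota> c) x) h) y"

text \<open>Jacobian criterion for \<open>y\<^sup>2 - f(x)\<close>: the polynomial and its two partial derivatives generate the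
  unit ideal of \<open>F[x, y]\<close>. The chart at infinity is smooth whenever \<open>deg f\<close> is odd.\<close>

definition smooth_affine_model :: "'a::field poly \<Rightarrow> bool" where
  "smooth_affine_model f \<longleftrightarrow> (\<exists>A B C :: 'a poly poly.
     A * ([:0, 1:]\<^sup>2 - [:f:]) + B * (2 * [:0, 1:]) + C * [:pderiv f:] = 1)"

definition transcendental_over :: "('a::field \<Rightarrow> 'b::field) \<Rightarrow> 'b \<Rightarrow> bool" where
  "transcendental_over \<iota> t \<longleftrightarrow> (\<forall>h. poly (map_poly \<iota> h) t = 0 \<longrightarrow> h = 0)"

text \<open>The function field of \<open>X\<close> is realised as the subfield \<open>F(x, y)\<close> of an arbitrary extension of
  \<open>F\<close> (such as an algebraic closure of \<open>F(x)\<close>); the ambient field may be larger than \<open>F(X)\<close>.\<close>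

definition hyperelliptic_functions ::
  "('a::field \<Rightarrow> 'b::field) \<Rightarrow> 'a poly \<Rightarrow> 'b \<Rightarrow> 'b \<Rightarrow> bool" where
  "hyperelliptic_functions \<iota> f x y \<longleftrightarrow>
     field_hom \<iota> \<and> transcendental_over \<iota> x \<and> y\<^sup>2 = poly (map_poly \<iota> f) x"

text \<open>A closed point of the affine curve is given by its ideal in \<open>F[x, y]\<close>, which contains
  \<open>y\<^sup>2 - f(x)\<close>. For coordinates \<open>\<gamma>, \<delta>\<close> in an extension of \<open>F\<close> it is the ideal of polynomials
  vanishing at \<open>(\<gamma>, \<delta>)\<close>.\<close>

definition point_ideal :: "('a::field \<Rightarrow> 'c::field) \<Rightarrow> 'c \<Rightarrow> 'c \<Rightarrow> 'a poly poly set" where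
  "point_ideal \<kappa> \<gamma> \<delta> = {h. eval2 \<kappa> h \<gamma> \<delta> = 0}"

definition local_ring ::
  "('a::field \<Rightarrow> 'b::field) \<Rightarrow> 'b \<Rightarrow> 'b \<Rightarrow> 'a poly poly set \<Rightarrow> 'b set" where
  "local_ring \<iota> x y P = {eval2 \<iota> u x y / eval2 \<iota> v x y | u v. v \<notin> P}"

definition local_ideal ::
  "('a::field \<Rightarrow> 'b::field) \<Rightarrow> 'b \<Rightarrow> 'b \<Rightarrow> 'a poly poly set \<Rightarrow> 'b set" where
  "local_ideal \<iota> x y P = {eval2 \<iota> u x y / eval2 \<iota> v x y | u v. u \<in> P \<and> v \<notin> P}"

definition ideal_span :: "'b::field set \<Rightarrow> 'b set \<Rightarrow> 'b set" where
  "ideal_span R S = {\<Sum>i<(n::nat). a i * s i | n a s. \<forall>i<n. a i \<in> R \<and> s i \<in> S}"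

definition ideal_pow :: "'b::field set \<Rightarrow> 'b set \<Rightarrow> nat \<Rightarrow> 'b set" where
  "ideal_pow R m n = ideal_span R {\<Prod>i<n. b i | b. \<forall>i<n. b i \<in> m}"

abbreviation principal_ideal :: "'b::field set \<Rightarrow> 'b \<Rightarrow> 'b set" where
  "principal_ideal R \<phi> \<equiv> {\<phi> * u | u. u \<in> R}"


section \<open>Hasse Wronskians and the local Euler index\<close>

text \<open>\<open>R\<close> is a local ring of the curve with maximal ideal \<open>m\<close>. The map \<open>t\<close> to the affine line is etale at
  the point, i.e. flat (\<open>R\<close> is a torsion-free \<open>F[t]\<close>-module) and unramified (the maximal ideal of
  the image point, \<open>{h(t) | h(t) \<in> m}\<close>, generates \<open>m\<close>), and it induces an isomorphism of residue fields
  (which makes the separability required by unramifiedness automatic).\<close>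

definition nisnevich_coordinate ::
  "('a::field \<Rightarrow> 'b::field) \<Rightarrow> 'b set \<Rightarrow> 'b set \<Rightarrow> 'b \<Rightarrow> bool" where
  "nisnevich_coordinate \<iota> R m t \<longleftrightarrow> t \<in> R \<and> transcendental_over \<iota> t \<and>
     m = ideal_span R {poly (map_poly \<iota> h) t | h. poly (map_poly \<iota> h) t \<in> m} \<and>
     (\<forall>u\<in>R. \<exists>h. u - poly (map_poly \<iota> h) t \<in> m)"

text \<open>The Hasse derivatives on the local ring (germs of those on a neighbourhood).\<close>

definition hasse_derivatives ::
  "('a::field \<Rightarrow> 'b::field) \<Rightarrow> 'b set \<Rightarrow> 'b \<Rightarrow> (nat \<Rightarrow> 'b \<Rightarrow> 'b) \<Rightarrow> bool" where
  "hasse_derivatives \<iota> R t D \<longleftrightarrow>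
     (\<forall>k. \<forall>u\<in>R. D k u \<in> R) \<and>
     (\<forall>k. \<forall>u\<in>R. \<forall>v\<in>R. D k (u + v) = D k u + D k v) \<and>
     (\<forall>k c. \<forall>u\<in>R. D k (\<iota> c * u) = \<iota> c * D k u) \<and>
     (\<forall>u\<in>R. D 0 u = u) \<and>
     (\<forall>k. \<forall>u\<in>R. \<forall>v\<in>R. D k (u * v) = (\<Sum>i\<le>k. D i u * D (k - i) v)) \<and>
     (\<forall>k n. D k (t ^ n) = of_nat (n choose k) * t ^ (n - k))"

definition wronskian :: "(nat \<Rightarrow> 'b::field \<Rightarrow> 'b) \<Rightarrow> 'b list \<Rightarrow> 'b" where
  "wronskian D ls = det (mat (length ls) (length ls) (\<lambda>(i, j). D i (ls ! j)))"

text \<open>\<open>(G(t\<^sub>1) - G(t\<^sub>2)) / (t\<^sub>1 - t\<^sub>2)\<close> in \<open>F[t\<^sub>2][t\<^sub>1]\<close>.\<close>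

definition difference_quotient :: "'a::field poly \<Rightarrow> 'a poly poly" where
  "difference_quotient G = (map_poly (\<lambda>c. [:c:]) G - [:G:]) div [:- [:0, 1:], 1:]"

text \<open>Elements of \<open>A = R/(\<phi>)\<close> are represented by elements of \<open>R\<close>: \<open>\<eta>\<close> is a linear functional on \<open>R\<close>
  vanishing on \<open>(\<phi>)\<close>, and the image of the difference quotient in \<open>A \<otimes> A\<close> is written as
  \<open>\<Sum> (H\<^sub>i\<^sub>j t\<^sup>i) \<otimes> t\<^sup>j\<close>, where \<open>H\<^sub>i\<^sub>j\<close> is the coefficient at \<open>t\<^sub>1\<^sup>i t\<^sub>2\<^sup>j\<close>.\<close>

definition ekl_functional ::
  "('a::field \<Rightarrow> 'b::field) \<Rightarrow> 'b set \<Rightarrow> 'b \<Rightarrow> 'b \<Rightarrow> 'a poly \<Rightarrow> ('b \<Rightarrow> 'a) \<Rightarrow> bool" where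
  "ekl_functional \<iota> R t \<phi> G \<eta> \<longleftrightarrow>
     (\<forall>u\<in>R. \<forall>v\<in>R. \<eta> (u + v) = \<eta> u + \<eta> v) \<and>
     (\<forall>c. \<forall>u\<in>R. \<eta> (\<iota> c * u) = c * \<eta> u) \<and>
     (\<forall>u \<in> principal_ideal R \<phi>. \<eta> u = 0) \<and>
     (let H = difference_quotient G in
        (\<Sum>i\<le>degree H. \<Sum>j\<le>degree (coeff H i). \<iota> (\<eta> (\<iota> (coeff (coeff H i) j) * t ^ i)) * t ^ j) - 1
          \<in> principal_ideal R \<phi>)"

definition quotient_basis ::
  "('a::field \<Rightarrow> 'b::field) \<Rightarrow> 'b set \<Rightarrow> 'b \<Rightarrow> 'b list \<Rightarrow> bool" where
  "quotient_basis \<iota> R \<phi> es \<longleftrightarrow> set es \<subseteq> R \<and>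
     (\<forall>u\<in>R. \<exists>!c. c \<in> carrier_vec (length es) \<and>
        u - (\<Sum>i<length es. \<iota> (c $ i) * es ! i) \<in> principal_ideal R \<phi>)"

text \<open>\<open>w\<close> is the class obtained from some admissible choice of \<open>n\<close> and \<open>G\<close> (and of a basis of \<open>A\<close>), for a
  fixed coordinate \<open>t\<close>.\<close>

definition euler_index_via ::
  "('a::field \<Rightarrow> 'b::field) \<Rightarrow> 'b set \<Rightarrow> 'b set \<Rightarrow> 'b \<Rightarrow> 'b list \<Rightarrow> 'a gw \<Rightarrow> bool" where
  "euler_index_via \<iota> R m t ls w \<longleftrightarrow> (\<exists>D \<phi> n G \<eta> es.
     hasse_derivatives \<iota> R t D \<and> \<phi> = wronskian D ls \<and> \<phi> \<in> m \<and>
     ideal_pow R m n \<subseteq> principal_ideal R \<phi> \<and>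
     poly (map_poly \<iota> G) t - \<phi> \<in> ideal_pow R m (2 * n) \<and>
     ekl_functional \<iota> R t \<phi> G \<eta> \<and> quotient_basis \<iota> R \<phi> es \<and>
     w = gw_class (mat (length es) (length es) (\<lambda>(i, j). \<eta> (es ! i * es ! j))))"

text \<open>The index at the point with ideal \<open>P\<close>. The use of \<open>THE\<close> records that the class does not depend on
  any of the choices. The section is trivialised by \<open>s = 1\<close> and \<open>dt\<close>, which are compatible with the
  relative orientation, so no correction factor appears.\<close>

definition local_euler_index ::
  "('a::field \<Rightarrow> 'b::field) \<Rightarrow> 'b \<Rightarrow> 'b \<Rightarrow> 'a poly poly set \<Rightarrow> 'b list \<Rightarrow> 'a gw" where
  "local_euler_index \<iota> x y P ls = (THE w. \<exists>a b.
     let t = \<iota> a * x + \<iota> b * y; R = local_ring \<iota> x y P; m = local_ideal \<iota> x y P in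
       nisnevich_coordinate \<iota> R m t \<and> euler_index_via \<iota> R m t ls w)"


section \<open>The complete linear series\<close>

definition series_basis :: "nat \<Rightarrow> nat \<Rightarrow> 'b::field \<Rightarrow> 'b \<Rightarrow> 'b list" where
  "series_basis l g x y =
     concat (map (\<lambda>i. [x ^ i, x ^ i * y]) [0..<l - g]) @ map (\<lambda>i. x ^ i) [l - g..<l + 1]"

definition binomial_matrix :: "nat \<Rightarrow> nat \<Rightarrow> int mat" where
  "binomial_matrix l g = mat (g + 1) (g + 1)
     (\<lambda>(i, j). if i \<le> 2 * j then of_nat ((l - g + j) choose (2 * j - i)) else 0)"

end

theory Submission
  imports Defs "Jordan_Normal_Form.Char_Poly" "HOL-Computational_Algebra.Polynomial_FPS"
begin

text \<open>Let \<open>t = a x + b y\<close> be an admissible coordinate, \<open>k = F(\<gamma>) = F(\<tau>)\<close> with \<open>\<tau> = a \<gamma>\<close>, and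
  \<open>s = t - \<tau>\<close>. Germs at the point expand in \<open>k[[s]]\<close>, and \<open>y = s / b + \<dots>\<close>,
  \<open>x - \<gamma> = s\<^sup>2 / (b\<^sup>2 f'(\<gamma>)) + \<dots>\<close>. Replacing \<open>x\<close> by \<open>x - \<gamma>\<close> changes the basis \<open>\<lambda>\<close> by a unitriangular
  matrix and makes the orders of vanishing distinct, so the Wronskian has order \<open>N = \<Sum>\<^sub>i\<^sub>\<le>\<^sub>g i\<close> and its
  leading coefficient \<open>\<delta>\<close> is the product of the leading coefficients of the basis and of the determinant
  of the \<open>binom(e\<^sub>j, i)\<close>, where \<open>e\<^sub>j\<close> are the orders. Column operations identify this determinant with
  \<open>2\<^sup>N det M(l, g)\<close>.

  On the other hand, \<open>p(t)\<close> is a uniformiser for the minimal polynomial \<open>p\<close> of \<open>\<tau>\<close>, and every functional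
  on \<open>R/(\<phi>)\<close> has the form \<open>u \<mapsto> Tr (\<Sum>\<^sub>n l\<^sub>n u\<^sub>n)\<close> with the coefficients \<open>u\<^sub>n\<close> of the expansion of \<open>u\<close>. The
  normalisation by the difference quotient, read modulo the maximal ideal, says exactly
  \<open>l\<^sub>N\<^sub>-\<^sub>1 = 1 / \<delta>\<close>. Hence the index is the trace of the Hankel form \<open>(l\<^sub>i\<^sub>+\<^sub>j)\<close>, which is triangular with
  respect to the antidiagonal: it is a sum of hyperbolic planes and, for odd \<open>N\<close>, of
  \<open>\<langle>1 / \<delta>\<rangle>\<close>.\<close>


section \<open>Antitriangular forms\<close>

text \<open>Both the index and the trace on classes are definite descriptions (\<open>THE\<close>),
  so each needs one admissible choice and the agreement of all choices. Agreement for the index: a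
  Nisnevich coordinate has b nonzero, since polynomials in x that vanish at the point vanish to
  order at least 2; every such coordinate has a chart, and the axioms determine the expansions of
  Hasse derivatives, so \<delta> depends on the coordinate only through b. Existence: x + y is
  admissible, and its Hasse derivatives are the coefficients of the expansion at the generic point
  (x, y). The result is independent of b because only the square class of 1/\<delta> matters, which
  is that of \<delta>. With leading coefficients v = 1/b of y and u = v^2/f'(\<gamma>) of x -
  \<gamma>, the basis contributes a square times v^(l-g) u^e. In the case of odd N, l - g is even
  and e is odd, which leaves f'(\<gamma>); the factor 2^N leaves 2. For even N the Hankel form has
  no middle entry and \<delta> disappears. Perfectness enters through the minimal polynomial p:
  p'(\<tau>) nonzero makes p(t) a uniformiser and the trace pairing of k/F nondegenerate.\<close>

lemma mult_mat_index_sum: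
  assumes "A \<in> carrier_mat n k" "B \<in> carrier_mat k m" "i < n" "j < m"
  shows "(A * B) $$ (i, j) = (\<Sum>l<k. A $$ (i, l) * B $$ (l, j))"
  using assms by (auto simp: scalar_prod_def lessThan_atLeast0 intro!: sum.cong)

lemma congruence_index_sum:
  assumes "A \<in> carrier_mat n n" "P \<in> carrier_mat n m" "i < m" "j < m"
  shows "(transpose_mat P * A * P) $$ (i, j) =
    (\<Sum>k<n. \<Sum>l<n. P $$ (k, i) * A $$ (k, l) * P $$ (l, j))"
proof -
  have "(transpose_mat P * A * P) $$ (i, j)
      = (\<Sum>l<n. (transpose_mat P * A) $$ (i, l) * P $$ (l, j))"
    using assms by (intro mult_mat_index_sum[where n = m and m = m]) auto
  also have "\<dots> = (\<Sum>l<n. \<Sum>k<n. P $$ (k, i) * A $$ (k, l) * P $$ (l, j))"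
  proof (rule sum.cong[OF refl])
    fix l assume "l \<in> {..<n}"
    then have "(transpose_mat P * A) $$ (i, l) = (\<Sum>k<n. transpose_mat P $$ (i, k) * A $$ (k, l))"
      using assms by (intro mult_mat_index_sum[where n = m and m = n]) auto
    also have "\<dots> = (\<Sum>k<n. P $$ (k, i) * A $$ (k, l))"
      using assms by (intro sum.cong) auto
    finally show "(transpose_mat P * A) $$ (i, l) * P $$ (l, j)
        = (\<Sum>k<n. P $$ (k, i) * A $$ (k, l) * P $$ (l, j))"
      by (simp add: sum_distrib_right)
  qed
  also have "\<dots> = (\<Sum>k<n. \<Sum>l<n. P $$ (k, i) * A $$ (k, l) * P $$ (l, j))"
    by (rule sum.swap)
  finally show ?thesis .
qed

lemma det_congruence:
  assumes "A \<in> carrier_mat n n" "P \<in> carrier_mat n n"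
  shows "det (transpose_mat P * A * P) = det P ^ 2 * (det A :: 'a::comm_ring_1)"
proof -
  have "det (transpose_mat P * A * P) = det (transpose_mat P) * det A * det P"
    using assms by (metis det_mult mult_carrier_mat transpose_carrier_mat)
  then show ?thesis
    using det_transpose[OF assms(2)] by (simp add: power2_eq_square mult_ac)
qed

lemma symmetric_congruence:
  assumes "A \<in> carrier_mat n n" "P \<in> carrier_mat n m" "transpose_mat A = A"
  shows "transpose_mat (transpose_mat P * A * P) = transpose_mat P * (A :: 'a::comm_ring_1 mat) * P"
proof -
  have "transpose_mat (transpose_mat P * A * P) = transpose_mat P * transpose_mat (transpose_mat P * A)"
    using assms(1,2) by (intro transpose_mult[of _ m n]) auto
  also have "transpose_mat (transpose_mat P * A) = transpose_mat A * P"
    using assms(1,2) transpose_mult[of "transpose_mat P" m n A n] by simp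
  finally show ?thesis
    using assms by (simp add: assoc_mult_mat[of _ m n _ n _ m])
qed

text \<open>Since \<open>det B = det P ^ 2 * det A\<close>, the single condition on
  \<open>det B\<close> gives nondegeneracy of \<open>A\<close> and invertibility of
  \<open>P\<close>; in applications only the simpler matrix \<open>B\<close> has to be
  examined.\<close>

lemma isometric_congruence:
  assumes A: "A \<in> carrier_mat n n" "transpose_mat A = A" and P: "P \<in> carrier_mat n n"
    and B: "B = transpose_mat P * A * P" and d: "det B \<noteq> 0"
  shows "nondeg_sym_form A" "nondeg_sym_form B" "isometric A B"
proof -
  have dd: "det A \<noteq> 0" "det P \<noteq> 0"
    using d det_congruence[OF A(1) P] unfolding B by auto
  have cB: "B \<in> carrier_mat n n" unfolding B using A P by simp
  show nA: "nondeg_sym_form A" using A dd by (auto simp: nondeg_sym_form_def)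
  show nB: "nondeg_sym_form B"
    using cB symmetric_congruence[OF A(1) P A(2)] d unfolding B by (auto simp: nondeg_sym_form_def)
  show "isometric A B"
    by (rule isometricI[OF nA nB A(1) cB P dd(2) B])
qed

section \<open>Classes of matrices in the Grothendieck-Witt group\<close>

lemma gw_class_isometric:
  assumes "isometric A B"
  shows "gw_class A = gw_class B"
  using Quotient3_rel_abs[OF Quotient3_form_class assms] by (simp add: gw_class_def)

lemma groth_of_add: "groth_of (a + b) = groth_of a + groth_of b"
  by transfer (simp add: groth_rel_def)

lemma form_class_sum:
  assumes "nondeg_sym_form A" "nondeg_sym_form B"
  shows "form_class (orthogonal_sum A B) = form_class A + form_class B"
  by (rule plus_form_class.abs_eq[OF isometric_refl isometric_refl, OF assms, symmetric])

lemma gw_class_sum: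
  assumes "nondeg_sym_form A" "nondeg_sym_form B"
  shows "gw_class (orthogonal_sum A B) = gw_class A + gw_class B"
  by (simp add: gw_class_def form_class_sum[OF assms] groth_of_add)

lemma gw_class_zero: "gw_class (0\<^sub>m 0 0) = 0"
  unfolding gw_class_def zero_form_class.abs_eq[symmetric] zero_groth_def groth_of_def
  by (simp add: groth_of.abs_eq zero_groth.abs_eq)

lemma nondeg_sym_form_unary: "c \<noteq> 0 \<Longrightarrow> nondeg_sym_form (mat 1 1 (\<lambda>_. c))"
  by (auto simp: nondeg_sym_form_def det_single)

text \<open>Rescaling of the basis vector by \<open>d\<close>. This is what allows square factors of
  the leading coefficient of the Wronskian to be dropped.\<close>

lemma gw_unary_mult_square:
  assumes "c \<noteq> 0" "d \<noteq> 0"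
  shows "gw_unary (c * d\<^sup>2) = gw_unary c"
proof -
  have "mat 1 1 (\<lambda>_. c * d\<^sup>2) = transpose_mat (mat 1 1 (\<lambda>_. d)) * mat 1 1 (\<lambda>_. c) * mat 1 1 (\<lambda>_. d)"
  proof (rule eq_matI, goal_cases)
    case (1 i j)
    then show ?case
      by (subst congruence_index_sum[where n = 1 and m = 1]) (auto simp: power2_eq_square)
  qed auto
  from isometric_congruence(3)[OF _ _ _ this, of 1]
  have "isometric (mat 1 1 (\<lambda>_. c)) (mat 1 1 (\<lambda>_. c * d\<^sup>2))"
    using assms nondeg_sym_form_unary[of c] by (auto simp: det_single nondeg_sym_form_def)
  then show ?thesis
    unfolding gw_unary_def by (rule gw_class_isometric[symmetric])
qed

lemma congruence_index_2:
  assumes "A \<in> carrier_mat 2 2" "P \<in> carrier_mat 2 2" "i < 2" "j < 2"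
  shows "(transpose_mat P * A * P) $$ (i, j) =
    P $$ (0, i) * A $$ (0, 0) * P $$ (0, j) + P $$ (0, i) * A $$ (0, 1) * P $$ (1, j) +
    (P $$ (1, i) * A $$ (1, 0) * P $$ (0, j) + P $$ (1, i) * A $$ (1, 1) * P $$ (1, j))"
proof -
  have "(\<Sum>k<2. u k) = u 0 + u 1" for u :: "nat \<Rightarrow> 'a" by (simp add: numeral_2_eq_2)
  then show ?thesis by (simp only: congruence_index_sum[OF assms])
qed

lemma gw_class_antidiagonal_plane:
  assumes "(2::'a::field) \<noteq> 0"
  defines "J \<equiv> mat 2 2 (\<lambda>(i, j). if i = j then 0 else (1::'a))"
  shows "nondeg_sym_form J" "gw_class J = gw_hyperbolic"
proof -
  define D where "D = orthogonal_sum (mat 1 1 (\<lambda>_. 1)) (mat 1 1 (\<lambda>_. - 1 :: 'a))"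
  define h :: 'a where "h = 1 / 2"
  have h: "h + h = 1"
    using assms(1) by (simp add: h_def flip: add_divide_distrib)
  \<comment> \<open>The columns are the vectors e0 + e1 and (e0 - e1)/2, isotropic for the diagonal
    form with entries 1 and -1; they pair to h + h = 1.\<close>
  define P where "P = mat 2 2 (\<lambda>(i, j). if j = 0 then 1 else if i = 0 then h else - h)"
  have cJ: "J \<in> carrier_mat 2 2" and cP: "P \<in> carrier_mat 2 2"
    unfolding J_def P_def by simp_all
  have cD: "D \<in> carrier_mat 2 2"
    unfolding D_def orthogonal_sum_def carrier_mat_def by simp
  have D: "D $$ (i, j) = (if i = j then if i = 0 then 1 else - 1 else 0)" if "i < 2" "j < 2" for i j
    using that unfolding D_def orthogonal_sum_def by auto
  have J: "J $$ (i, j) = (if i = j then 0 else 1)" if "i < 2" "j < 2" for i j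
    using that by (simp add: J_def)
  have P: "P $$ (i, j) = (if j = 0 then 1 else if i = 0 then h else - h)" if "i < 2" "j < 2" for i j
    using that by (simp add: P_def)
  \<comment> \<open>The symmetric matrix \<open>J\<close> is its own inverse, so its determinant is
    nonzero without being computed.\<close>
  have "transpose_mat J * 1\<^sub>m 2 * J = 1\<^sub>m 2"
  proof (rule eq_matI)
    fix i j :: nat assume "i < dim_row (1\<^sub>m 2 :: 'a mat)" "j < dim_col (1\<^sub>m 2 :: 'a mat)"
    then have ij: "i < 2" "j < 2" by simp_all
    then show "(transpose_mat J * 1\<^sub>m 2 * J) $$ (i, j) = 1\<^sub>m 2 $$ (i, j)"
      by (subst congruence_index_2[OF _ cJ ij]) (auto simp: J less_2_cases_iff)
  qed (use cJ in simp_all)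
  then have dJ: "det J \<noteq> 0" using det_congruence[OF one_carrier_mat cJ] by auto
  have JD: "J = transpose_mat P * D * P"
  proof (rule eq_matI)
    fix i j assume "i < dim_row (transpose_mat P * D * P)" "j < dim_col (transpose_mat P * D * P)"
    then have ij: "i < 2" "j < 2" using cP by simp_all
    show "J $$ (i, j) = (transpose_mat P * D * P) $$ (i, j)"
      using ij h by (subst congruence_index_2[OF cD cP ij]) (auto simp: J D P less_2_cases_iff)
  qed (use cJ cP in simp_all)
  have "transpose_mat D = D"
    by (rule eq_matI) (use cD in \<open>auto simp: D\<close>)
  note iso = isometric_congruence[OF cD this cP JD dJ]
  show "nondeg_sym_form J" by (rule iso(2))
  have "gw_class D = gw_hyperbolic"
    unfolding D_def gw_hyperbolic_def gw_unary_def
    by (intro gw_class_sum nondeg_sym_form_unary) simp_all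
  with gw_class_isometric[OF iso(3)] show "gw_class J = gw_hyperbolic" by simp
qed

lemma sum_two_points:
  fixes F :: "nat \<Rightarrow> 'a::comm_ring_1"
  assumes "p < n" "q < n"
  shows "(\<Sum>k<n. ((if k = p then s1 else 0) + (if k = q then s2 else 0)) * F k) = s1 * F p + s2 * F q"
proof -
  have "(\<Sum>k<n. ((if k = p then s1 else 0) + (if k = q then s2 else 0)) * F k) =
      (\<Sum>k<n. (if k = p then s1 * F p else 0) + (if k = q then s2 * F q else 0))"
    by (intro sum.cong) (auto simp: distrib_right)
  then show ?thesis using assms by (simp only: sum.distrib sum.delta) simp
qed

text \<open>Columns of the change of basis in \<open>antitriangular_split\<close> are supported on
  at most two indices, so each entry of the transformed form combines four old ones; coinciding
  indices simply add up.\<close>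

lemma sum_four_points:
  fixes h :: "nat \<Rightarrow> nat \<Rightarrow> 'a::comm_ring_1"
  assumes "p < n" "q < n" "p' < n" "q' < n"
  shows "(\<Sum>k<n. \<Sum>l<n. ((if k = p then s1 else 0) + (if k = q then s2 else 0)) * h k l
          * ((if l = p' then s3 else 0) + (if l = q' then s4 else 0)))
        = s1 * s3 * h p p' + s1 * s4 * h p q' + s2 * s3 * h q p' + s2 * s4 * h q q'"
proof -
  have "(\<Sum>l<n. ((if k = p then s1 else 0) + (if k = q then s2 else 0)) * h k l
      * ((if l = p' then s3 else 0) + (if l = q' then s4 else 0))) =
    ((if k = p then s1 else 0) + (if k = q then s2 else 0)) * (s3 * h k p' + s4 * h k q')" for k
    unfolding sum_two_points[OF assms(3,4), of s3 s4 "h k", symmetric] sum_distrib_left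
    by (intro sum.cong) (simp_all only: mult_ac)
  then show ?thesis
    by (simp only: sum_two_points[OF assms(1,2)]) (simp add: algebra_simps)
qed

text \<open>Split off the hyperbolic plane spanned by the first and the last basis vector.\<close>

lemma antitriangular_split:
  fixes a :: "nat \<Rightarrow> nat \<Rightarrow> 'a::field"
  assumes two: "(2::'a) \<noteq> 0" and c: "c \<noteq> 0"
    and sym: "\<And>i j. a i j = a j i"
    and zero: "\<And>i j. i + j \<ge> n' + 2 \<Longrightarrow> a i j = 0"
    and anti: "\<And>i j. i + j = n' + 1 \<Longrightarrow> a i j = c"
  shows "\<exists>P \<in> carrier_mat (n' + 2) (n' + 2).
    orthogonal_sum (mat n' n' (\<lambda>(i, j). a (i + 1) (j + 1))) (mat 2 2 (\<lambda>(i, j). if i = j then 0 else 1)) =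
    transpose_mat P * mat (n' + 2) (n' + 2) (\<lambda>(i, j). a i j) * P"
proof -
  define n where "n = n' + 2"
  define A where "A = mat n n (\<lambda>(i, j). a i j)"
  define A' where "A' = mat n' n' (\<lambda>(i, j). a (i + 1) (j + 1))"
  define J where "J = mat 2 2 (\<lambda>(i, j). if i = j then 0 else (1::'a))"
  define B where "B = orthogonal_sum A' J"
  \<comment> \<open>The new basis starts from e_(j+1) for j < n', then e_0, then e_(n'+1)/c, each
    corrected by the multiple \<open>r j\<close> of e_(n'+1). That vector pairs only with e_0, with
    value c. Hence the corrections leave the values among the first n' vectors unchanged, make these
    orthogonal to e_0, and, through the halved coefficient, make the new e_0 isotropic.\<close>
  define \<sigma> where "\<sigma> j = (if j < n' then j + 1 else if j = n' then 0 else n' + 1)" for j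
  define s where "s j = (if j = n' + 1 then 1 / c else 1)" for j
  define r where "r j = (if j < n' then - a 0 (j + 1) / c
      else if j = n' then - a 0 0 / (2 * c) else 0)" for j
  define P where "P = mat n n (\<lambda>(k, j).
      (if k = \<sigma> j then s j else 0) + (if k = n' + 1 then r j else 0))"
  have sg: "\<sigma> j < n" for j by (auto simp: \<sigma>_def n_def)
  have last: "a (Suc n') k = (if k = 0 then c else 0)" "a k (Suc n') = (if k = 0 then c else 0)" for k
    using zero[of "Suc n'" k] zero[of k "Suc n'"] anti[of "Suc n'" k] anti[of k "Suc n'"] by auto
  have sym0: "a (Suc i) 0 = a 0 (Suc i)" for i by (rule sym)
  have "B = transpose_mat P * A * P"
  proof (rule eq_matI)
    fix i j
    assume "i < dim_row (transpose_mat P * A * P)" "j < dim_col (transpose_mat P * A * P)"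
    then have ij: "i < n" "j < n" by (simp_all add: P_def)
    have cP: "P \<in> carrier_mat n n" and cA: "A \<in> carrier_mat n n" by (simp_all add: P_def A_def)
    have "(transpose_mat P * A * P) $$ (i, j) = (\<Sum>k<n. \<Sum>l<n. P $$ (k, i) * A $$ (k, l) * P $$ (l, j))"
      by (rule congruence_index_sum[OF cA cP ij])
    also have "\<dots> = (\<Sum>k<n. \<Sum>l<n. ((if k = \<sigma> i then s i else 0) + (if k = Suc n' then r i else 0))
        * a k l * ((if l = \<sigma> j then s j else 0) + (if l = Suc n' then r j else 0)))"
      using ij by (intro sum.cong) (simp_all add: P_def A_def)
    also have "\<dots> = s i * s j * a (\<sigma> i) (\<sigma> j) + s i * r j * a (\<sigma> i) (Suc n')
        + r i * s j * a (Suc n') (\<sigma> j) + r i * r j * a (Suc n') (Suc n')"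
      using sg by (intro sum_four_points) (simp_all add: n_def)
    also have "\<dots> = B $$ (i, j)"
    proof -
      have Bij: "B $$ (i, j) = (if i < n' then if j < n' then a (i + 1) (j + 1) else 0
          else if j < n' then 0 else if i = j then 0 else 1)"
        using ij by (auto simp: B_def orthogonal_sum_def A'_def J_def n_def)
      have v: "\<sigma> j = Suc j" "s j = 1" "r j = - a 0 (Suc j) / c" if "j < n'" for j
        using that by (simp_all add: \<sigma>_def s_def r_def)
      have v': "\<sigma> n' = 0" "s n' = 1" "r n' = - a 0 0 / (2 * c)"
          "\<sigma> (Suc n') = Suc n'" "s (Suc n') = 1 / c" "r (Suc n') = 0"
        by (simp_all add: \<sigma>_def s_def r_def)
      have half: "x * c / (2 * c) + x * c / (2 * c) = x" for x
      proof -
        have "x * c / (2 * c) + x * c / (2 * c) = (x + x) * c / (2 * c)"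
          by (simp only: add_divide_distrib distrib_right)
        also have "\<dots> = (x * (2 * c)) / (2 * c)"
          by (simp only: mult_2 distrib_left distrib_right)
        finally show ?thesis using c two by simp
      qed
      consider "i < n'" | "i = n'" | "i = Suc n'" using ij unfolding n_def by linarith
      note i = this
      consider "j < n'" | "j = n'" | "j = Suc n'" using ij unfolding n_def by linarith
      note j = this
      show ?thesis unfolding Bij
        by (rule i; rule j)
          (use c half[of "a 0 0"] in \<open>simp_all add: v v' last sym0\<close>)
    qed
    finally show "B $$ (i, j) = (transpose_mat P * A * P) $$ (i, j)" by (rule HOL.sym)
  qed (simp_all add: B_def orthogonal_sum_def A'_def J_def P_def n_def)
  then show ?thesis
    by (intro bexI[of _ P]) (simp_all add: B_def A_def A'_def J_def n_def P_def)
qed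

text \<open>Splitting off a plane removes the first and the last vector and shifts both indices by
  one, so i + j drops by 2 together with the size: what remains is again antitriangular with the
  same value c on the antidiagonal. Odd sizes end in the form c of rank 1.\<close>

lemma antitriangular_form:
  fixes a :: "nat \<Rightarrow> nat \<Rightarrow> 'a::field"
  assumes two: "(2::'a) \<noteq> 0" and c: "c \<noteq> 0"
    and "\<And>i j. a i j = a j i" "\<And>i j. i + j \<ge> n \<Longrightarrow> a i j = 0"
    and "\<And>i j. i + j + 1 = n \<Longrightarrow> a i j = c"
  shows "nondeg_sym_form (mat n n (\<lambda>(i, j). a i j)) \<and>
    gw_class (mat n n (\<lambda>(i, j). a i j)) =
      (\<Sum>_<n div 2. gw_hyperbolic) + (if odd n then gw_unary c else 0)"
  using assms(3-)
proof (induction n arbitrary: a rule: less_induct)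
  case (less n a)
  consider "n = 0" | "n = 1" | n' where "n = n' + 2"
  proof -
    have "n = 0 \<or> n = 1 \<or> n = (n - 2) + 2" by linarith
    with that show thesis by blast
  qed
  then show ?case
  proof cases
    case 1
    have "mat 0 0 (\<lambda>(i, j). a i j) = 0\<^sub>m 0 0" by (rule eq_matI) simp_all
    then show ?thesis
      using 1 nondeg_sym_form_zero[where ?'a='a] gw_class_zero[where ?'a='a] by simp
  next
    case 2
    have "a 0 0 = c" by (rule less.prems(3)) (simp add: 2)
    then have "mat 1 1 (\<lambda>(i, j). a i j) = mat 1 1 (\<lambda>_. c)"
      by (intro eq_matI) simp_all
    then show ?thesis
      using 2 nondeg_sym_form_unary[OF c] by (simp add: gw_unary_def)
  next
    case (3 n')
    define A where "A = mat n n (\<lambda>(i, j). a i j)"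
    define A' where "A' = mat n' n' (\<lambda>(i, j). a (i + 1) (j + 1))"
    define J where "J = mat 2 2 (\<lambda>(i, j). if i = j then 0 else (1::'a))"
    define B where "B = orthogonal_sum A' J"
    have "nondeg_sym_form A' \<and> gw_class A' =
        (\<Sum>_<n' div 2. gw_hyperbolic) + (if odd n' then gw_unary c else 0)"
      unfolding A'_def
    proof (rule less.IH)
      show "a (i + 1) (j + 1) = a (j + 1) (i + 1)" for i j by (rule less.prems(1))
      show "a (i + 1) (j + 1) = 0" if "n' \<le> i + j" for i j
        using that 3 by (intro less.prems(2)) simp
      show "a (i + 1) (j + 1) = c" if "i + j + 1 = n'" for i j
        using that 3 by (intro less.prems(3)) simp
    qed (use 3 in simp)
    then have IH: "nondeg_sym_form A'" "gw_class A' =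
        (\<Sum>_<n' div 2. gw_hyperbolic) + (if odd n' then gw_unary c else 0)" by blast+
    note J = gw_class_antidiagonal_plane[OF two, folded J_def]
    have "\<exists>P \<in> carrier_mat (n' + 2) (n' + 2). B = transpose_mat P * mat (n' + 2) (n' + 2) (\<lambda>(i, j). a i j) * P"
      unfolding A'_def B_def J_def
    proof (rule antitriangular_split[OF two c])
      show "a i j = a j i" for i j by (rule less.prems(1))
      show "a i j = 0" if "n' + 2 \<le> i + j" for i j
        using that 3 by (intro less.prems(2)) simp
      show "a i j = c" if "i + j = n' + 1" for i j
        using that 3 by (intro less.prems(3)) simp
    qed
    then obtain P where cP: "P \<in> carrier_mat n n" and B_eq: "B = transpose_mat P * A * P"
      unfolding A_def 3 by blast
    have dB: "det B \<noteq> 0"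
      unfolding B_def by (rule nondeg_sym_formD(3)[OF nondeg_sym_form_sum[OF IH(1) J(1)] refl])
    have sym: "transpose_mat A = A"
    proof (rule eq_matI)
      show "transpose_mat A $$ (i, j) = A $$ (i, j)" if "i < dim_row A" "j < dim_col A" for i j
        using that less.prems(1)[of j i] by (simp add: A_def)
    qed (simp_all add: A_def)
    have cA: "A \<in> carrier_mat n n"
      by (simp add: A_def)
    note iso = isometric_congruence[OF cA sym cP B_eq dB]
    have "gw_class A = gw_class A' + gw_class J"
      using gw_class_isometric[OF iso(3)] gw_class_sum[OF IH(1) J(1)] by (simp only: B_def)
    moreover have "n div 2 = Suc (n' div 2)" "odd n = odd n'" using 3 by simp_all
    ultimately have "gw_class A =
        (\<Sum>_<n div 2. gw_hyperbolic) + (if odd n then gw_unary c else 0)"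
      by (simp add: IH(2) J(2) add_ac)
    with iso(1) show ?thesis by (simp only: A_def simp_thms)
  qed
qed


section \<open>The trace of a simple separable extension\<close>

text \<open>The target may be any commutative ring, so one set of rules serves field elements, power
  series and, by nesting, polynomials in two variables.\<close>

definition pev :: "('a::comm_ring_1 \<Rightarrow> 'b::comm_ring_1) \<Rightarrow> 'a poly \<Rightarrow> 'b \<Rightarrow> 'b" where
  "pev \<phi> h x = poly (map_poly \<phi> h) x"

context comm_ring_hom
begin

lemma pev_0 [simp]: "pev hom 0 x = 0"
  and pev_pCons [simp]: "pev hom (pCons a p) x = hom a + x * pev hom p x"
  and pev_1 [simp]: "pev hom 1 x = 1"
  by (simp_all add: pev_def map_poly_pCons_hom one_pCons)

lemma pev_add: "pev hom (p + q) x = pev hom p x + pev hom q x"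
  by (simp add: pev_def map_poly_hom_add)

lemma pev_smult: "pev hom (smult c p) x = hom c * pev hom p x"
  by (simp add: pev_def map_poly_hom_smult)

lemma pev_mult: "pev hom (p * q) x = pev hom p x * pev hom q x"
  by (induction p) (simp_all add: pev_add pev_smult algebra_simps)

lemma pev_uminus: "pev hom (- p) x = - pev hom p x"
  by (induction p) (simp_all add: hom_uminus algebra_simps)

lemma pev_diff: "pev hom (p - q) x = pev hom p x - pev hom q x"
  using pev_add[of p "- q" x] by (simp add: pev_uminus)

lemma pev_power: "pev hom (p ^ n) x = pev hom p x ^ n"
  by (induction n) (simp_all add: pev_mult)

lemma pev_sum: "pev hom (\<Sum>i\<in>A. f i) x = (\<Sum>i\<in>A. pev hom (f i) x)"
  by (induction A rule: infinite_finite_induct) (simp_all add: pev_add)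

lemma pev_monom: "pev hom (monom c n) x = hom c * x ^ n"
  by (simp add: pev_def poly_monom)

lemma pev_altdef: "pev hom h x = (\<Sum>i\<le>degree h. hom (coeff h i) * x ^ i)"
proof -
  have "pev hom h x = pev hom (\<Sum>i\<le>degree h. monom (coeff h i) i) x"
    by (simp only: poly_as_sum_of_monoms)
  then show ?thesis by (simp only: pev_sum pev_monom)
qed

lemma pev_altdef': "degree h < n \<Longrightarrow> pev hom h x = (\<Sum>i<n. hom (coeff h i) * x ^ i)"
proof -
  assume *: "degree h < n"
  have "pev hom h x = (\<Sum>i\<le>degree h. hom (coeff h i) * x ^ i)" by (rule pev_altdef)
  also have "\<dots> = (\<Sum>i<n. hom (coeff h i) * x ^ i)"
    using * by (intro sum.mono_neutral_left) (auto simp: coeff_eq_0 not_le)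
  finally show ?thesis .
qed

end

text \<open>The linear functional with moments \<open>m\<close>: the i-th power of the variable goes
  to \<open>m i\<close>. It serves to contract one factor of a tensor written as a
  polynomial.\<close>

definition functional_on_poly :: "(nat \<Rightarrow> 'b::comm_ring_1) \<Rightarrow> 'b poly \<Rightarrow> 'b" where
  "functional_on_poly m Q = (\<Sum>i\<le>degree Q. coeff Q i * m i)"

lemma functional_on_poly_altdef:
  assumes "degree Q < n"
  shows "functional_on_poly m Q = (\<Sum>i<n. coeff Q i * m i)"
  unfolding functional_on_poly_def
  using assms by (intro sum.mono_neutral_left) (auto simp: coeff_eq_0 not_le)

lemma functional_on_poly_add:
  "functional_on_poly m (P + Q) = functional_on_poly m P + functional_on_poly m Q"
proof -
  define n where "n = Suc (max (degree P) (degree Q))"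
  have "degree P < n" "degree Q < n" "degree (P + Q) < n"
    using degree_add_le_max[of P Q] by (auto simp: n_def)
  then show ?thesis
    by (simp add: functional_on_poly_altdef distrib_right sum.distrib)
qed

lemma functional_on_poly_smult:
  "functional_on_poly m (smult c P) = c * functional_on_poly m P"
proof -
  have "degree (smult c P) < Suc (degree P)" "degree P < Suc (degree P)"
    using degree_smult_le[of c P] by auto
  from this[THEN functional_on_poly_altdef[of _ _ m]] show ?thesis
    by (simp only: coeff_smult mult.assoc sum_distrib_left)
qed

lemma functional_on_poly_pCons:
  "functional_on_poly m (pCons a P) = a * m 0 + functional_on_poly (\<lambda>i. m (Suc i)) P"
proof -
  have *: "degree (pCons a P) < Suc (Suc (degree P))" "degree P < Suc (degree P)"
    using degree_pCons_le[of a P] by auto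
  show ?thesis
    unfolding *[THEN functional_on_poly_altdef] by (subst sum.lessThan_Suc_shift) simp
qed

text \<open>The product of the i-th and the j-th power of the variable goes to
  \<open>m (i + j)\<close>; so the functional may be applied to \<open>P\<close> first, with the
  exponent coming from \<open>Q\<close> as a shift of the moments.\<close>

lemma functional_on_poly_mult:
  "functional_on_poly m (P * Q) = functional_on_poly (\<lambda>j. functional_on_poly (\<lambda>i. m (i + j)) P) Q"
proof (induction P arbitrary: m)
  case 0
  then show ?case by (simp add: functional_on_poly_def)
next
  case (pCons a P)
  have *: "functional_on_poly (\<lambda>j. u j + v j) Q = functional_on_poly u Q + functional_on_poly v Q" for u v :: "nat \<Rightarrow> 'a"
    by (simp add: functional_on_poly_def distrib_left sum.distrib)
  have **: "functional_on_poly (\<lambda>j. a * u j) Q = a * functional_on_poly u Q" for u :: "nat \<Rightarrow> 'a"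
    by (simp add: functional_on_poly_def sum_distrib_left mult_ac)
  have "functional_on_poly m (pCons a P * Q) = a * functional_on_poly m Q + functional_on_poly (\<lambda>i. m (Suc i)) (P * Q)"
    by (simp add: functional_on_poly_add functional_on_poly_smult functional_on_poly_pCons)
  also have "\<dots> = functional_on_poly (\<lambda>j. a * m j + functional_on_poly (\<lambda>i. m (Suc i + j)) P) Q"
    by (simp add: pCons.IH * **)
  finally show ?case by (simp add: functional_on_poly_pCons)
qed

lemma functional_on_poly_sum:
  "functional_on_poly (\<lambda>j. \<Sum>k\<in>A. u k j) Q = (\<Sum>k\<in>A. functional_on_poly (u k) Q)"
  unfolding functional_on_poly_def sum_distrib_left by (rule sum.swap)

lemma functional_on_poly_cmult:
  "functional_on_poly (\<lambda>j. c * u j) Q = c * functional_on_poly u Q"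
  by (simp add: functional_on_poly_def sum_distrib_left mult_ac)

text \<open>Two bases are related by matrices P and Q with P Q = 1, and the matrices of
  multiplication by \<open>a\<close> satisfy M' = Q M P; so tr M' = tr (M P Q) = tr M. The two
  lengths are never compared, since this computation makes sense for rectangular P and Q.\<close>

lemma (in field_hom) field_trace_eq:
  assumes es: "basis_over hom es"
    and M: "\<And>j. j < length es \<Longrightarrow> a * es ! j = (\<Sum>i<length es. hom (M i j) * es ! i)"
  shows "field_trace hom a = (\<Sum>i<length es. M i i)"
  unfolding field_trace_def
proof (rule the_equality)
  show "\<exists>es' M'. basis_over hom es' \<and>
      (\<forall>j<length es'. a * es' ! j = (\<Sum>i<length es'. hom (M' i j) * es' ! i)) \<and>
      (\<Sum>i<length es. M i i) = (\<Sum>i<length es'. M' i i)"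
    using assms by blast
next
  fix \<tau> assume "\<exists>es' M'. basis_over hom es' \<and>
      (\<forall>j<length es'. a * es' ! j = (\<Sum>i<length es'. hom (M' i j) * es' ! i)) \<and>
      \<tau> = (\<Sum>i<length es'. M' i i)"
  then obtain es' M' where es': "basis_over hom es'"
    and M': "\<And>j. j < length es' \<Longrightarrow> a * es' ! j = (\<Sum>i<length es'. hom (M' i j) * es' ! i)"
    and \<tau>: "\<tau> = (\<Sum>i<length es'. M' i i)" by blast
  define n n' where "n = length es" and "n' = length es'"
  have ex: "\<exists>c. u = (\<Sum>i<length bs. hom (c i) * bs ! i)" if "basis_over hom bs" for bs u
    using that unfolding basis_over_def by metis
  have uniq: "c i = c' i"
    if "basis_over hom bs" "(\<Sum>i<length bs. hom (c i) * bs ! i) = (\<Sum>i<length bs. hom (c' i) * bs ! i)"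
      "i < length bs" for bs c c' i
  proof -
    let ?v = "\<lambda>c. vec (length bs) c"
    let ?u = "\<Sum>i<length bs. hom (c i) * bs ! i"
    have "\<exists>!v. v \<in> carrier_vec (length bs) \<and> ?u = (\<Sum>i<length bs. hom (v $ i) * bs ! i)"
      using that(1) unfolding basis_over_def by blast
    moreover have "?u = (\<Sum>i<length bs. hom (?v c $ i) * bs ! i)" by simp
    moreover have "?u = (\<Sum>i<length bs. hom (?v c' $ i) * bs ! i)" using that(2) by simp
    moreover have "?v c \<in> carrier_vec (length bs)" "?v c' \<in> carrier_vec (length bs)" by simp_all
    ultimately have "?v c = ?v c'" by blast
    then show ?thesis using that(3) by (metis index_vec)
  qed
  have coeffs: "\<exists>P. \<forall>j. u j = (\<Sum>i<length bs. hom (P i j) * bs ! i)" if "basis_over hom bs"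
    for bs and u :: "nat \<Rightarrow> 'b"
  proof -
    have "\<forall>j. \<exists>c. u j = (\<Sum>i<length bs. hom (c i) * bs ! i)" using ex[OF that] by blast
    then obtain c where "\<forall>j. u j = (\<Sum>i<length bs. hom (c j i) * bs ! i)" by (rule choice[THEN exE])
    then show ?thesis by (intro exI[of _ "\<lambda>i j. c j i"])
  qed
  from coeffs[OF es, of "\<lambda>j. es' ! j"] obtain P where P: "es' ! j = (\<Sum>i<n. hom (P i j) * es ! i)" for j
    unfolding n_def by blast
  from coeffs[OF es', of "\<lambda>j. es ! j"] obtain Q where Q: "es ! j = (\<Sum>i<n'. hom (Q i j) * es' ! i)" for j
    unfolding n'_def by blast
  have PQ: "(\<Sum>k<n'. P i k * Q k j) = (if i = j then 1 else 0)" if "i < n" "j < n" for i j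
  proof (rule uniq[OF es, folded n_def, of "\<lambda>i. \<Sum>k<n'. P i k * Q k j" "\<lambda>i. if i = j then 1 else 0"])
    have "(\<Sum>i<n. hom (\<Sum>k<n'. P i k * Q k j) * es ! i) = (\<Sum>i<n. \<Sum>k<n'. hom (Q k j) * (hom (P i k) * es ! i))"
      by (simp add: hom_sum hom_mult sum_distrib_left sum_distrib_right mult_ac)
    also have "\<dots> = (\<Sum>k<n'. hom (Q k j) * es' ! k)"
      by (subst sum.swap) (simp only: P sum_distrib_left)
    also have "\<dots> = (\<Sum>i<n. if i = j then es ! i else 0)"
      using that by (simp add: Q[symmetric])
    also have "\<dots> = (\<Sum>i<n. hom (if i = j then 1 else 0) * es ! i)"
      by (intro sum.cong) auto
    finally show "(\<Sum>i<n. hom (\<Sum>k<n'. P i k * Q k j) * es ! i) =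
        (\<Sum>i<n. hom (if i = j then 1 else 0) * es ! i)" .
  qed (rule that)
  have M'_eq: "M' i j = (\<Sum>k<n. \<Sum>l<n. Q i k * M k l * P l j)" if "i < n'" "j < n'" for i j
  proof (rule uniq[OF es', folded n'_def, of "\<lambda>i. M' i j" "\<lambda>i. \<Sum>k<n. \<Sum>l<n. Q i k * M k l * P l j"])
    have "(\<Sum>i<n'. hom (M' i j) * es' ! i) = a * es' ! j"
      using M' that(2) by (simp add: n'_def)
    also have "\<dots> = (\<Sum>l<n. hom (P l j) * (a * es ! l))"
      by (simp only: P sum_distrib_left mult.left_commute)
    also have "\<dots> = (\<Sum>l<n. \<Sum>k<n. hom (P l j) * (hom (M k l) * es ! k))"
      by (simp add: M n_def sum_distrib_left)
    also have "\<dots> = (\<Sum>l<n. \<Sum>k<n. \<Sum>i<n'. hom (P l j) * (hom (M k l) * (hom (Q i k) * es' ! i)))"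
      by (simp only: Q sum_distrib_left)
    also have "\<dots> = (\<Sum>k<n. \<Sum>l<n. \<Sum>i<n'. hom (P l j) * (hom (M k l) * (hom (Q i k) * es' ! i)))"
      by (rule sum.swap)
    also have "\<dots> = (\<Sum>k<n. \<Sum>i<n'. \<Sum>l<n. hom (P l j) * (hom (M k l) * (hom (Q i k) * es' ! i)))"
      by (rule sum.cong[OF refl], rule sum.swap)
    also have "\<dots> = (\<Sum>i<n'. \<Sum>k<n. \<Sum>l<n. hom (P l j) * (hom (M k l) * (hom (Q i k) * es' ! i)))"
      by (rule sum.swap)
    also have "\<dots> = (\<Sum>i<n'. hom (\<Sum>k<n. \<Sum>l<n. Q i k * M k l * P l j) * es' ! i)"
      by (simp add: hom_sum hom_mult sum_distrib_left sum_distrib_right mult_ac)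
    finally show "(\<Sum>i<n'. hom (M' i j) * es' ! i) =
      (\<Sum>i<n'. hom (\<Sum>k<n. \<Sum>l<n. Q i k * M k l * P l j) * es' ! i)" .
  qed (rule that)
  have "\<tau> = (\<Sum>i<n'. \<Sum>k<n. \<Sum>l<n. Q i k * M k l * P l i)"
    unfolding \<tau> n'_def[symmetric] by (intro sum.cong) (simp_all add: M'_eq)
  also have "\<dots> = (\<Sum>k<n. \<Sum>i<n'. \<Sum>l<n. Q i k * M k l * P l i)" by (rule sum.swap)
  also have "\<dots> = (\<Sum>k<n. \<Sum>l<n. \<Sum>i<n'. Q i k * M k l * P l i)"
    by (rule sum.cong[OF refl], rule sum.swap)
  also have "\<dots> = (\<Sum>k<n. \<Sum>l<n. M k l * (\<Sum>i<n'. P l i * Q i k))"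
    by (simp add: sum_distrib_left mult_ac)
  also have "\<dots> = (\<Sum>k<n. \<Sum>l<n. if k = l then M k k else 0)"
    by (intro sum.cong) (auto simp: PQ)
  also have "\<dots> = (\<Sum>k<n. M k k)" by simp
  finally show "\<tau> = (\<Sum>i<length es. M i i)" by (simp add: n_def)
qed

section \<open>Power basis, Euler's formula and nondegeneracy of the trace\<close>

locale simple_separable_extension = field_hom \<kappa>
  for \<kappa> :: "'a::field \<Rightarrow> 'c::field" +
  fixes \<tau> :: 'c and p :: "'a poly"
  assumes monic: "lead_coeff p = 1"
    and root: "pev \<kappa> p \<tau> = 0"
    and minimal: "pev \<kappa> h \<tau> = 0 \<Longrightarrow> p dvd h"
    and separable: "pev \<kappa> (pderiv p) \<tau> \<noteq> 0"
    and generated: "\<exists>h. c = pev \<kappa> h \<tau>"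
begin

definition d where "d = degree p"

lemma p_nonzero: "p \<noteq> 0"
  using monic by auto

lemma d_pos: "d > 0"
proof (rule ccontr)
  assume "\<not> d > 0"
  then have "degree p = 0" by (simp add: d_def)
  then obtain c where "p = [:c:]" by (rule degree_eq_zeroE)
  with monic have "p = 1" by (simp add: one_pCons)
  with root show False by simp
qed

definition repr :: "'c \<Rightarrow> 'a poly" where
  "repr c = (SOME h. c = pev \<kappa> h \<tau>) mod p"

lemma pev_mod: "pev \<kappa> (h mod p) \<tau> = pev \<kappa> h \<tau>"
proof -
  have "pev \<kappa> h \<tau> = pev \<kappa> (h div p * p + h mod p) \<tau>" by simp
  then show ?thesis by (simp only: pev_add pev_mult root) simp
qed

lemma pev_repr [simp]: "pev \<kappa> (repr c) \<tau> = c"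
  unfolding repr_def pev_mod using someI_ex[OF generated[of c]] by simp

lemma degree_repr: "degree (repr c) < d"
  using degree_mod_less[OF p_nonzero, of "SOME h. c = pev \<kappa> h \<tau>"] d_pos
  unfolding repr_def d_def by (metis degree_0)

lemma repr_unique:
  assumes "degree h < d" "pev \<kappa> h \<tau> = c"
  shows "repr c = h"
proof -
  have "pev \<kappa> (repr c - h) \<tau> = 0" by (simp add: pev_diff assms(2))
  then have "p dvd repr c - h" by (rule minimal)
  moreover have "degree (repr c - h) < degree p"
    using degree_diff_less[OF degree_repr assms(1)] by (simp add: d_def)
  ultimately have "repr c - h = 0" using dvd_imp_degree_le[of p "repr c - h"] by linarith
  then show ?thesis by simp
qed

definition coord :: "'c \<Rightarrow> nat \<Rightarrow> 'a" where
  "coord c i = coeff (repr c) i"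

lemma coord_expand: "c = (\<Sum>i<d. \<kappa> (coord c i) * \<tau> ^ i)"
  using pev_altdef'[OF degree_repr, of c \<tau>] by (simp add: coord_def)

lemma coord_sum_powers:
  assumes "i < d"
  shows "coord (\<Sum>j<d. \<kappa> (a j) * \<tau> ^ j) i = a i"
proof -
  define h where "h = (\<Sum>j<d. monom (a j) j)"
  have "degree h < d"
    unfolding h_def using d_pos by (intro degree_sum_less) (auto intro: le_less_trans[OF degree_monom_le])
  moreover have "pev \<kappa> h \<tau> = (\<Sum>j<d. \<kappa> (a j) * \<tau> ^ j)"
    by (simp add: h_def pev_sum pev_monom)
  ultimately have "repr (\<Sum>j<d. \<kappa> (a j) * \<tau> ^ j) = h" by (rule repr_unique)
  then show ?thesis using assms by (simp add: coord_def h_def coeff_sum)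
qed

lemma coord_add: "coord (u + v) i = coord u i + coord v i"
proof -
  have "repr (u + v) = repr u + repr v"
    by (rule repr_unique) (simp_all add: pev_add degree_add_less degree_repr)
  then show ?thesis by (simp add: coord_def)
qed

lemma coord_scale: "coord (\<kappa> c * u) i = c * coord u i"
proof -
  have "repr (\<kappa> c * u) = smult c (repr u)"
    using d_pos by (intro repr_unique) (auto simp: pev_smult intro: le_less_trans[OF degree_smult_le] degree_repr)
  then show ?thesis by (simp add: coord_def)
qed

lemma coord_power:
  assumes "i < d" "j < d"
  shows "coord (\<tau> ^ j) i = (if i = j then 1 else 0)"
proof -
  have "\<tau> ^ j = (\<Sum>k<d. if k = j then \<tau> ^ k else 0)" using assms by simp
  also have "\<dots> = (\<Sum>k<d. \<kappa> (if k = j then 1 else 0) * \<tau> ^ k)" by (intro sum.cong) auto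
  finally have eq: "\<tau> ^ j = (\<Sum>k<d. \<kappa> (if k = j then 1 else 0) * \<tau> ^ k)" .
  show ?thesis by (subst eq) (rule coord_sum_powers[OF assms(1)])
qed

lemma basis_powers: "basis_over \<kappa> (map (\<lambda>i. \<tau> ^ i) [0..<d])"
  unfolding basis_over_def
proof
  fix u
  have *: "(\<Sum>i<length (map (\<lambda>i. \<tau> ^ i) [0..<d]). \<kappa> (c $ i) * map (\<lambda>i. \<tau> ^ i) [0..<d] ! i)
      = (\<Sum>i<d. \<kappa> (c $ i) * \<tau> ^ i)" for c
    by (intro sum.cong) auto
  show "\<exists>!c. c \<in> carrier_vec (length (map (\<lambda>i. \<tau> ^ i) [0..<d])) \<and>
      u = (\<Sum>i<length (map (\<lambda>i. \<tau> ^ i) [0..<d]). \<kappa> (c $ i) * map (\<lambda>i. \<tau> ^ i) [0..<d] ! i)"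
    unfolding *
  proof (intro ex1I[of _ "vec d (coord u)"] conjI)
    show "u = (\<Sum>i<d. \<kappa> (vec d (coord u) $ i) * \<tau> ^ i)"
      using coord_expand[of u] by simp
  next
    fix c assume "c \<in> carrier_vec (length (map (\<lambda>i. \<tau> ^ i) [0..<d])) \<and> u = (\<Sum>i<d. \<kappa> (c $ i) * \<tau> ^ i)"
    then show "c = vec d (coord u)"
      by (intro eq_vecI) (simp_all add: coord_sum_powers)
  qed simp
qed

lemma trace_coord: "field_trace \<kappa> a = (\<Sum>i<d. coord (a * \<tau> ^ i) i)"
proof -
  have "field_trace \<kappa> a = (\<Sum>i<length (map (\<lambda>i. \<tau> ^ i) [0..<d]). coord (a * \<tau> ^ i) i)"
  proof (rule field_trace_eq[OF basis_powers, where M = "\<lambda>i j. coord (a * \<tau> ^ j) i"])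
    fix j assume "j < length (map (\<lambda>i. \<tau> ^ i) [0..<d])"
    then have "a * map (\<lambda>i. \<tau> ^ i) [0..<d] ! j = a * \<tau> ^ j" by simp
    also have "\<dots> = (\<Sum>i<d. \<kappa> (coord (a * \<tau> ^ j) i) * \<tau> ^ i)" by (rule coord_expand)
    also have "\<dots> = (\<Sum>i<length (map (\<lambda>i. \<tau> ^ i) [0..<d]).
        \<kappa> (coord (a * \<tau> ^ j) i) * map (\<lambda>i. \<tau> ^ i) [0..<d] ! i)"
      by (intro sum.cong) auto
    finally show "a * map (\<lambda>i. \<tau> ^ i) [0..<d] ! j = (\<Sum>i<length (map (\<lambda>i. \<tau> ^ i) [0..<d]).
        \<kappa> (coord (a * \<tau> ^ j) i) * map (\<lambda>i. \<tau> ^ i) [0..<d] ! i)" .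
  qed
  then show ?thesis by simp
qed

definition linear_form :: "('c \<Rightarrow> 'a) \<Rightarrow> bool" where
  "linear_form \<mu> \<longleftrightarrow> (\<forall>u v. \<mu> (u + v) = \<mu> u + \<mu> v) \<and> (\<forall>c u. \<mu> (\<kappa> c * u) = c * \<mu> u)"

lemma linear_formD:
  assumes "linear_form \<mu>"
  shows "\<mu> (u + v) = \<mu> u + \<mu> v" "\<mu> (\<kappa> c * u) = c * \<mu> u" "\<mu> 0 = 0"
    "\<mu> (sum f A) = (\<Sum>x\<in>A. \<mu> (f x))" "\<mu> (u - v) = \<mu> u - \<mu> v"
proof -
  show add: "\<mu> (u + v) = \<mu> u + \<mu> v" for u v using assms by (simp add: linear_form_def)
  show "\<mu> (\<kappa> c * u) = c * \<mu> u" for c u using assms by (simp add: linear_form_def)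
  from this[of 0 0] show z: "\<mu> 0 = 0" by simp
  show "\<mu> (sum f A) = (\<Sum>x\<in>A. \<mu> (f x))"
    by (induction A rule: infinite_finite_induct) (simp_all add: add z)
  have "\<mu> u = \<mu> ((u - v) + v)" by simp
  then show "\<mu> (u - v) = \<mu> u - \<mu> v" by (simp only: add) simp
qed

lemma linear_form_scaled:
  assumes "linear_form \<mu>"
  shows "linear_form (\<lambda>c. \<mu> (w * c))"
  unfolding linear_form_def
proof (intro conjI allI)
  show "\<mu> (w * (u + v)) = \<mu> (w * u) + \<mu> (w * v)" for u v
    by (simp only: distrib_left linear_formD(1)[OF assms])
  show "\<mu> (w * (\<kappa> c * u)) = c * \<mu> (w * u)" for c u
    by (simp only: mult.left_commute[of w "\<kappa> c" u] linear_formD(2)[OF assms])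
qed

lemma linear_form_trace: "linear_form (field_trace \<kappa>)"
  by (simp add: linear_form_def trace_coord distrib_right coord_add sum.distrib mult.assoc
      coord_scale sum_distrib_left)

lemma linear_form_expand:
  assumes "linear_form \<mu>"
  shows "\<mu> c = (\<Sum>i<d. coord c i * \<mu> (\<tau> ^ i))"
proof -
  have "\<mu> c = \<mu> (\<Sum>i<d. \<kappa> (coord c i) * \<tau> ^ i)" using coord_expand[of c] by simp
  then show ?thesis by (simp only: linear_formD(4)[OF assms] linear_formD(2)[OF assms])
qed

text \<open>The quotient of p(T) by T - \<tau> over k, that is, the difference quotient of p with
  one variable specialised to \<tau>.\<close>

definition cofactor :: "'c poly" where
  "cofactor = synthetic_div (map_poly \<kappa> p) \<tau>"

lemma cofactor: "map_poly \<kappa> p = [:- \<tau>, 1:] * cofactor"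
  using synthetic_div_correct'[of \<tau> "map_poly \<kappa> p"] root unfolding cofactor_def pev_def by simp

lemma degree_cofactor: "degree cofactor < d"
proof -
  have "degree (map_poly \<kappa> p) = d" by (simp add: d_def)
  then show ?thesis using d_pos unfolding cofactor_def by (simp add: degree_synthetic_div)
qed

lemma poly_cofactor: "poly cofactor \<tau> = pev \<kappa> (pderiv p) \<tau>"
proof -
  have "pev \<kappa> (pderiv p) \<tau> = poly (pderiv ([:- \<tau>, 1:] * cofactor)) \<tau>"
    by (simp add: pev_def map_poly_pderiv cofactor)
  also have "pderiv ([:- \<tau>, 1:] * cofactor) = [:- \<tau>, 1:] * pderiv cofactor + cofactor"
    by (simp only: pderiv_mult) (simp add: pderiv_pCons)
  finally show ?thesis by simp
qed

text \<open>The coefficients of \<open>h\<close> lie in F and \<mu> is F-linear, so multiplication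
  by h(T) can be moved inside \<mu>, where T acts as \<tau>.\<close>

lemma functional_map_poly_mult:
  assumes "linear_form \<mu>"
  shows "functional_on_poly (\<lambda>j. \<kappa> (\<mu> (c * \<tau> ^ j))) (map_poly \<kappa> h * Q) =
    functional_on_poly (\<lambda>j. \<kappa> (\<mu> (pev \<kappa> h \<tau> * c * \<tau> ^ j))) Q"
proof -
  have "functional_on_poly (\<lambda>i. \<kappa> (\<mu> (c * \<tau> ^ (i + j)))) (map_poly \<kappa> h) =
    \<kappa> (\<mu> (pev \<kappa> h \<tau> * c * \<tau> ^ j))" for j
  proof -
    have "functional_on_poly (\<lambda>i. \<kappa> (\<mu> (c * \<tau> ^ (i + j)))) (map_poly \<kappa> h)
        = \<kappa> (\<Sum>i\<le>degree h. coeff h i * \<mu> (c * \<tau> ^ (i + j)))"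
      by (simp add: functional_on_poly_def hom_sum hom_mult)
    also have "(\<Sum>i\<le>degree h. coeff h i * \<mu> (c * \<tau> ^ (i + j))) =
        \<mu> (\<Sum>i\<le>degree h. \<kappa> (coeff h i) * (c * \<tau> ^ (i + j)))"
      by (simp only: linear_formD(4)[OF assms] linear_formD(2)[OF assms])
    also have "(\<Sum>i\<le>degree h. \<kappa> (coeff h i) * (c * \<tau> ^ (i + j))) = pev \<kappa> h \<tau> * c * \<tau> ^ j"
      by (simp add: pev_altdef sum_distrib_left sum_distrib_right power_add mult_ac)
    finally show ?thesis .
  qed
  then show ?thesis by (simp add: functional_on_poly_mult)
qed

text \<open>Modulo \<open>p\<close>, multiplication of \<^const>\<open>cofactor\<close> by the variable is multiplication by \<open>\<tau>\<close>.\<close>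

lemma functional_cofactor_scale:
  assumes "linear_form \<mu>"
  shows "functional_on_poly (\<lambda>j. \<kappa> (\<mu> (c * \<tau> ^ j))) cofactor =
    c * functional_on_poly (\<lambda>j. \<kappa> (\<mu> (\<tau> ^ j))) cofactor"
proof -
  define E where "E = functional_on_poly (\<lambda>j. \<kappa> (\<mu> (1 * \<tau> ^ j)))"
  obtain h where h: "c = pev \<kappa> h \<tau>" using generated by blast
  define q where "q = synthetic_div (map_poly \<kappa> h) \<tau>"
  \<comment> \<open>As h(T) - c is divisible by T - \<tau>, its product with \<open>cofactor\<close>
    is a multiple of p(T), which the functional kills.\<close>
  have "map_poly \<kappa> h = [:- \<tau>, 1:] * q + [:c:]"
    using synthetic_div_correct'[of \<tau> "map_poly \<kappa> h"] unfolding q_def h pev_def by simp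
  then have "map_poly \<kappa> h * cofactor = ([:- \<tau>, 1:] * q + [:c:]) * cofactor" by (simp only:)
  also have "\<dots> = ([:- \<tau>, 1:] * cofactor) * q + [:c:] * cofactor"
    by (simp only: ring_distribs mult_ac)
  finally have "map_poly \<kappa> h * cofactor = map_poly \<kappa> p * q + smult c cofactor"
    by (simp only: cofactor) simp
  then have "E (map_poly \<kappa> h * cofactor) = E (map_poly \<kappa> p * q) + c * E cofactor"
    by (simp add: E_def functional_on_poly_add functional_on_poly_smult)
  also have "E (map_poly \<kappa> p * q) = 0"
    unfolding E_def functional_map_poly_mult[OF assms] root
    by (simp add: linear_formD(3)[OF assms] functional_on_poly_def)
  finally show ?thesis
    using functional_map_poly_mult[OF assms, of 1 h cofactor] by (simp add: E_def h)
qed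

text \<open>Euler's formula: up to the factor \<open>p'(\<tau>)\<close>, the coefficients of \<^const>\<open>cofactor\<close> form the trace
  dual of the basis of powers of \<open>\<tau>\<close>.\<close>

lemma trace_cofactor:
  "functional_on_poly (\<lambda>j. \<kappa> (field_trace \<kappa> (w * \<tau> ^ j))) cofactor = w * pev \<kappa> (pderiv p) \<tau>"
proof -
  have *: "functional_on_poly (\<lambda>j. \<kappa> (coord (\<tau> ^ j) i)) cofactor = coeff cofactor i" if "i < d" for i
  proof -
    have "functional_on_poly (\<lambda>j. \<kappa> (coord (\<tau> ^ j) i)) cofactor =
        (\<Sum>j<d. if j = i then coeff cofactor j else 0)"
      unfolding functional_on_poly_altdef[OF degree_cofactor]
      using that by (intro sum.cong) (auto simp: coord_power)
    then show ?thesis using that by simp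
  qed
  have coord: "linear_form (\<lambda>c. coord c i)" for i
    by (simp add: linear_form_def coord_add coord_scale)
  \<comment> \<open>The trace of \<tau>^j is the sum over i of the i-th coordinate of \<tau>^i
    \<tau>^j. Scaling pulls \<tau>^i out of each summand, and the i-th coordinate functional picks
    the i-th coefficient of \<open>cofactor\<close>; the sum is its value at \<tau>.\<close>
  have "functional_on_poly (\<lambda>j. \<kappa> (field_trace \<kappa> (\<tau> ^ j))) cofactor =
      (\<Sum>i<d. functional_on_poly (\<lambda>j. \<kappa> (coord (\<tau> ^ i * \<tau> ^ j) i)) cofactor)"
    by (simp add: trace_coord hom_sum functional_on_poly_sum mult.commute)
  also have "\<dots> = (\<Sum>i<d. \<tau> ^ i * coeff cofactor i)"
    by (intro sum.cong) (simp_all add: functional_cofactor_scale[OF coord] *)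
  also have "\<dots> = (\<Sum>i\<le>degree cofactor. coeff cofactor i * \<tau> ^ i)"
    using degree_cofactor
    by (intro sum.mono_neutral_cong_right) (auto simp: coeff_eq_0 not_le mult.commute)
  also have "\<dots> = poly cofactor \<tau>"
    by (simp add: poly_altdef)
  finally show ?thesis
    by (simp add: functional_cofactor_scale[OF linear_form_trace] poly_cofactor)
qed

text \<open>If all these traces vanish, so does the left side of Euler's formula, while its right
  side is w p'(\<tau>) with p'(\<tau>) nonzero.\<close>

lemma trace_nondegenerate:
  assumes "\<And>v. field_trace \<kappa> (w * v) = 0"
  shows "w = 0"
  using trace_cofactor[of w] separable by (simp add: assms functional_on_poly_def)

text \<open>Nondegeneracy makes the Gram matrix of the trace pairing on the powers of \<tau>
  invertible; solving the linear system for the values of \<mu> on these powers gives the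
  coordinates of w.\<close>

lemma linear_form_eq_trace:
  assumes "linear_form \<mu>"
  obtains w where "\<And>c. \<mu> c = field_trace \<kappa> (w * c)"
proof -
  define T where "T = mat d d (\<lambda>(i, j). field_trace \<kappa> (\<tau> ^ i * \<tau> ^ j))"
  have cT: "T \<in> carrier_mat d d" by (simp add: T_def)
  have Tv: "(T *\<^sub>v v) $ i = field_trace \<kappa> ((\<Sum>j<d. \<kappa> (v $ j) * \<tau> ^ j) * \<tau> ^ i)"
    if "v \<in> carrier_vec d" "i < d" for v i
  proof -
    have "(T *\<^sub>v v) $ i = (\<Sum>j<d. v $ j * field_trace \<kappa> (\<tau> ^ j * \<tau> ^ i))"
      using that by (auto simp: T_def scalar_prod_def lessThan_atLeast0 mult.commute intro!: sum.cong)
    also have "\<dots> = field_trace \<kappa> (\<Sum>j<d. \<kappa> (v $ j) * (\<tau> ^ j * \<tau> ^ i))"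
      by (simp only: linear_formD(4)[OF linear_form_trace] linear_formD(2)[OF linear_form_trace])
    finally show ?thesis by (simp only: sum_distrib_right mult.assoc)
  qed
  have eq_if: "\<mu> c = field_trace \<kappa> (w * c)"
    if "linear_form \<mu>" and "\<And>i. i < d \<Longrightarrow> \<mu> (\<tau> ^ i) = field_trace \<kappa> (w * \<tau> ^ i)" for \<mu> w c
    using linear_form_expand[OF that(1), of c]
      linear_form_expand[OF linear_form_scaled[OF linear_form_trace], of w c] that(2) by simp
  have "det T \<noteq> 0"
  proof
    assume "det T = 0"
    then obtain v where v: "v \<in> carrier_vec d" "v \<noteq> 0\<^sub>v d" "T *\<^sub>v v = 0\<^sub>v d"
      using det_0_iff_vec_prod_zero_field[OF cT] by blast
    define w where "w = (\<Sum>j<d. \<kappa> (v $ j) * \<tau> ^ j)"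
    have "linear_form (\<lambda>_. 0)" by (simp add: linear_form_def)
    moreover have "field_trace \<kappa> (w * \<tau> ^ i) = 0" if "i < d" for i
      using Tv[OF v(1) that] v(3) that by (simp add: w_def)
    ultimately have "field_trace \<kappa> (w * c) = 0" for c
      using eq_if[of "\<lambda>_. 0" w c] by simp
    then have "w = 0" by (rule trace_nondegenerate)
    have "v $ i = 0" if "i < d" for i
    proof -
      have "v $ i = coord w i" unfolding w_def using that by (simp add: coord_sum_powers)
      also have "\<dots> = 0" using coord_scale[of 0 0 i] by (simp add: \<open>w = 0\<close>)
      finally show ?thesis .
    qed
    then have "v = 0\<^sub>v d" using v(1) by (intro eq_vecI) auto
    with v(2) show False by simp
  qed
  then obtain Q where Q: "Q \<in> carrier_mat d d" "T * Q = 1\<^sub>m d"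
    using det_non_zero_imp_unit[OF cT, of "undefined :: unit"] by (auto simp: Units_def ring_mat_def)
  define m where "m = vec d (\<lambda>i. \<mu> (\<tau> ^ i))"
  define v where "v = Q *\<^sub>v m"
  have v: "v \<in> carrier_vec d" using Q by (simp add: v_def m_def)
  have "T *\<^sub>v v = (T * Q) *\<^sub>v m"
    unfolding v_def using Q cT by (intro assoc_mult_mat_vec[symmetric]) (simp_all add: m_def)
  then have Tm: "T *\<^sub>v v = m" using Q by (simp add: m_def)
  show thesis
  proof (rule that)
    show "\<mu> c = field_trace \<kappa> ((\<Sum>j<d. \<kappa> (v $ j) * \<tau> ^ j) * c)" for c
      by (rule eq_if[OF assms]) (simp add: Tv[OF v, symmetric] Tm m_def)
  qed
qed

end


section \<open>The trace on the Grothendieck-Witt group\<close>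

context field_hom
begin

text \<open>The basis clause of \<open>trace_form\<close> under a name of its own.
  \<open>basis_vecI\<close> and \<open>basis_vecD\<close> turn its matrix equation and unique
  existence into sums, spanning and independence.\<close>

definition basis_vec :: "nat \<Rightarrow> 'b vec list \<Rightarrow> bool" where
  "basis_vec n bs \<longleftrightarrow> set bs \<subseteq> carrier_vec n \<and>
     (\<forall>v \<in> carrier_vec n. \<exists>!c. c \<in> carrier_vec (length bs) \<and>
        v = mat_of_cols n bs *\<^sub>v map_vec hom c)"

lemma mult_cols_index:
  assumes "c \<in> carrier_vec (length bs)" "i < n" "set bs \<subseteq> carrier_vec n"
  shows "(mat_of_cols n bs *\<^sub>v map_vec hom c) $ i = (\<Sum>j<length bs. hom (c $ j) * bs ! j $ i)"
proof -
  have "(mat_of_cols n bs *\<^sub>v map_vec hom c) $ i = (\<Sum>j<length bs. row (mat_of_cols n bs) i $ j * map_vec hom c $ j)"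
    using assms(1,2) by (simp add: scalar_prod_def lessThan_atLeast0)
  also have "\<dots> = (\<Sum>j<length bs. hom (c $ j) * bs ! j $ i)"
  proof (rule sum.cong[OF refl])
    fix j assume "j \<in> {..<length bs}"
    then have j: "j < length bs" by simp
    have "row (mat_of_cols n bs) i $ j = bs ! j $ i"
      using j assms(2) by (simp add: mat_of_cols_index)
    moreover have "map_vec hom c $ j = hom (c $ j)" using j assms(1) by simp
    ultimately show "row (mat_of_cols n bs) i $ j * map_vec hom c $ j = hom (c $ j) * bs ! j $ i"
      by (simp only: mult.commute)
  qed
  finally show ?thesis .
qed

lemma mult_cols_carrier [simp]: "mat_of_cols n bs *\<^sub>v map_vec hom c \<in> carrier_vec n"
  by (rule carrier_vecI) (simp only: dim_mult_mat_vec mat_of_cols_carrier)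

lemma basis_vecI:
  assumes "set bs \<subseteq> carrier_vec n"
    and "\<And>v. v \<in> carrier_vec n \<Longrightarrow> \<exists>c. \<forall>i<n. v $ i = (\<Sum>j<length bs. hom (c j) * bs ! j $ i)"
    and "\<And>c. (\<And>i. i < n \<Longrightarrow> (\<Sum>j<length bs. hom (c j) * bs ! j $ i) = 0) \<Longrightarrow> \<forall>j<length bs. c j = 0"
  shows "basis_vec n bs"
  unfolding basis_vec_def
proof (intro conjI ballI assms(1))
  fix v :: "'b vec" assume v: "v \<in> carrier_vec n"
  from assms(2)[OF v] obtain c where c: "\<forall>i<n. v $ i = (\<Sum>j<length bs. hom (c j) * bs ! j $ i)" by blast
  show "\<exists>!c. c \<in> carrier_vec (length bs) \<and> v = mat_of_cols n bs *\<^sub>v map_vec hom c"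
  proof (intro ex1I[of _ "vec (length bs) c"] conjI)
    show "v = mat_of_cols n bs *\<^sub>v map_vec hom (vec (length bs) c)"
    proof (rule eq_vecI)
      fix i assume "i < dim_vec (mat_of_cols n bs *\<^sub>v map_vec hom (vec (length bs) c))"
      then have i: "i < n" by simp
      show "v $ i = (mat_of_cols n bs *\<^sub>v map_vec hom (vec (length bs) c)) $ i"
        using c i by (simp only: mult_cols_index[OF vec_carrier i assms(1)]) simp
    qed (use v in simp)
  next
    fix c' assume c': "c' \<in> carrier_vec (length bs) \<and> v = mat_of_cols n bs *\<^sub>v map_vec hom c'"
    have "\<forall>j<length bs. c' $ j - c j = 0"
    proof (rule assms(3))
      fix i assume i: "i < n"
      have "v $ i = (\<Sum>j<length bs. hom (c' $ j) * bs ! j $ i)"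
        using mult_cols_index[OF _ i assms(1), of c'] c' by simp
      with c i have "(\<Sum>j<length bs. hom (c' $ j) * bs ! j $ i) = (\<Sum>j<length bs. hom (c j) * bs ! j $ i)"
        by simp
      then show "(\<Sum>j<length bs. hom (c' $ j - c j) * bs ! j $ i) = 0"
        by (simp add: hom_minus left_diff_distrib sum_subtractf)
    qed
    then show "c' = vec (length bs) c" using c' by (intro eq_vecI) simp_all
  qed simp
qed

lemma basis_vecD:
  assumes "basis_vec n bs"
  shows "set bs \<subseteq> carrier_vec n"
    and "v \<in> carrier_vec n \<Longrightarrow> \<exists>c. \<forall>i<n. v $ i = (\<Sum>j<length bs. hom (c j) * bs ! j $ i)"
    and "\<lbrakk>\<And>i. i < n \<Longrightarrow> (\<Sum>j<length bs. hom (c j) * bs ! j $ i) = 0; j < length bs\<rbrakk> \<Longrightarrow> c j = 0"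
proof -
  show sub: "set bs \<subseteq> carrier_vec n" using assms by (simp add: basis_vec_def)
  show "\<exists>c. \<forall>i<n. v $ i = (\<Sum>j<length bs. hom (c j) * bs ! j $ i)" if v: "v \<in> carrier_vec n"
  proof -
    from assms v obtain c where c: "c \<in> carrier_vec (length bs)" "v = mat_of_cols n bs *\<^sub>v map_vec hom c"
      unfolding basis_vec_def by blast
    show ?thesis
      using mult_cols_index[OF c(1) _ sub] unfolding c(2) by blast
  qed
  show "c j = 0" if z: "\<And>i. i < n \<Longrightarrow> (\<Sum>j<length bs. hom (c j) * bs ! j $ i) = 0" and j: "j < length bs"
  proof -
    have eq: "0\<^sub>v n = mat_of_cols n bs *\<^sub>v map_vec hom (vec (length bs) a)"
      if "\<And>i. i < n \<Longrightarrow> (\<Sum>j<length bs. hom (a j) * bs ! j $ i) = 0" for a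
    proof (rule eq_vecI)
      fix i assume "i < dim_vec (mat_of_cols n bs *\<^sub>v map_vec hom (vec (length bs) a))"
      then have i: "i < n" by simp
      show "0\<^sub>v n $ i = (mat_of_cols n bs *\<^sub>v map_vec hom (vec (length bs) a)) $ i"
        using that[OF i] i by (simp only: mult_cols_index[OF vec_carrier i sub]) simp
    qed simp
    have "\<exists>!c. c \<in> carrier_vec (length bs) \<and> 0\<^sub>v n = mat_of_cols n bs *\<^sub>v map_vec hom c"
      using assms unfolding basis_vec_def by simp
    moreover have "vec (length bs) c \<in> carrier_vec (length bs)" "vec (length bs) (\<lambda>_. 0) \<in> carrier_vec (length bs)"
      by simp_all
    ultimately have "vec (length bs) c = vec (length bs) (\<lambda>_. 0)"
      using eq[of c, OF z] eq[of "\<lambda>_. 0"] by auto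
    then have "vec (length bs) c $ j = vec (length bs) (\<lambda>_. 0) $ j" by (simp only:)
    then show ?thesis using j by simp
  qed
qed

text \<open>The two lengths are not known to agree at this point, so invertibility of the transition
  matrix is expressed as surjectivity (second clause) and injectivity (third clause) of a possibly
  rectangular \<open>Q\<close>.\<close>

lemma basis_vec_transition:
  assumes bs: "basis_vec n bs" and bs': "basis_vec n bs'"
  shows "\<exists>Q. (\<forall>j<length bs'. \<forall>i<n. bs' ! j $ i = (\<Sum>k<length bs. hom (Q k j) * bs ! k $ i)) \<and>
    (\<forall>j<length bs. \<exists>c. \<forall>k<length bs. (\<Sum>l<length bs'. Q k l * c l) = (if k = j then 1 else 0)) \<and>
    (\<forall>c. (\<forall>k<length bs. (\<Sum>l<length bs'. Q k l * c l) = 0) \<longrightarrow> (\<forall>l<length bs'. c l = 0))"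
proof -
  define N N' where "N = length bs" and "N' = length bs'"
  have "\<forall>j. \<exists>c. j < N' \<longrightarrow> (\<forall>i<n. bs' ! j $ i = (\<Sum>k<N. hom (c k) * bs ! k $ i))"
  proof
    fix j
    show "\<exists>c. j < N' \<longrightarrow> (\<forall>i<n. bs' ! j $ i = (\<Sum>k<N. hom (c k) * bs ! k $ i))"
    proof (cases "j < N'")
      case True
      then have "bs' ! j \<in> carrier_vec n" using basis_vecD(1)[OF bs'] unfolding N'_def by auto
      from basis_vecD(2)[OF bs this] show ?thesis unfolding N_def by blast
    qed simp
  qed
  then obtain Q0 where "\<forall>j. j < N' \<longrightarrow> (\<forall>i<n. bs' ! j $ i = (\<Sum>k<N. hom (Q0 j k) * bs ! k $ i))"
    by (rule choice[THEN exE])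
  then have Q0: "bs' ! j $ i = (\<Sum>k<N. hom (Q0 j k) * bs ! k $ i)" if "j < N'" "i < n" for i j
    using that by blast
  have comp: "(\<Sum>l<N'. hom (c l) * bs' ! l $ i) = (\<Sum>k<N. hom (\<Sum>l<N'. Q0 l k * c l) * bs ! k $ i)"
    if "i < n" for c i
  proof -
    have "(\<Sum>l<N'. hom (c l) * bs' ! l $ i) = (\<Sum>l<N'. \<Sum>k<N. hom (Q0 l k * c l) * bs ! k $ i)"
      using that by (intro sum.cong) (simp_all add: Q0 sum_distrib_left hom_mult mult_ac)
    also have "\<dots> = (\<Sum>k<N. \<Sum>l<N'. hom (Q0 l k * c l) * bs ! k $ i)" by (rule sum.swap)
    finally show ?thesis by (simp only: hom_sum sum_distrib_right)
  qed
  show ?thesis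
    unfolding N_def[symmetric] N'_def[symmetric]
  proof (intro exI[of _ "\<lambda>k j. Q0 j k"] conjI allI impI)
    show "bs' ! j $ i = (\<Sum>k<N. hom (Q0 j k) * bs ! k $ i)" if "j < N'" "i < n" for i j
      by (rule Q0[OF that])
    show "\<exists>c. \<forall>k<N. (\<Sum>l<N'. Q0 l k * c l) = (if k = j then 1 else 0)" if j: "j < N" for j
    proof -
      have "bs ! j \<in> carrier_vec n" using basis_vecD(1)[OF bs] j unfolding N_def by auto
      from basis_vecD(2)[OF bs' this] obtain c
        where c: "\<forall>i<n. bs ! j $ i = (\<Sum>l<N'. hom (c l) * bs' ! l $ i)" unfolding N'_def by blast
      have "(\<Sum>l<N'. Q0 l k * c l) - (if k = j then 1 else 0) = 0" if "k < N" for k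
      proof (rule basis_vecD(3)[OF bs, folded N_def, of "\<lambda>k. (\<Sum>l<N'. Q0 l k * c l) - (if k = j then 1 else 0)"])
        fix i assume i: "i < n"
        have "(\<Sum>k<N. hom (if k = j then 1 else 0) * bs ! k $ i) = (\<Sum>k<N. if k = j then bs ! k $ i else 0)"
          by (intro sum.cong) auto
        also have "\<dots> = bs ! j $ i" using j by simp
        finally show "(\<Sum>k<N. hom ((\<Sum>l<N'. Q0 l k * c l) - (if k = j then 1 else 0)) * bs ! k $ i) = 0"
          using c i comp[OF i, of c] by (simp add: hom_minus left_diff_distrib sum_subtractf)
      qed (rule that)
      then show ?thesis by (intro exI[of _ c]) simp
    qed
    show "c l = 0" if c: "\<forall>k<N. (\<Sum>l<N'. Q0 l k * c l) = 0" and l: "l < N'" for c l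
    proof (rule basis_vecD(3)[OF bs', folded N'_def, of c, OF _ l])
      fix i assume i: "i < n"
      show "(\<Sum>l<N'. hom (c l) * bs' ! l $ i) = 0"
        using c by (simp add: comp[OF i])
    qed
  qed
qed

end

text \<open>If m < n, padding \<open>A\<close> by zero columns and \<open>B\<close> by zero rows
  gives square matrices whose product is still the identity, although the padded \<open>A\<close>
  kills the unit vector with index m.\<close>

lemma right_inverse_dim_le:
  fixes A B :: "'a::idom mat"
  assumes "A \<in> carrier_mat n m" "B \<in> carrier_mat m n" "A * B = 1\<^sub>m n"
  shows "n \<le> m"
proof (rule ccontr)
  assume "\<not> n \<le> m"
  then have m: "m < n" by simp
  define A' where "A' = mat n n (\<lambda>(i, j). if j < m then A $$ (i, j) else 0)"
  define B' where "B' = mat n n (\<lambda>(i, j). if i < m then B $$ (i, j) else 0)"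
  have c: "A' \<in> carrier_mat n n" "B' \<in> carrier_mat n n" by (simp_all add: A'_def B'_def)
  have "A' * B' = 1\<^sub>m n"
  proof (rule eq_matI)
    fix i j assume "i < dim_row (1\<^sub>m n :: 'a mat)" "j < dim_col (1\<^sub>m n :: 'a mat)"
    then have ij: "i < n" "j < n" by simp_all
    have "(A' * B') $$ (i, j) = (\<Sum>l<n. A' $$ (i, l) * B' $$ (l, j))"
      by (rule mult_mat_index_sum[OF c ij])
    also have "\<dots> = (\<Sum>l<m. A $$ (i, l) * B $$ (l, j))"
      using ij m by (intro sum.mono_neutral_cong_right) (auto simp: A'_def B'_def)
    also have "\<dots> = (A * B) $$ (i, j)"
      by (rule mult_mat_index_sum[OF assms(1,2) ij, symmetric])
    finally show "(A' * B') $$ (i, j) = 1\<^sub>m n $$ (i, j)" by (simp only: assms(3))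
  qed (use c in simp_all)
  then have "det A' * det B' = 1" using det_mult[OF c] by simp
  moreover have "A' *\<^sub>v unit_vec n m = 0\<^sub>v n"
  proof (rule eq_vecI)
    fix i assume "i < dim_vec (0\<^sub>v n :: 'a vec)"
    then show "(A' *\<^sub>v unit_vec n m) $ i = 0\<^sub>v n $ i" using m by (simp add: A'_def)
  qed (simp add: A'_def)
  moreover have "unit_vec n m \<noteq> (0\<^sub>v n :: 'a vec)"
  proof
    assume "unit_vec n m = (0\<^sub>v n :: 'a vec)"
    then have "unit_vec n m $ m = (0\<^sub>v n :: 'a vec) $ m" by simp
    with m show False by simp
  qed
  ultimately have "det A' = 0"
    using det_0_iff_vec_prod_zero[OF c(1)] unit_vec_carrier[of n m] by blast
  with \<open>det A' * det B' = 1\<close> show False by simp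
qed

text \<open>Surjectivity yields a right inverse R of \<open>P\<close>, injectivity makes it a left
  inverse, and the two dimension bounds give n = m. Only then is \<open>P\<close> square, as the
  definition of isometry demands.\<close>

lemma isometric_transition:
  fixes A :: "'a::field mat"
  assumes A: "nondeg_sym_form A" "A \<in> carrier_mat n n" and P: "P \<in> carrier_mat n m"
    and inj: "\<And>c. c \<in> carrier_vec m \<Longrightarrow> P *\<^sub>v c = 0\<^sub>v n \<Longrightarrow> c = 0\<^sub>v m"
    and surj: "\<And>j. j < n \<Longrightarrow> \<exists>c \<in> carrier_vec m. P *\<^sub>v c = unit_vec n j"
  shows "isometric A (transpose_mat P * A * P)"
proof -
  have "\<forall>j. \<exists>c. j < n \<longrightarrow> c \<in> carrier_vec m \<and> P *\<^sub>v c = unit_vec n j" using surj by blast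
  then obtain c where "\<forall>j. j < n \<longrightarrow> c j \<in> carrier_vec m \<and> P *\<^sub>v c j = unit_vec n j"
    by (rule choice[THEN exE])
  then have c: "c j \<in> carrier_vec m" "P *\<^sub>v c j = unit_vec n j" if "j < n" for j
    using that by blast+
  define R where "R = mat_of_cols m (map c [0..<n])"
  have R: "R \<in> carrier_mat m n" using mat_of_cols_carrier(1)[of m "map c [0..<n]"] by (simp add: R_def)
  have colR: "col R j = c j" if "j < n" for j
    using that c(1)[OF that] unfolding R_def by (subst col_mat_of_cols) simp_all
  have PR: "P * R = 1\<^sub>m n"
  proof (rule eq_matI)
    fix i j assume "i < dim_row (1\<^sub>m n :: 'a mat)" "j < dim_col (1\<^sub>m n :: 'a mat)"
    then have ij: "i < n" "j < n" by simp_all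
    have "(P * R) $$ (i, j) = (P *\<^sub>v c j) $ i"
      using ij P R by (simp add: colR)
    then show "(P * R) $$ (i, j) = 1\<^sub>m n $$ (i, j)" using ij c(2)[OF ij(2)] by (simp add: unit_vec_def)
  qed (use P R in simp_all)
  have "R * P = 1\<^sub>m m"
  proof -
    have RP: "R * P - 1\<^sub>m m \<in> carrier_mat m m" by (rule minus_carrier_mat[OF one_carrier_mat])
    have "P * (R * P - 1\<^sub>m m) = P * (R * P) - P * 1\<^sub>m m"
      using R P by (intro mult_minus_distrib_mat[of _ n m _ m]) simp_all
    also have "P * (R * P) = P * R * P" using R P by (intro assoc_mult_mat[symmetric]) simp_all
    also have "\<dots> - P * 1\<^sub>m m = 0\<^sub>m n m" using PR P by simp
    finally have z: "P * (R * P - 1\<^sub>m m) = 0\<^sub>m n m" .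
    have "col (R * P - 1\<^sub>m m) j = 0\<^sub>v m" if "j < m" for j
    proof (rule inj)
      show "P *\<^sub>v col (R * P - 1\<^sub>m m) j = 0\<^sub>v n"
        using arg_cong[OF z, of "\<lambda>M. col M j"] col_mult2[OF P RP that] that by simp
      show "col (R * P - 1\<^sub>m m) j \<in> carrier_vec m" by (rule carrier_vecI) (simp add: RP)
    qed
    then have "R * P - 1\<^sub>m m = 0\<^sub>m m m"
      using RP by (intro mat_col_eqI) simp_all
    then have eq0: "(R * P - 1\<^sub>m m) $$ (i, j) = 0" if "i < m" "j < m" for i j
      using that by simp
    have "(R * P) $$ (i, j) = 1\<^sub>m m $$ (i, j)" if "i < m" "j < m" for i j
      using eq0[OF that] index_minus_mat(1)[of i "1\<^sub>m m" j "R * P"] that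
      by (simp del: index_mult_mat)
    then show ?thesis using R P by (intro eq_matI) simp_all
  qed
  then have "n = m" using right_inverse_dim_le[OF P R PR] right_inverse_dim_le[OF R P] by simp
  with P R have P: "P \<in> carrier_mat n n" "R \<in> carrier_mat n n" by simp_all
  have "det P * det R = 1" using det_mult[OF P] PR by simp
  then have "det P \<noteq> 0" by auto
  then have d: "det (transpose_mat P * A * P) \<noteq> 0"
    using det_congruence[OF A(2) P(1)] nondeg_sym_formD(3)[OF A(1) refl] by simp
  have "transpose_mat A = A" by (rule nondeg_sym_formD(2)[OF A(1) refl])
  from isometric_congruence(3)[OF A(2) this P(1) refl d] show ?thesis .
qed

lemma scalar_prod_mult_mat_vec:
  assumes "A \<in> carrier_mat n n" "u \<in> carrier_vec n" "v \<in> carrier_vec n"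
  shows "u \<bullet> (A *\<^sub>v v) = (\<Sum>x<n. \<Sum>y<n. u $ x * A $$ (x, y) * v $ y)"
proof -
  have "u \<bullet> (A *\<^sub>v v) = (\<Sum>x<n. u $ x * (A *\<^sub>v v) $ x)"
    using assms by (simp add: scalar_prod_def lessThan_atLeast0)
  also have "\<dots> = (\<Sum>x<n. u $ x * (\<Sum>y<n. A $$ (x, y) * v $ y))"
  proof (rule sum.cong[OF refl])
    fix x assume "x \<in> {..<n}"
    then have "(A *\<^sub>v v) $ x = (\<Sum>y<n. A $$ (x, y) * v $ y)"
      using assms by (simp add: scalar_prod_def lessThan_atLeast0)
    then show "u $ x * (A *\<^sub>v v) $ x = u $ x * (\<Sum>y<n. A $$ (x, y) * v $ y)" by (simp only:)
  qed
  finally show ?thesis by (simp only: sum_distrib_left mult.assoc)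
qed

lemma bilinear_sum_expand:
  fixes a b :: "nat \<Rightarrow> 'a::comm_ring_1"
  shows "(\<Sum>x<n. \<Sum>y<n. (\<Sum>k<K. a k * U k x) * A x y * (\<Sum>l<L. b l * V l y)) =
    (\<Sum>k<K. \<Sum>l<L. a k * b l * (\<Sum>x<n. \<Sum>y<n. U k x * A x y * V l y))"
proof -
  define F where "F x y k l = a k * b l * (U k x * A x y * V l y)" for x y k l
  have "(\<Sum>k<K. a k * U k x) * A x y * (\<Sum>l<L. b l * V l y) = (\<Sum>k<K. \<Sum>l<L. F x y k l)" for x y
    unfolding sum_distrib_right sum_distrib_left F_def
    by (subst sum.swap, intro sum.cong refl) (simp only: mult_ac)
  then have "(\<Sum>x<n. \<Sum>y<n. (\<Sum>k<K. a k * U k x) * A x y * (\<Sum>l<L. b l * V l y)) =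
      (\<Sum>x<n. \<Sum>y<n. \<Sum>k<K. \<Sum>l<L. F x y k l)" by (simp only:)
  also have "\<dots> = (\<Sum>x<n. \<Sum>k<K. \<Sum>y<n. \<Sum>l<L. F x y k l)"
    by (rule sum.cong[OF refl], rule sum.swap)
  also have "\<dots> = (\<Sum>k<K. \<Sum>x<n. \<Sum>y<n. \<Sum>l<L. F x y k l)" by (rule sum.swap)
  also have "\<dots> = (\<Sum>k<K. \<Sum>x<n. \<Sum>l<L. \<Sum>y<n. F x y k l)"
    by (rule sum.cong[OF refl], rule sum.cong[OF refl], rule sum.swap)
  also have "\<dots> = (\<Sum>k<K. \<Sum>l<L. \<Sum>x<n. \<Sum>y<n. F x y k l)"
    by (rule sum.cong[OF refl], rule sum.swap)
  finally show ?thesis by (simp only: F_def sum_distrib_left)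
qed

context simple_separable_extension
begin

definition trace_gram :: "'c mat \<Rightarrow> 'c vec list \<Rightarrow> 'a mat" where
  "trace_gram A bs = mat (length bs) (length bs) (\<lambda>(i, j). field_trace \<kappa> (bs ! i \<bullet> (A *\<^sub>v bs ! j)))"

lemma trace_form_altdef: "trace_form \<kappa> A B \<longleftrightarrow> (\<exists>bs. basis_vec (dim_row A) bs \<and> B = trace_gram A bs)"
  by (simp only: trace_form_def basis_vec_def trace_gram_def conj_assoc)

lemma trace_gram_index:
  assumes "A \<in> carrier_mat n n" "set bs \<subseteq> carrier_vec n" "i < length bs" "j < length bs"
  shows "trace_gram A bs $$ (i, j) =
    field_trace \<kappa> (\<Sum>x<n. \<Sum>y<n. bs ! i $ x * A $$ (x, y) * bs ! j $ y)"
proof -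
  have "bs ! i \<in> carrier_vec n" "bs ! j \<in> carrier_vec n"
    using assms by auto
  from scalar_prod_mult_mat_vec[OF assms(1) this] show ?thesis
    using assms(3,4) by (simp add: trace_gram_def)
qed

lemma trace_gram_carrier [simp]: "trace_gram A bs \<in> carrier_mat (length bs) (length bs)"
  by (simp add: trace_gram_def)

lemma trace_gram_dim [simp]: "dim_row (trace_gram A bs) = length bs" "dim_col (trace_gram A bs) = length bs"
  by (simp_all add: trace_gram_def)

lemma trace_double_sum:
  "field_trace \<kappa> (\<Sum>k\<in>K. \<Sum>l\<in>L. \<kappa> (a k) * \<kappa> (b l) * G k l) =
    (\<Sum>k\<in>K. \<Sum>l\<in>L. a k * field_trace \<kappa> (G k l) * b l)"
proof -
  have "field_trace \<kappa> (\<kappa> (a k) * \<kappa> (b l) * G k l) = a k * field_trace \<kappa> (G k l) * b l" for k l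
    using linear_formD(2)[OF linear_form_trace, of "a k * b l" "G k l"] by (simp add: hom_mult mult_ac)
  then show ?thesis by (simp only: linear_formD(4)[OF linear_form_trace])
qed

text \<open>A kernel vector v of the Gram matrix gives a combination w of the basis with Tr(u^T A w)
  = 0 for all u. Taking for u all multiples of a unit vector, nondegeneracy of the trace gives A w =
  0, hence w = 0 and v = 0 by independence.\<close>

lemma trace_gram_nondeg:
  assumes A: "nondeg_sym_form A" "dim_row A = n" and bs: "basis_vec n bs"
  shows "nondeg_sym_form (trace_gram A bs)"
proof -
  note cA = nondeg_sym_formD(1)[OF A] and sA = nondeg_sym_formD(2)[OF A] and dA = nondeg_sym_formD(3)[OF A]
  note sub = basis_vecD(1)[OF bs]
  define N where "N = length bs"
  let ?B = "trace_gram A bs"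
  have cB: "?B \<in> carrier_mat N N" by (simp add: N_def)
  note B = trace_gram_index[OF cA sub, folded N_def]
  have Asym: "A $$ (x, y) = A $$ (y, x)" if "x < n" "y < n" for x y
    using arg_cong[OF sA, of "\<lambda>M. M $$ (x, y)"] cA that by simp
  have "transpose_mat ?B = ?B"
  proof (rule eq_matI)
    fix i j assume "i < dim_row ?B" "j < dim_col ?B"
    then have ij: "i < N" "j < N" by (simp_all add: N_def)
    have "(\<Sum>x<n. \<Sum>y<n. bs ! j $ x * A $$ (x, y) * bs ! i $ y) =
        (\<Sum>y<n. \<Sum>x<n. bs ! j $ x * A $$ (x, y) * bs ! i $ y)" by (rule sum.swap)
    also have "\<dots> = (\<Sum>x<n. \<Sum>y<n. bs ! i $ x * A $$ (x, y) * bs ! j $ y)"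
      using Asym by (intro sum.cong refl) (simp add: mult_ac)
    finally have "?B $$ (j, i) = ?B $$ (i, j)" by (simp only: B ij)
    then show "transpose_mat ?B $$ (i, j) = ?B $$ (i, j)" using ij by (simp add: N_def)
  qed (use cB in simp_all)
  moreover have "det ?B \<noteq> 0"
  proof
    assume "det ?B = 0"
    then obtain v where v: "v \<in> carrier_vec N" "v \<noteq> 0\<^sub>v N" "?B *\<^sub>v v = 0\<^sub>v N"
      using det_0_iff_vec_prod_zero_field[OF cB] by blast
    define w where "w x = (\<Sum>l<N. \<kappa> (v $ l) * bs ! l $ x)" for x
    have Bv: "field_trace \<kappa> (\<Sum>x<n. \<Sum>y<n. u $ x * A $$ (x, y) * w y) = 0" if "u \<in> carrier_vec n" for u
    proof -
      from basis_vecD(2)[OF bs that] obtain c where c: "u $ x = (\<Sum>k<N. \<kappa> (c k) * bs ! k $ x)" if "x < n" for x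
        unfolding N_def by blast
      have "(\<Sum>x<n. \<Sum>y<n. u $ x * A $$ (x, y) * w y) =
          (\<Sum>x<n. \<Sum>y<n. (\<Sum>k<N. \<kappa> (c k) * bs ! k $ x) * A $$ (x, y) * (\<Sum>l<N. \<kappa> (v $ l) * bs ! l $ y))"
        by (intro sum.cong refl) (simp add: c w_def)
      also have "\<dots> = (\<Sum>k<N. \<Sum>l<N. \<kappa> (c k) * \<kappa> (v $ l) * (\<Sum>x<n. \<Sum>y<n. bs ! k $ x * A $$ (x, y) * bs ! l $ y))"
        by (rule bilinear_sum_expand[where A = "\<lambda>x y. A $$ (x, y)" and U = "\<lambda>k x. bs ! k $ x" and V = "\<lambda>k x. bs ! k $ x"])
      finally have "field_trace \<kappa> (\<Sum>x<n. \<Sum>y<n. u $ x * A $$ (x, y) * w y) =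
          (\<Sum>k<N. \<Sum>l<N. c k * field_trace \<kappa> (\<Sum>x<n. \<Sum>y<n. bs ! k $ x * A $$ (x, y) * bs ! l $ y) * v $ l)"
        by (simp only: trace_double_sum)
      also have "\<dots> = (\<Sum>k<N. c k * (\<Sum>l<N. ?B $$ (k, l) * v $ l))"
        by (simp add: B sum_distrib_left mult.assoc)
      also have "\<dots> = (\<Sum>k<N. c k * (?B *\<^sub>v v) $ k)"
        using v(1) by (intro sum.cong refl) (simp add: scalar_prod_def lessThan_atLeast0 N_def)
      also have "\<dots> = 0" by (simp add: v(3))
      finally show ?thesis .
    qed
    have Aw: "(\<Sum>y<n. A $$ (x, y) * w y) = 0" if x: "x < n" for x
    proof (rule trace_nondegenerate)
      fix t :: 'c
      define u where "u = vec n (\<lambda>i. if i = x then t else 0)"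
      have "(\<Sum>i<n. \<Sum>y<n. u $ i * A $$ (i, y) * w y) = (\<Sum>i<n. if i = x then \<Sum>y<n. t * A $$ (i, y) * w y else 0)"
        by (intro sum.cong refl) (simp add: u_def)
      also have "\<dots> = (\<Sum>y<n. A $$ (x, y) * w y) * t"
        using x by (simp add: sum_distrib_left sum_distrib_right mult_ac)
      finally show "field_trace \<kappa> ((\<Sum>y<n. A $$ (x, y) * w y) * t) = 0"
        using Bv[of u] by (simp add: u_def)
    qed
    have "A *\<^sub>v vec n w = 0\<^sub>v n"
    proof (rule eq_vecI)
      fix x assume "x < dim_vec (0\<^sub>v n :: 'c vec)"
      then show "(A *\<^sub>v vec n w) $ x = 0\<^sub>v n $ x"
        using Aw[of x] cA by (simp add: scalar_prod_def lessThan_atLeast0)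
    qed (use cA in simp)
    then have w0: "vec n w = 0\<^sub>v n"
      using det_0_iff_vec_prod_zero_field[OF cA] dA vec_carrier[of n w] by blast
    have "v $ l = 0" if "l < N" for l
    proof (rule basis_vecD(3)[OF bs, folded N_def, of "\<lambda>l. v $ l"])
      fix x assume "x < n"
      then show "(\<Sum>j<N. \<kappa> (v $ j) * bs ! j $ x) = 0"
        using arg_cong[OF w0, of "\<lambda>v. v $ x"] by (simp add: w_def)
    qed (rule that)
    then have "v = 0\<^sub>v N" using v(1) by (intro eq_vecI) simp_all
    with v(2) show False by simp
  qed
  ultimately show ?thesis using cB by (auto simp: nondeg_sym_form_def)
qed

lemma trace_gram_change_basis:
  assumes A: "nondeg_sym_form A" "dim_row A = n" and bs: "basis_vec n bs" "basis_vec n bs'"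
  shows "isometric (trace_gram A bs) (trace_gram A bs')"
proof -
  note cA = nondeg_sym_formD(1)[OF A]
  define N N' where "N = length bs" and "N' = length bs'"
  obtain Q where Q: "\<And>j. j < N' \<Longrightarrow> \<forall>i<n. bs' ! j $ i = (\<Sum>k<N. \<kappa> (Q k j) * bs ! k $ i)"
    and Qs: "\<And>j. j < N \<Longrightarrow> \<exists>c. \<forall>k<N. (\<Sum>l<N'. Q k l * c l) = (if k = j then 1 else 0)"
    and Qi: "\<And>c. (\<forall>k<N. (\<Sum>l<N'. Q k l * c l) = 0) \<Longrightarrow> \<forall>l<N'. c l = 0"
    using basis_vec_transition[OF bs] unfolding N_def N'_def by blast
  define P where "P = mat N N' (\<lambda>(k, l). Q k l)"
  have P: "P \<in> carrier_mat N N'" by (simp add: P_def)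
  have Pv: "(P *\<^sub>v c) $ k = (\<Sum>l<N'. Q k l * c $ l)" if "c \<in> carrier_vec N'" "k < N" for c k
    using that by (simp add: P_def scalar_prod_def lessThan_atLeast0)
  have cB: "trace_gram A bs \<in> carrier_mat N N" by (simp add: N_def)
  have "trace_gram A bs' = transpose_mat P * trace_gram A bs * P"
  proof (rule eq_matI)
    fix i j assume "i < dim_row (transpose_mat P * trace_gram A bs * P)"
      "j < dim_col (transpose_mat P * trace_gram A bs * P)"
    then have ij: "i < N'" "j < N'" using P by simp_all
    have "trace_gram A bs' $$ (i, j) =
        field_trace \<kappa> (\<Sum>x<n. \<Sum>y<n. bs' ! i $ x * A $$ (x, y) * bs' ! j $ y)"
      using trace_gram_index[OF cA basis_vecD(1)[OF bs(2)]] ij by (simp add: N'_def)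
    also have "(\<Sum>x<n. \<Sum>y<n. bs' ! i $ x * A $$ (x, y) * bs' ! j $ y) =
        (\<Sum>x<n. \<Sum>y<n. (\<Sum>k<N. \<kappa> (Q k i) * bs ! k $ x) * A $$ (x, y) * (\<Sum>l<N. \<kappa> (Q l j) * bs ! l $ y))"
      by (intro sum.cong refl) (simp add: Q ij)
    also have "\<dots> = (\<Sum>k<N. \<Sum>l<N. \<kappa> (Q k i) * \<kappa> (Q l j) * (\<Sum>x<n. \<Sum>y<n. bs ! k $ x * A $$ (x, y) * bs ! l $ y))"
      by (rule bilinear_sum_expand[where A = "\<lambda>x y. A $$ (x, y)" and U = "\<lambda>k x. bs ! k $ x" and V = "\<lambda>k x. bs ! k $ x"])
    also have "field_trace \<kappa> \<dots> =
        (\<Sum>k<N. \<Sum>l<N. Q k i * field_trace \<kappa> (\<Sum>x<n. \<Sum>y<n. bs ! k $ x * A $$ (x, y) * bs ! l $ y) * Q l j)"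
      by (rule trace_double_sum)
    also have "\<dots> = (\<Sum>k<N. \<Sum>l<N. P $$ (k, i) * trace_gram A bs $$ (k, l) * P $$ (l, j))"
      using ij trace_gram_index[OF cA basis_vecD(1)[OF bs(1)], folded N_def]
      by (intro sum.cong refl) (simp add: P_def)
    also have "\<dots> = (transpose_mat P * trace_gram A bs * P) $$ (i, j)"
      by (rule congruence_index_sum[OF cB P ij, symmetric])
    finally show "trace_gram A bs' $$ (i, j) = (transpose_mat P * trace_gram A bs * P) $$ (i, j)" .
  qed (use P in \<open>simp_all add: N'_def\<close>)
  moreover have "isometric (trace_gram A bs) (transpose_mat P * trace_gram A bs * P)"
  proof (rule isometric_transition[OF trace_gram_nondeg[OF A bs(1)] cB P])
    fix c assume c: "c \<in> carrier_vec N'" "P *\<^sub>v c = 0\<^sub>v N"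
    have "\<forall>l<N'. c $ l = 0"
    proof (rule Qi, intro allI impI)
      fix k assume "k < N"
      then show "(\<Sum>l<N'. Q k l * c $ l) = 0" using Pv[OF c(1)] c(2) by simp
    qed
    then show "c = 0\<^sub>v N'" using c(1) by (intro eq_vecI) simp_all
  next
    fix j assume "j < N"
    from Qs[OF this] obtain c where c: "\<forall>k<N. (\<Sum>l<N'. Q k l * c l) = (if k = j then 1 else 0)" by blast
    have "P *\<^sub>v vec N' c = unit_vec N j"
    proof (rule eq_vecI)
      fix k assume "k < dim_vec (unit_vec N j :: 'a vec)"
      then show "(P *\<^sub>v vec N' c) $ k = unit_vec N j $ k"
        using c Pv[of "vec N' c" k] by (simp add: unit_vec_def)
    qed (use P in simp)
    then show "\<exists>c\<in>carrier_vec N'. P *\<^sub>v c = unit_vec N j" by (intro bexI[of _ "vec N' c"]) simp_all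
  qed
  ultimately show ?thesis by simp
qed

text \<open>A k-linear change of variables can be moved from the form to the F-basis. Isometry over
  k thereby becomes a change of F-basis for one fixed form, which
  \<open>trace_gram_change_basis\<close> handles.\<close>

lemma trace_gram_congruence:
  assumes A: "nondeg_sym_form A" "dim_row A = n" and P: "P \<in> carrier_mat n n" "det P \<noteq> 0"
    and bs: "basis_vec n bs"
  shows "basis_vec n (map ((*\<^sub>v) P) bs)"
    "trace_gram A (map ((*\<^sub>v) P) bs) = trace_gram (transpose_mat P * A * P) bs"
proof -
  note cA = nondeg_sym_formD(1)[OF A] and sub = basis_vecD(1)[OF bs]
  define N where "N = length bs"
  have Pb: "(P *\<^sub>v bs ! j) $ i = (\<Sum>x<n. P $$ (i, x) * bs ! j $ x)" if "i < n" "j < N" for i j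
  proof -
    have "bs ! j \<in> carrier_vec n" using sub that by (auto simp: N_def)
    then show ?thesis using P that by (simp add: scalar_prod_def lessThan_atLeast0)
  qed
  have comb: "(\<Sum>j<N. \<kappa> (c j) * (P *\<^sub>v bs ! j) $ i) = (\<Sum>x<n. P $$ (i, x) * (\<Sum>j<N. \<kappa> (c j) * bs ! j $ x))"
    if "i < n" for c i
  proof -
    have "(\<Sum>j<N. \<kappa> (c j) * (P *\<^sub>v bs ! j) $ i) = (\<Sum>j<N. \<Sum>x<n. P $$ (i, x) * (\<kappa> (c j) * bs ! j $ x))"
      using that by (intro sum.cong refl) (simp add: Pb sum_distrib_left mult_ac)
    also have "\<dots> = (\<Sum>x<n. \<Sum>j<N. P $$ (i, x) * (\<kappa> (c j) * bs ! j $ x))" by (rule sum.swap)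
    finally show ?thesis by (simp only: sum_distrib_left)
  qed
  have len: "length (map ((*\<^sub>v) P) bs) = N" by (simp add: N_def)
  have nth: "map ((*\<^sub>v) P) bs ! j = P *\<^sub>v bs ! j" if "j < N" for j using that by (simp add: N_def)
  show *: "basis_vec n (map ((*\<^sub>v) P) bs)"
  proof (rule basis_vecI)
    show "set (map ((*\<^sub>v) P) bs) \<subseteq> carrier_vec n" using sub P by auto
  next
    fix v :: "'c vec" assume v: "v \<in> carrier_vec n"
    obtain R where R: "R \<in> carrier_mat n n" "P * R = 1\<^sub>m n"
      using det_non_zero_imp_unit[OF P, of "undefined :: unit"] by (auto simp: Units_def ring_mat_def)
    define r where "r = R *\<^sub>v v"
    have r: "r \<in> carrier_vec n" using R v by (simp add: r_def)
    have "P *\<^sub>v r = v"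
      using assoc_mult_mat_vec[OF P(1) R(1) v] R(2) v by (simp add: r_def)
    moreover from basis_vecD(2)[OF bs r] obtain c where c: "\<forall>i<n. r $ i = (\<Sum>j<N. \<kappa> (c j) * bs ! j $ i)"
      unfolding N_def by blast
    moreover have "(P *\<^sub>v r) $ i = (\<Sum>x<n. P $$ (i, x) * r $ x)" if "i < n" for i
      using P that r by (simp add: scalar_prod_def lessThan_atLeast0)
    ultimately have "\<forall>i<n. v $ i = (\<Sum>j<N. \<kappa> (c j) * (P *\<^sub>v bs ! j) $ i)"
      using c by (simp add: comb)
    then show "\<exists>c. \<forall>i<n. v $ i = (\<Sum>j<length (map ((*\<^sub>v) P) bs). \<kappa> (c j) * map ((*\<^sub>v) P) bs ! j $ i)"
      unfolding len by (intro exI[of _ c]) (simp add: nth)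
  next
    fix c assume "\<And>i. i < n \<Longrightarrow> (\<Sum>j<length (map ((*\<^sub>v) P) bs). \<kappa> (c j) * map ((*\<^sub>v) P) bs ! j $ i) = 0"
    then have c: "(\<Sum>x<n. P $$ (i, x) * (\<Sum>j<N. \<kappa> (c j) * bs ! j $ x)) = 0" if "i < n" for i
      using that unfolding len by (simp add: nth comb)
    define w where "w = vec n (\<lambda>x. \<Sum>j<N. \<kappa> (c j) * bs ! j $ x)"
    have "P *\<^sub>v w = 0\<^sub>v n"
    proof (rule eq_vecI)
      fix i assume "i < dim_vec (0\<^sub>v n :: 'c vec)"
      then show "(P *\<^sub>v w) $ i = 0\<^sub>v n $ i"
        using c[of i] P by (simp add: w_def scalar_prod_def lessThan_atLeast0)
    qed (use P in simp)
    then have w0: "w = 0\<^sub>v n"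
      using det_0_iff_vec_prod_zero_field[OF P(1)] P(2) vec_carrier unfolding w_def by blast
    have "(\<Sum>j<N. \<kappa> (c j) * bs ! j $ x) = 0" if "x < n" for x
      using arg_cong[OF w0, of "\<lambda>v. v $ x"] that by (simp add: w_def)
    then show "\<forall>j<length (map ((*\<^sub>v) P) bs). c j = 0"
      unfolding len using basis_vecD(3)[OF bs, folded N_def, of c] by blast
  qed
  show "trace_gram A (map ((*\<^sub>v) P) bs) = trace_gram (transpose_mat P * A * P) bs"
  proof (rule eq_matI)
    fix i j assume "i < dim_row (trace_gram (transpose_mat P * A * P) bs)"
      "j < dim_col (trace_gram (transpose_mat P * A * P) bs)"
    then have ij: "i < N" "j < N" by (simp_all add: N_def trace_gram_def)
    have cPAP: "transpose_mat P * A * P \<in> carrier_mat n n" using P cA by simp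
    have "(\<Sum>x<n. \<Sum>y<n. (P *\<^sub>v bs ! i) $ x * A $$ (x, y) * (P *\<^sub>v bs ! j) $ y) =
      (\<Sum>x<n. \<Sum>y<n. (\<Sum>k<n. bs ! i $ k * P $$ (x, k)) * A $$ (x, y) * (\<Sum>l<n. bs ! j $ l * P $$ (y, l)))"
      using ij by (intro sum.cong refl) (simp add: Pb mult.commute)
    also have "\<dots> = (\<Sum>k<n. \<Sum>l<n. bs ! i $ k * bs ! j $ l * (\<Sum>x<n. \<Sum>y<n. P $$ (x, k) * A $$ (x, y) * P $$ (y, l)))"
      by (rule bilinear_sum_expand[where A = "\<lambda>x y. A $$ (x, y)" and U = "\<lambda>k x. P $$ (x, k)" and V = "\<lambda>k x. P $$ (x, k)"])
    also have "\<dots> = (\<Sum>k<n. \<Sum>l<n. bs ! i $ k * (transpose_mat P * A * P) $$ (k, l) * bs ! j $ l)"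
      by (intro sum.cong refl) (simp add: congruence_index_sum[OF cA P(1)] mult_ac del: index_mult_mat)
    finally show "trace_gram A (map ((*\<^sub>v) P) bs) $$ (i, j) = trace_gram (transpose_mat P * A * P) bs $$ (i, j)"
      using ij trace_gram_index[OF cA basis_vecD(1)[OF *], unfolded len, of i j]
        trace_gram_index[OF cPAP sub, folded N_def, of i j] by (simp only: nth)
  qed (simp_all add: trace_gram_def)
qed

lemma trace_form_isometric:
  assumes "isometric A A'" "trace_form \<kappa> A B" "trace_form \<kappa> A' B'"
  shows "isometric B B'"
proof -
  from assms(1) obtain n P where A: "nondeg_sym_form A" "nondeg_sym_form A'"
    "A \<in> carrier_mat n n" "A' \<in> carrier_mat n n" and P: "P \<in> carrier_mat n n" "det P \<noteq> 0"
    and eq: "A' = transpose_mat P * A * P"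
    by (rule isometricE)
  have dims: "dim_row A = n" "dim_row A' = n" using A(3,4) by simp_all
  obtain bs bs' where bs: "basis_vec n bs" "B = trace_gram A bs" and bs': "basis_vec n bs'" "B' = trace_gram A' bs'"
    using assms(2,3) unfolding trace_form_altdef dims by blast
  note * = trace_gram_congruence[OF A(1) dims(1) P bs'(1)]
  show ?thesis
    using trace_gram_change_basis[OF A(1) dims(1) bs(1) *(1)] unfolding *(2) bs(2) bs'(2) eq .
qed

end

section \<open>Orthogonal sums of trace forms\<close>

context field_hom
begin

definition append_basis :: "nat \<Rightarrow> nat \<Rightarrow> 'b vec list \<Rightarrow> 'b vec list \<Rightarrow> 'b vec list" where
  "append_basis n n' bs bs' = map (\<lambda>v. v @\<^sub>v 0\<^sub>v n') bs @ map (\<lambda>v. 0\<^sub>v n @\<^sub>v v) bs'"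

lemma append_basis_index:
  assumes "set bs \<subseteq> carrier_vec n" "set bs' \<subseteq> carrier_vec n'" "j < length bs + length bs'" "i < n + n'"
  shows "append_basis n n' bs bs' ! j $ i =
    (if j < length bs then if i < n then bs ! j $ i else 0
     else if i < n then 0 else bs' ! (j - length bs) $ (i - n))"
proof (cases "j < length bs")
  case True
  then have "bs ! j \<in> carrier_vec n" using assms(1) by auto
  then have "dim_vec (bs ! j) = n" by (rule carrier_vecD)
  with True assms(4) show ?thesis by (simp add: append_basis_def nth_append)
next
  case False
  then have "bs' ! (j - length bs) \<in> carrier_vec n'" using assms(2,3) by auto
  then have "dim_vec (bs' ! (j - length bs)) = n'" by (rule carrier_vecD)
  with False assms(3,4) show ?thesis by (simp add: append_basis_def nth_append)
qed

lemma length_append_basis [simp]: "length (append_basis n n' bs bs') = length bs + length bs'"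
  by (simp add: append_basis_def)

lemma sum_lessThan_add:
  fixes f :: "nat \<Rightarrow> 'z::comm_monoid_add"
  shows "(\<Sum>j<m + k. f j) = (\<Sum>j<m. f j) + (\<Sum>j<k. f (m + j))"
  by (induction k) (simp_all add: add.assoc)

lemma append_basis_comb:
  assumes "set bs \<subseteq> carrier_vec n" "set bs' \<subseteq> carrier_vec n'" "i < n + n'"
  shows "(\<Sum>j<length (append_basis n n' bs bs'). hom (c j) * append_basis n n' bs bs' ! j $ i) =
    (if i < n then \<Sum>j<length bs. hom (c j) * bs ! j $ i
     else \<Sum>j<length bs'. hom (c (length bs + j)) * bs' ! j $ (i - n))"
  by (simp add: sum_lessThan_add append_basis_index[OF assms(1,2) _ assms(3)])

lemma basis_vec_append:
  assumes "basis_vec n bs" "basis_vec n' bs'"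
  shows "basis_vec (n + n') (append_basis n n' bs bs')"
proof -
  note sub = basis_vecD(1)[OF assms(1)] basis_vecD(1)[OF assms(2)]
  note comb = append_basis_comb[OF sub]
  show ?thesis
  proof (rule basis_vecI)
    show "set (append_basis n n' bs bs') \<subseteq> carrier_vec (n + n')"
      using sub by (auto simp: append_basis_def)
  next
    fix v :: "'b vec" assume v: "v \<in> carrier_vec (n + n')"
    obtain c where c: "\<forall>i<n. vec n (\<lambda>i. v $ i) $ i = (\<Sum>j<length bs. hom (c j) * bs ! j $ i)"
      using basis_vecD(2)[OF assms(1) vec_carrier] by blast
    obtain c' where c': "\<forall>i<n'. vec n' (\<lambda>i. v $ (n + i)) $ i = (\<Sum>j<length bs'. hom (c' j) * bs' ! j $ i)"
      using basis_vecD(2)[OF assms(2) vec_carrier] by blast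
    show "\<exists>c. \<forall>i<n + n'. v $ i = (\<Sum>j<length (append_basis n n' bs bs'). hom (c j) * append_basis n n' bs bs' ! j $ i)"
    proof (intro exI allI impI)
      fix i assume i: "i < n + n'"
      show "v $ i = (\<Sum>j<length (append_basis n n' bs bs').
          hom (if j < length bs then c j else c' (j - length bs)) * append_basis n n' bs bs' ! j $ i)"
      proof (cases "i < n")
        case True
        with c show ?thesis by (simp only: comb[OF i]) simp
      next
        case False
        with i have "i - n < n'" "n + (i - n) = i" by simp_all
        with c' have "v $ i = (\<Sum>j<length bs'. hom (c' j) * bs' ! j $ (i - n))" by (metis index_vec)
        with False show ?thesis by (simp only: comb[OF i]) simp
      qed
    qed
  next
    fix c assume *: "\<And>i. i < n + n' \<Longrightarrow>
      (\<Sum>j<length (append_basis n n' bs bs'). hom (c j) * append_basis n n' bs bs' ! j $ i) = 0"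
    have c1: "(\<Sum>j<length bs. hom (c j) * bs ! j $ i) = 0" if "i < n" for i
    proof -
      have i: "i < n + n'" using that by simp
      from *[OF i] that show ?thesis by (simp only: comb[OF i] if_True)
    qed
    have c2: "(\<Sum>j<length bs'. hom (c (length bs + j)) * bs' ! j $ i) = 0" if "i < n'" for i
    proof -
      have i: "n + i < n + n'" using that by simp
      from *[OF i] have "(\<Sum>j<length bs'. hom (c (length bs + j)) * bs' ! j $ (n + i - n)) = 0"
        by (simp only: comb[OF i]) simp
      then show ?thesis by simp
    qed
    show "\<forall>j<length (append_basis n n' bs bs'). c j = 0"
    proof (intro allI impI)
      fix j assume j: "j < length (append_basis n n' bs bs')"
      show "c j = 0"
      proof (cases "j < length bs")
        case True
        show ?thesis by (rule basis_vecD(3)[OF assms(1) c1 True])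
      next
        case False
        then have "j - length bs < length bs'" using j by simp
        from basis_vecD(3)[OF assms(2) c2 this] False show ?thesis by simp
      qed
    qed
  qed
qed

end

context simple_separable_extension
begin

lemma trace_gram_append:
  assumes A: "A \<in> carrier_mat n n" "A' \<in> carrier_mat n' n'" and bs: "basis_vec n bs" "basis_vec n' bs'"
  shows "trace_gram (orthogonal_sum A A') (append_basis n n' bs bs') =
    orthogonal_sum (trace_gram A bs) (trace_gram A' bs')"
proof -
  define N N' where "N = length bs" and "N' = length bs'"
  note sub = basis_vecD(1)[OF bs(1)] basis_vecD(1)[OF bs(2)]
  note idx = append_basis_index[OF sub, folded N_def N'_def]
  have cS: "orthogonal_sum A A' \<in> carrier_mat (n + n') (n + n')" by (rule orthogonal_sum_carrier[OF A])
  have S: "orthogonal_sum A A' $$ (x, y) = (if x < n then if y < n then A $$ (x, y) else 0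
      else if y < n then 0 else A' $$ (x - n, y - n))" if "x < n + n'" "y < n + n'" for x y
    using A that by (auto simp: orthogonal_sum_def)
  have B: "orthogonal_sum (trace_gram A bs) (trace_gram A' bs') $$ (i, j) =
     (if i < N then if j < N then trace_gram A bs $$ (i, j) else 0
      else if j < N then 0 else trace_gram A' bs' $$ (i - N, j - N))" if "i < N + N'" "j < N + N'" for i j
    using that by (auto simp: orthogonal_sum_def N_def N'_def)
  note subS = basis_vecD(1)[OF basis_vec_append[OF bs]]
  note G1 = trace_gram_index[OF A(1) sub(1), folded N_def]
  note G2 = trace_gram_index[OF A(2) sub(2), folded N'_def]
  show ?thesis
  proof (rule eq_matI)
    fix i j assume "i < dim_row (orthogonal_sum (trace_gram A bs) (trace_gram A' bs'))"
      "j < dim_col (orthogonal_sum (trace_gram A bs) (trace_gram A' bs'))"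
    then have ij: "i < N + N'" "j < N + N'" by (simp_all add: orthogonal_sum_def N_def N'_def)
    define F where "F x y = append_basis n n' bs bs' ! i $ x * orthogonal_sum A A' $$ (x, y)
        * append_basis n n' bs bs' ! j $ y" for x y
    have "trace_gram (orthogonal_sum A A') (append_basis n n' bs bs') $$ (i, j) =
        field_trace \<kappa> (\<Sum>x<n + n'. \<Sum>y<n + n'. F x y)"
      using trace_gram_index[OF cS subS, of i j] ij by (simp add: F_def N_def N'_def)
    also have "(\<Sum>x<n + n'. \<Sum>y<n + n'. F x y) =
        (\<Sum>x<n. (\<Sum>y<n. F x y) + (\<Sum>y<n'. F x (n + y))) +
        (\<Sum>x<n'. (\<Sum>y<n. F (n + x) y) + (\<Sum>y<n'. F (n + x) (n + y)))"
      by (simp only: sum_lessThan_add)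
    also have "\<dots> = (if i < N \<and> j < N then \<Sum>x<n. \<Sum>y<n. bs ! i $ x * A $$ (x, y) * bs ! j $ y
        else if i < N \<or> j < N then 0
        else \<Sum>x<n'. \<Sum>y<n'. bs' ! (i - N) $ x * A' $$ (x, y) * bs' ! (j - N) $ y)"
      using ij by (auto simp: F_def S idx)
    also have "field_trace \<kappa> \<dots> = orthogonal_sum (trace_gram A bs) (trace_gram A' bs') $$ (i, j)"
    proof -
      have "i - N < N'" if "\<not> i < N" using ij that by simp
      moreover have "j - N < N'" if "\<not> j < N" using ij that by simp
      ultimately show ?thesis
        by (simp add: B[OF ij] G1 G2 linear_formD(3)[OF linear_form_trace])
    qed
    finally show "trace_gram (orthogonal_sum A A') (append_basis n n' bs bs') $$ (i, j) =
        orthogonal_sum (trace_gram A bs) (trace_gram A' bs') $$ (i, j)" .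
  qed (simp_all add: orthogonal_sum_def)
qed

lemma trace_form_sum:
  assumes "nondeg_sym_form A" "nondeg_sym_form A'" "trace_form \<kappa> A B" "trace_form \<kappa> A' B'"
  shows "trace_form \<kappa> (orthogonal_sum A A') (orthogonal_sum B B')"
proof -
  define n n' where "n = dim_row A" and "n' = dim_row A'"
  have c: "A \<in> carrier_mat n n" "A' \<in> carrier_mat n' n'"
    using assms(1,2) by (simp_all add: nondeg_sym_form_def n_def n'_def)
  obtain bs bs' where bs: "basis_vec n bs" "B = trace_gram A bs" "basis_vec n' bs'" "B' = trace_gram A' bs'"
    using assms(3,4) unfolding trace_form_altdef n_def n'_def by blast
  have "dim_row (orthogonal_sum A A') = n + n'" by (simp add: orthogonal_sum_def n_def n'_def)
  then show ?thesis
    using basis_vec_append[OF bs(1,3)] trace_gram_append[OF c bs(1,3)]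
    unfolding trace_form_altdef bs(2,4) by metis
qed

lemma basis_vec_exists: "\<exists>bs. basis_vec n bs"
proof (induction n)
  case 0
  have "basis_vec 0 []" by (rule basis_vecI) simp_all
  then show ?case by blast
next
  case (Suc n)
  then obtain bs where bs: "basis_vec n bs" by blast
  define es where "es = map (\<lambda>i. vec 1 (\<lambda>_. \<tau> ^ i)) [0..<d]"
  have es: "length es = d" "es ! j $ 0 = \<tau> ^ j" if "j < d" for j
    using that by (simp_all add: es_def)
  have len: "length es = d" by (simp add: es_def)
  have "basis_vec 1 es"
  proof (rule basis_vecI)
    show "set es \<subseteq> carrier_vec 1" by (auto simp: es_def)
  next
    fix v :: "'c vec" assume "v \<in> carrier_vec 1"
    have "v $ 0 = (\<Sum>j<length es. \<kappa> (coord (v $ 0) j) * es ! j $ 0)"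
      using coord_expand[of "v $ 0"] by (simp add: len es)
    then show "\<exists>c. \<forall>i<1. v $ i = (\<Sum>j<length es. \<kappa> (c j) * es ! j $ i)"
      by (intro exI[of _ "coord (v $ 0)"]) simp
  next
    fix c assume *: "\<And>i. i < 1 \<Longrightarrow> (\<Sum>j<length es. \<kappa> (c j) * es ! j $ i) = 0"
    have "(\<Sum>j<d. \<kappa> (c j) * \<tau> ^ j) = 0" using *[of 0] by (simp add: len es)
    then have "c j = coord 0 j" if "j < d" for j using coord_sum_powers[OF that, of c] by simp
    moreover have "coord 0 j = 0" for j using coord_scale[of 0 0 j] by simp
    ultimately show "\<forall>j<length es. c j = 0" by (simp add: len)
  qed
  from basis_vec_append[OF bs this] show ?case by auto
qed

lemma trace_form_exists: "\<exists>B. trace_form \<kappa> A B"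
  using basis_vec_exists trace_form_altdef by blast

lemma trace_form_nondeg:
  assumes "nondeg_sym_form A" "trace_form \<kappa> A B"
  shows "nondeg_sym_form B"
  using assms trace_gram_nondeg unfolding trace_form_altdef by blast

end

section \<open>Formal differences and the trace of a class\<close>

lemma groth_of_diff: "groth_of a - groth_of b = abs_groth (a, b)"
proof -
  have "groth_of a - groth_of b = groth_of a + - groth_of b" by simp
  then show ?thesis by (simp add: groth_of.abs_eq uminus_groth.abs_eq plus_groth.abs_eq)
qed

lemma form_class_eq_iff:
  assumes "nondeg_sym_form A" "nondeg_sym_form B"
  shows "form_class A = form_class B \<longleftrightarrow> isometric A B"
  using Quotient3_rel[OF Quotient3_form_class, of A B] isometric_refl[OF assms(1)] isometric_refl[OF assms(2)]
  by blast

lemma form_class_cases: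
  obtains A where "nondeg_sym_form A" "e = form_class A"
proof
  have "isometric (rep_form_class e) (rep_form_class e)"
    by (rule Quotient3_rep_reflp[OF Quotient3_form_class])
  then show "nondeg_sym_form (rep_form_class e)" by (simp add: isometric_def)
  show "e = form_class (rep_form_class e)"
    by (rule Quotient3_abs_rep[OF Quotient3_form_class, symmetric])
qed

text \<open>Equality in the group completion is equality after adding some class e; every class is
  represented by a nondegenerate form, so this is stable isometry of actual matrices.\<close>

lemma gw_class_diff_eq_iff:
  assumes n: "nondeg_sym_form A" "nondeg_sym_form A'" "nondeg_sym_form C" "nondeg_sym_form C'"
  shows "gw_class A - gw_class A' = gw_class C - gw_class C' \<longleftrightarrow>
    (\<exists>E. nondeg_sym_form E \<and> isometric (orthogonal_sum (orthogonal_sum A C') E)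
       (orthogonal_sum (orthogonal_sum C A') E))" (is "?l \<longleftrightarrow> ?r")
proof -
  have "?l \<longleftrightarrow> (\<exists>e. form_class A + form_class C' + e = form_class C + form_class A' + e)"
    by (simp add: gw_class_def groth_of_diff groth.abs_eq_iff groth_rel_def)
  also have "\<dots> \<longleftrightarrow> (\<exists>E. nondeg_sym_form E \<and>
      form_class A + form_class C' + form_class E = form_class C + form_class A' + form_class E)"
    using form_class_cases by metis
  also have "\<dots> \<longleftrightarrow> ?r"
    using n by (intro ex_cong1 conj_cong refl)
      (simp add: form_class_eq_iff nondeg_sym_form_sum flip: form_class_sum)
  finally show ?thesis .
qed

context simple_separable_extension
begin

text \<open>Any other presentation A1 - A' of the same class gives an isometry of A + A' + E with A1
  + E for some E. Traces respect isometry and sums, so the traced forms satisfy the same relation,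
  and that of E cancels in the group.\<close>

lemma gw_trace_eq:
  assumes A: "nondeg_sym_form A" and B: "trace_form \<kappa> A B"
  shows "gw_trace \<kappa> (gw_class A) = gw_class B"
  unfolding gw_trace_def
proof (rule the_equality)
  have "trace_form \<kappa> (0\<^sub>m 0 0) (0\<^sub>m 0 0)"
    unfolding trace_form_altdef
  proof (intro exI conjI)
    show "basis_vec (dim_row (0\<^sub>m 0 0 :: 'c mat)) []" by (rule basis_vecI) simp_all
    show "0\<^sub>m 0 0 = trace_gram (0\<^sub>m 0 0) []" by (rule eq_matI) simp_all
  qed
  then show "\<exists>A1 A' B1 B'. nondeg_sym_form A1 \<and> nondeg_sym_form A' \<and> gw_class A = gw_class A1 - gw_class A' \<and>
      trace_form \<kappa> A1 B1 \<and> trace_form \<kappa> A' B' \<and> gw_class B = gw_class B1 - gw_class B'"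
    using A B nondeg_sym_form_zero by (intro exI[of _ A] exI[of _ "0\<^sub>m 0 0"] exI[of _ B]) (simp add: gw_class_zero)
next
  fix w assume "\<exists>A1 A' B1 B'. nondeg_sym_form A1 \<and> nondeg_sym_form A' \<and> gw_class A = gw_class A1 - gw_class A' \<and>
      trace_form \<kappa> A1 B1 \<and> trace_form \<kappa> A' B' \<and> w = gw_class B1 - gw_class B'"
  then obtain A1 A' B1 B' where n: "nondeg_sym_form A1" "nondeg_sym_form A'"
    and eq: "gw_class A = gw_class A1 - gw_class A'"
    and t: "trace_form \<kappa> A1 B1" "trace_form \<kappa> A' B'" and w: "w = gw_class B1 - gw_class B'" by blast
  have "gw_class A - gw_class (0\<^sub>m 0 0) = gw_class A1 - gw_class A'"
    by (simp add: gw_class_zero eq)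
  then obtain E where E: "nondeg_sym_form E"
    "isometric (orthogonal_sum (orthogonal_sum A A') E) (orthogonal_sum (orthogonal_sum A1 (0\<^sub>m 0 0)) E)"
    using gw_class_diff_eq_iff[OF A nondeg_sym_form_zero n] by blast
  have z: "orthogonal_sum X (0\<^sub>m 0 0) = X" for X :: "'z::field mat"
    unfolding orthogonal_sum_def by (rule eq_matI) simp_all
  obtain T where T: "trace_form \<kappa> E T" using trace_form_exists by blast
  have nS: "nondeg_sym_form (orthogonal_sum A A')" using A n by (simp add: nondeg_sym_form_sum)
  have "isometric (orthogonal_sum (orthogonal_sum B B') T) (orthogonal_sum B1 T)"
    using trace_form_isometric[OF E(2)[unfolded z]
        trace_form_sum[OF nS E(1) trace_form_sum[OF A n(2) B t(2)] T]
        trace_form_sum[OF n(1) E(1) t(1) T]] .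
  from gw_class_isometric[OF this] have "gw_class B + gw_class B' + gw_class T = gw_class B1 + gw_class T"
    using trace_form_nondeg A B n t E(1) T by (simp add: gw_class_sum nondeg_sym_form_sum)
  then show "w = gw_class B" by (simp add: w algebra_simps)
qed

end


section \<open>The index in a local chart\<close>

notation fps_nth (infixl "$$$" 75)

text \<open>\<open>\<Theta>\<close> is the expansion of germs in \<open>k[[s]]\<close>, where \<open>s = t - \<tau>\<close> and \<open>k = F(\<tau>)\<close> is the residue field.\<close>

locale local_chart = simple_separable_extension \<kappa> \<tau> p + emb: field_hom \<iota>
  for \<kappa> :: "'a::field \<Rightarrow> 'c::field" and \<tau> p and \<iota> :: "'a \<Rightarrow> 'b::field" +
  fixes R m :: "'b set" and t \<pi> :: 'b and \<Theta> :: "'b \<Rightarrow> 'c fps"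
  assumes R_const: "\<iota> c \<in> R"
    and R_add: "u \<in> R \<Longrightarrow> v \<in> R \<Longrightarrow> u + v \<in> R"
    and R_mult: "u \<in> R \<Longrightarrow> v \<in> R \<Longrightarrow> u * v \<in> R"
    and R_inverse: "u \<in> R \<Longrightarrow> \<Theta> u $$$ 0 \<noteq> 0 \<Longrightarrow> inverse u \<in> R"
    and \<Theta>_const: "\<Theta> (\<iota> c) = fps_const (\<kappa> c)"
    and \<Theta>_add: "u \<in> R \<Longrightarrow> v \<in> R \<Longrightarrow> \<Theta> (u + v) = \<Theta> u + \<Theta> v"
    and \<Theta>_mult: "u \<in> R \<Longrightarrow> v \<in> R \<Longrightarrow> \<Theta> (u * v) = \<Theta> u * \<Theta> v"
    and t_in_R: "t \<in> R" and \<Theta>_t: "\<Theta> t = fps_const \<tau> + fps_X"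
    and m_eq: "m = {u \<in> R. \<Theta> u $$$ 0 = 0}"
    and \<pi>_in_m: "\<pi> \<in> m" and \<Theta>_\<pi>: "\<Theta> \<pi> $$$ 1 \<noteq> 0"
    and \<pi>_divides: "u \<in> m \<Longrightarrow> \<exists>v\<in>R. u = \<pi> * v"
begin

lemma R_0: "0 \<in> R" and R_1: "1 \<in> R"
  using R_const[of 0] R_const[of 1] by simp_all

lemma \<Theta>_0: "\<Theta> 0 = 0" and \<Theta>_1: "\<Theta> 1 = 1"
  using \<Theta>_const[of 0] \<Theta>_const[of 1] by simp_all

lemma R_uminus: "u \<in> R \<Longrightarrow> - u \<in> R"
  using R_mult[OF R_const[of "- 1"]] by (simp add: emb.hom_uminus)

lemma R_diff: "u \<in> R \<Longrightarrow> v \<in> R \<Longrightarrow> u - v \<in> R"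
  using R_add[OF _ R_uminus] by simp

lemma \<Theta>_diff: "u \<in> R \<Longrightarrow> v \<in> R \<Longrightarrow> \<Theta> (u - v) = \<Theta> u - \<Theta> v"
  using \<Theta>_add[OF R_diff, of u v v] by simp

lemma R_power: "u \<in> R \<Longrightarrow> u ^ n \<in> R"
  by (induction n) (simp_all add: R_1 R_mult)

lemma \<Theta>_power: "u \<in> R \<Longrightarrow> \<Theta> (u ^ n) = \<Theta> u ^ n"
  by (induction n) (simp_all add: \<Theta>_1 \<Theta>_mult R_power)

lemma R_sum: "(\<And>i. i \<in> A \<Longrightarrow> f i \<in> R) \<Longrightarrow> sum f A \<in> R"
  by (induction A rule: infinite_finite_induct) (simp_all add: R_0 R_add)

lemma \<Theta>_sum: "(\<And>i. i \<in> A \<Longrightarrow> f i \<in> R) \<Longrightarrow> \<Theta> (sum f A) = (\<Sum>i\<in>A. \<Theta> (f i))"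
  by (induction A rule: infinite_finite_induct) (simp_all add: \<Theta>_0 \<Theta>_add R_sum)

lemma R_prod: "(\<And>i. i \<in> A \<Longrightarrow> f i \<in> R) \<Longrightarrow> prod f A \<in> R"
  by (induction A rule: infinite_finite_induct) (simp_all add: R_1 R_mult)

lemma \<Theta>_prod: "(\<And>i. i \<in> A \<Longrightarrow> f i \<in> R) \<Longrightarrow> \<Theta> (prod f A) = (\<Prod>i\<in>A. \<Theta> (f i))"
  by (induction A rule: infinite_finite_induct) (simp_all add: \<Theta>_1 \<Theta>_mult R_prod)

sublocale const: comm_ring_hom "\<lambda>c. fps_const (\<kappa> c)"
  by unfold_locales (simp_all add: hom_add hom_mult)

definition taylor :: "'a poly \<Rightarrow> 'c fps" where
  "taylor h = pev (\<lambda>c. fps_const (\<kappa> c)) h (fps_const \<tau> + fps_X)"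

lemma pev_t_in_R: "pev \<iota> h t \<in> R"
  by (induction h) (simp_all add: R_0 R_add R_mult R_const t_in_R)

lemma \<Theta>_pev: "\<Theta> (pev \<iota> h t) = taylor h"
  by (induction h) (simp_all add: taylor_def \<Theta>_0 \<Theta>_add \<Theta>_mult \<Theta>_const \<Theta>_t R_mult R_const t_in_R pev_t_in_R)

lemma taylor_nth_0: "taylor h $$$ 0 = pev \<kappa> h \<tau>"
  by (induction h) (simp_all add: taylor_def)

lemma taylor_nth_1: "taylor h $$$ 1 = pev \<kappa> (pderiv h) \<tau>"
proof (induction h)
  case (pCons a h)
  have "taylor (pCons a h) $$$ 1 = \<tau> * taylor h $$$ 1 + taylor h $$$ 0"
    by (simp add: taylor_def distrib_right fps_X_mult_nth)
  also have "\<dots> = pev \<kappa> (pderiv (pCons a h)) \<tau>"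
    by (simp add: pCons.IH[unfolded One_nat_def] taylor_nth_0 pderiv_pCons pev_add)
  finally show ?case .
qed (simp add: taylor_def)

lemmas taylor_hom = const.pev_add[of _ _ "fps_const \<tau> + fps_X", folded taylor_def]
  const.pev_mult[of _ _ "fps_const \<tau> + fps_X", folded taylor_def]
  const.pev_power[of _ _ "fps_const \<tau> + fps_X", folded taylor_def]

definition p' :: 'c where "p' = pev \<kappa> (pderiv p) \<tau>"

lemma p'_nonzero: "p' \<noteq> 0"
  using separable by (simp add: p'_def)

text \<open>As p(\<tau>) = 0, the expansion of p(t) is s times a series with constant term
  p'(\<tau>), and this is nonzero: p(t) has order exactly 1.\<close>

lemma taylor_p_power: "\<exists>P. (\<forall>n. taylor (p ^ n) = fps_X ^ n * P ^ n) \<and> P $$$ 0 = p'"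
proof -
  define P where "P = fps_shift 1 (taylor p)"
  have *: "taylor p = fps_X * P"
  proof (rule fps_ext)
    show "taylor p $$$ n = (fps_X * P) $$$ n" for n
      using root taylor_nth_0[of p] by (cases n) (simp_all add: P_def)
  qed
  have "taylor (p ^ n) = fps_X ^ n * P ^ n" for n
    by (simp add: taylor_hom(3) * power_mult_distrib)
  moreover have "P $$$ 0 = p'" by (simp add: P_def p'_def taylor_nth_1[unfolded One_nat_def])
  ultimately show ?thesis by blast
qed

lemma taylor_p_power_mult:
  "i < n \<Longrightarrow> taylor (p ^ n * h) $$$ i = 0" "taylor (p ^ n * h) $$$ n = p' ^ n * pev \<kappa> h \<tau>"
proof -
  obtain P where P: "taylor (p ^ n) = fps_X ^ n * P ^ n" "P $$$ 0 = p'"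
    using taylor_p_power by blast
  have "taylor (p ^ n * h) = fps_X ^ n * (P ^ n * taylor h)"
    by (simp add: taylor_hom(2) P mult.assoc)
  then have *: "taylor (p ^ n * h) $$$ i = (if i < n then 0 else (P ^ n * taylor h) $$$ (i - n))" for i
    by (simp add: fps_X_power_mult_nth)
  show "i < n \<Longrightarrow> taylor (p ^ n * h) $$$ i = 0" by (simp add: *)
  show "taylor (p ^ n * h) $$$ n = p' ^ n * pev \<kappa> h \<tau>" by (simp add: * P(2) taylor_nth_0 fps_power_zeroth)
qed

text \<open>The n-th coefficient is corrected by p^n h', which leaves the earlier ones alone and
  contributes p'(\<tau>)^n h'(\<tau>); as \<tau> generates k over F, h'(\<tau>) can be any
  prescribed value.\<close>

lemma taylor_dense: "\<exists>h. \<forall>i<n. taylor h $$$ i = \<xi> $$$ i"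
proof (induction n)
  case (Suc n)
  then obtain h where h: "\<forall>i<n. taylor h $$$ i = \<xi> $$$ i" by blast
  obtain h' where h': "(\<xi> $$$ n - taylor h $$$ n) / p' ^ n = pev \<kappa> h' \<tau>" using generated by blast
  show ?case
  proof (intro exI[of _ "h + p ^ n * h'"] allI impI)
    fix i assume "i < Suc n"
    then show "taylor (h + p ^ n * h') $$$ i = \<xi> $$$ i"
      using h taylor_p_power_mult(1)[of i n h'] taylor_p_power_mult(2)[of n h'] p'_nonzero
      by (cases "i = n") (simp_all add: taylor_hom(1) flip: h')
  qed
qed simp

text \<open>The filtration by order of expansion. \<open>M_eq\<close> and
  \<open>ideal_pow_eq\<close> identify it with the powers of the maximal ideal, so that all ideals
  in the definition of the index become conditions on coefficients.\<close>

definition M :: "nat \<Rightarrow> 'b set" where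
  "M n = {u \<in> R. \<forall>i<n. \<Theta> u $$$ i = 0}"

lemma M_add: "u \<in> M n \<Longrightarrow> v \<in> M n \<Longrightarrow> u + v \<in> M n"
  by (simp add: M_def \<Theta>_add R_add)

lemma M_diff: "u \<in> M n \<Longrightarrow> v \<in> M n \<Longrightarrow> u - v \<in> M n"
  by (simp add: M_def \<Theta>_diff R_diff)

lemma M_mult: "u \<in> M n \<Longrightarrow> v \<in> M k \<Longrightarrow> u * v \<in> M (n + k)"
proof -
  assume u: "u \<in> M n" and v: "v \<in> M k"
  have "(\<Theta> u * \<Theta> v) $$$ i = 0" if "i < n + k" for i
    unfolding fps_mult_nth
  proof (rule sum.neutral, rule ballI)
    fix j assume "j \<in> {0..i}"
    then have "j < n \<or> i - j < k" using that by auto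
    then show "\<Theta> u $$$ j * \<Theta> v $$$ (i - j) = 0" using u v by (auto simp: M_def)
  qed
  then show ?thesis using u v by (simp add: M_def \<Theta>_mult R_mult)
qed

lemma M_0: "M 0 = R" and M_1: "M 1 = m"
  by (simp_all add: M_def m_eq)

lemma M_mult_R: "u \<in> M n \<Longrightarrow> v \<in> R \<Longrightarrow> u * v \<in> M n"
  using M_mult[of u n v 0] by (simp add: M_0)

lemma M_mono: "n \<le> k \<Longrightarrow> M k \<subseteq> M n"
  by (auto simp: M_def)

lemma M_R: "u \<in> M n \<Longrightarrow> u \<in> R"
  by (simp add: M_def)

lemma \<pi>_in_R: "\<pi> \<in> R" and \<Theta>_\<pi>_0: "\<Theta> \<pi> $$$ 0 = 0"
  using \<pi>_in_m by (simp_all add: m_eq)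

lemma \<pi>_power: "\<pi> ^ n \<in> M n"
  using \<pi>_in_m by (induction n) (simp_all add: M_0 R_1 M_mult[of _ 1, simplified] flip: M_1[unfolded One_nat_def])

text \<open>The expansion of \<pi>^n is s^n times a series with nonzero constant term, so
  coefficient n of \<pi>^n v is a nonzero multiple of the constant term of v.\<close>

lemma \<Theta>_\<pi>_power_mult: "v \<in> R \<Longrightarrow> \<Theta> (\<pi> ^ n * v) $$$ (n + i) = 0 \<Longrightarrow> i = 0 \<Longrightarrow> \<Theta> v $$$ 0 = 0"
proof -
  assume v: "v \<in> R" and z: "\<Theta> (\<pi> ^ n * v) $$$ (n + i) = 0" and "i = 0"
  define P where "P = fps_shift 1 (\<Theta> \<pi>)"
  have "\<Theta> \<pi> = fps_X * P"
  proof (rule fps_ext)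
    show "\<Theta> \<pi> $$$ n = (fps_X * P) $$$ n" for n using \<Theta>_\<pi>_0 by (cases n) (simp_all add: P_def)
  qed
  then have "\<Theta> (\<pi> ^ n * v) = fps_X ^ n * (P ^ n * \<Theta> v)"
    using v by (simp add: \<Theta>_mult \<Theta>_power R_power \<pi>_in_R power_mult_distrib mult.assoc)
  then have "\<Theta> (\<pi> ^ n * v) $$$ n = (\<Theta> \<pi> $$$ 1) ^ n * \<Theta> v $$$ 0"
    by (simp add: fps_X_power_mult_nth P_def fps_power_zeroth)
  with z \<open>i = 0\<close> \<Theta>_\<pi> show ?thesis by simp
qed

text \<open>One factor \<pi> is peeled off at a time: if u = \<pi>^n v has vanishing n-th
  coefficient, then v has no constant term, lies in m and is divisible by \<pi>.\<close>

lemma M_eq: "u \<in> M n \<longleftrightarrow> (\<exists>v\<in>R. u = \<pi> ^ n * v)"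
proof
  show "u \<in> M n" if "\<exists>v\<in>R. u = \<pi> ^ n * v"
    using that M_mult_R[OF \<pi>_power] by auto
next
  show "\<exists>v\<in>R. u = \<pi> ^ n * v" if "u \<in> M n"
    using that
  proof (induction n)
    case 0
    then show ?case by (simp add: M_0)
  next
    case (Suc n)
    then have "u \<in> M n" using M_mono[of n "Suc n"] by auto
    with Suc.IH obtain v where v: "v \<in> R" "u = \<pi> ^ n * v" by blast
    have "\<Theta> u $$$ n = 0" using Suc.prems by (simp add: M_def)
    with \<Theta>_\<pi>_power_mult[OF v(1), of n 0] have "\<Theta> v $$$ 0 = 0" by (simp add: v(2))
    then have "v \<in> m" using v(1) by (simp add: m_eq)
    then obtain w where "w \<in> R" "v = \<pi> * w" using \<pi>_divides by blast
    then show ?case using v(2) by (intro bexI[of _ w]) (simp_all add: mult_ac)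
  qed
qed

lemma M_sum: "(\<And>i. i \<in> A \<Longrightarrow> f i \<in> M n) \<Longrightarrow> sum f A \<in> M n"
  by (induction A rule: infinite_finite_induct) (simp_all add: M_add M_def[of n] R_0 \<Theta>_0 \<Theta>_add R_add)

lemma ideal_pow_eq: "ideal_pow R m n = M n"
proof
  have prod: "(\<Prod>i<k. b i) \<in> M k" if "\<forall>i<k. b i \<in> m" for b k
    using that
  proof (induction k)
    case (Suc k)
    then show ?case using M_mult[of "\<Prod>i<k. b i" k "b k" 1] by (simp add: M_1[unfolded One_nat_def])
  qed (simp add: M_0 R_1)
  show "ideal_pow R m n \<subseteq> M n"
    unfolding ideal_pow_def ideal_span_def
  proof (rule subsetI, elim CollectE exE conjE)
    fix u a s and k :: nat
    assume u: "u = (\<Sum>i<k. a i * s i)"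
      and *: "\<forall>i<k. a i \<in> R \<and> s i \<in> {\<Prod>i<n. b i | b. \<forall>i<n. b i \<in> m}"
    have "a i * s i \<in> M n" if "i < k" for i
      using * that prod M_mult_R[of "s i" n "a i"] by (auto simp: mult.commute)
    then show "u \<in> M n" unfolding u by (intro M_sum) simp
  qed
  show "M n \<subseteq> ideal_pow R m n"
  proof
    fix u assume "u \<in> M n"
    then obtain v where v: "v \<in> R" "u = \<pi> ^ n * v" unfolding M_eq by blast
    show "u \<in> ideal_pow R m n"
      unfolding ideal_pow_def ideal_span_def
    proof (rule CollectI, rule exI[of _ "1::nat"], rule exI[of _ "\<lambda>_. v"],
        rule exI[of _ "\<lambda>_. \<Prod>i<n. \<pi>"], intro conjI allI impI)
      show "u = (\<Sum>i<(1::nat). v * (\<Prod>i<n. \<pi>))" by (simp add: v(2))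
      show "(\<Prod>i<n. \<pi>) \<in> {\<Prod>i<n. b i | b. \<forall>i<n. b i \<in> m}"
        using \<pi>_in_m by (intro CollectI exI[of _ "\<lambda>_. \<pi>"]) simp
    qed (rule v(1))
  qed
qed

lemma R_approx:
  assumes "u \<in> R"
  obtains h where "u - pev \<iota> h t \<in> M n"
proof -
  obtain h where "\<forall>i<n. taylor h $$$ i = \<Theta> u $$$ i" using taylor_dense by blast
  then have "u - pev \<iota> h t \<in> M n"
    using assms by (simp add: M_def \<Theta>_diff R_diff pev_t_in_R \<Theta>_pev)
  then show thesis by (rule that)
qed

end

text \<open>The division in the definition is exact: the dividend, as a polynomial in the outer
  variable, has the inner variable as a root.\<close>

lemma difference_quotient_mult:
  "[:- [:0, 1:], 1:] * difference_quotient G = map_poly (\<lambda>c. [:c:]) G - [:G:]" for G :: "'a::field poly"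
proof -
  interpret C: comm_ring_hom "\<lambda>c::'a. [:c:]"
    by unfold_locales simp_all
  have "pev (\<lambda>c. [:c:]) G [:0, 1:] = G"
    by (induction G) simp_all
  then have "poly (map_poly (\<lambda>c. [:c:]) G - [:G:]) [:0, 1:] = 0"
    by (simp add: pev_def)
  then have "[:- [:0, 1:], 1:] dvd map_poly (\<lambda>c. [:c:]) G - [:G:]"
    by (simp only: poly_eq_0_iff_dvd)
  then show ?thesis
    unfolding difference_quotient_def by (rule dvd_mult_div_cancel)
qed

lemma (in comm_ring_hom) pev_comm_ring_hom: "comm_ring_hom (\<lambda>h. pev hom h x)"
  by unfold_locales (simp_all add: pev_add pev_mult)

lemma (in comm_ring_hom) map_poly_pev_mult:
  "map_poly (\<lambda>h. pev hom h x) (P * Q) = map_poly (\<lambda>h. pev hom h x) P * map_poly (\<lambda>h. pev hom h x) Q"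
proof -
  interpret E: map_poly_comm_ring_hom "\<lambda>h. pev hom h x"
    using pev_comm_ring_hom by (rule map_poly_comm_ring_hom.intro)
  show ?thesis by (rule E.hom_mult)
qed

text \<open>Specialisation of the inner variable t2 to x. It is used in the function field with x =
  t, and in the residue field with x = \<tau>.\<close>

lemma (in field_hom) difference_quotient_eval:
  "[:- x, 1:] * map_poly (\<lambda>h. pev hom h x) (difference_quotient G) =
    map_poly hom G - [:pev hom G x:]"
proof -
  interpret E: map_poly_comm_ring_hom "\<lambda>h. pev hom h x"
    using pev_comm_ring_hom by (rule map_poly_comm_ring_hom.intro)
  have "map_poly (\<lambda>h. pev hom h x) [:- [:0, 1:], 1:] = [:- x, 1:]"
    by (simp add: map_poly_pCons hom_uminus)
  then have "[:- x, 1:] * map_poly (\<lambda>h. pev hom h x) (difference_quotient G)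
      = map_poly (\<lambda>h. pev hom h x) ([:- [:0, 1:], 1:] * difference_quotient G)"
    by (simp only: map_poly_pev_mult)
  also have "\<dots> = map_poly (\<lambda>h. pev hom h x) (map_poly (\<lambda>c. [:c:]) G) - map_poly (\<lambda>h. pev hom h x) [:G:]"
    by (simp only: difference_quotient_mult E.hom_minus)
  also have "map_poly (\<lambda>h. pev hom h x) (map_poly (\<lambda>c. [:c:]) G) = map_poly hom G"
    by (subst map_poly_map_poly) (simp_all add: o_def)
  also have "map_poly (\<lambda>h. pev hom h x) [:G:] = [:pev hom G x:]"
    by (rule poly_eqI) (simp add: coeff_map_poly coeff_pCons split: nat.splits)
  finally show ?thesis .
qed

section \<open>Functionals on the quotient by an element of order N\<close>

context local_chart
begin

definition has_order :: "'b \<Rightarrow> nat \<Rightarrow> 'c \<Rightarrow> bool" where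
  "has_order \<phi> N \<delta> \<longleftrightarrow> \<phi> \<in> M N \<and> \<Theta> \<phi> $$$ N = \<delta> \<and> \<delta> \<noteq> 0"

lemma \<Theta>_\<pi>_power_nth: "\<Theta> (\<pi> ^ n) $$$ n \<noteq> 0"
  using \<Theta>_\<pi>_power_mult[OF R_1, of n 0] by (auto simp: \<Theta>_1)

lemma principal_ideal_eq:
  assumes "has_order \<phi> N \<delta>"
  shows "principal_ideal R \<phi> = M N"
proof
  have \<phi>: "\<phi> \<in> M N" "\<Theta> \<phi> $$$ N \<noteq> 0" using assms by (auto simp: has_order_def)
  show "principal_ideal R \<phi> \<subseteq> M N" using M_mult_R[OF \<phi>(1)] by auto
  obtain w where w: "w \<in> R" "\<phi> = \<pi> ^ N * w" using \<phi>(1) unfolding M_eq by blast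
  have "\<Theta> w $$$ 0 \<noteq> 0"
  proof
    assume "\<Theta> w $$$ 0 = 0"
    then have "w \<in> M 1" using w(1) by (simp add: M_def)
    then have "\<phi> \<in> M (N + 1)" unfolding w(2) by (rule M_mult[OF \<pi>_power])
    with \<phi>(2) show False by (simp add: M_def)
  qed
  then have iw: "inverse w \<in> R" "w \<noteq> 0" using R_inverse[OF w(1)] by (auto simp: \<Theta>_0)
  show "M N \<subseteq> principal_ideal R \<phi>"
  proof
    fix u assume "u \<in> M N"
    then obtain v where v: "v \<in> R" "u = \<pi> ^ N * v" unfolding M_eq by blast
    have "u = \<phi> * (inverse w * v)" using iw(2) by (simp add: v(2) w(2))
    with R_mult[OF iw(1) v(1)] show "u \<in> principal_ideal R \<phi>" by blast
  qed
qed

lemma ideal_pow_subset_iff: "ideal_pow R m n \<subseteq> M N \<longleftrightarrow> N \<le> n"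
proof
  assume "ideal_pow R m n \<subseteq> M N"
  then have "\<pi> ^ n \<in> M N" using \<pi>_power[of n] by (auto simp: ideal_pow_eq)
  then show "N \<le> n" using \<Theta>_\<pi>_power_nth[of n] by (auto simp: M_def not_le[symmetric])
qed (simp add: ideal_pow_eq M_mono)

text \<open>Vanishing at \<tau> over k becomes divisibility over F: if G = p^N e, the next
  coefficient is p'(\<tau>)^N e(\<tau>), and its vanishing makes p divide e.\<close>

lemma p_power_dvd:
  assumes "\<forall>i<N. taylor G $$$ i = 0"
  shows "p ^ N dvd G"
  using assms
proof (induction N)
  case (Suc N)
  then obtain e where e: "G = p ^ N * e" by (auto elim: dvdE)
  have "taylor G $$$ N = 0" using Suc.prems by simp
  then have "pev \<kappa> e \<tau> = 0" using taylor_p_power_mult(2)[of N e] p'_nonzero by (simp add: e)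
  then have "p dvd e" by (rule minimal)
  then show ?case by (simp add: e mult.commute[of p] mult_dvd_mono)
qed simp

text \<open>The contraction of \<open>\<eta>(u \<cdot> _)\<close> with the difference quotient of \<open>G\<close>.\<close>

definition contraction :: "('b \<Rightarrow> 'a) \<Rightarrow> 'a poly \<Rightarrow> 'b \<Rightarrow> 'b" where
  "contraction \<eta> G u = functional_on_poly (\<lambda>i. \<iota> (\<eta> (t ^ i * u)))
     (map_poly (\<lambda>h. pev \<iota> h t) (difference_quotient G))"

definition linear_on :: "('b \<Rightarrow> 'a) \<Rightarrow> bool" where
  "linear_on \<eta> \<longleftrightarrow> (\<forall>u\<in>R. \<forall>v\<in>R. \<eta> (u + v) = \<eta> u + \<eta> v) \<and> (\<forall>c. \<forall>u\<in>R. \<eta> (\<iota> c * u) = c * \<eta> u)"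

lemma linear_onD:
  assumes "linear_on \<eta>"
  shows "u \<in> R \<Longrightarrow> v \<in> R \<Longrightarrow> \<eta> (u + v) = \<eta> u + \<eta> v" "u \<in> R \<Longrightarrow> \<eta> (\<iota> c * u) = c * \<eta> u"
    "\<eta> 0 = 0" "(\<And>i. i \<in> A \<Longrightarrow> f i \<in> R) \<Longrightarrow> \<eta> (sum f A) = (\<Sum>i\<in>A. \<eta> (f i))"
    "u \<in> R \<Longrightarrow> v \<in> R \<Longrightarrow> \<eta> (u - v) = \<eta> u - \<eta> v"
proof -
  show add: "\<eta> (u + v) = \<eta> u + \<eta> v" if "u \<in> R" "v \<in> R" for u v
    using assms that by (simp add: linear_on_def)
  show "u \<in> R \<Longrightarrow> \<eta> (\<iota> c * u) = c * \<eta> u" using assms by (simp add: linear_on_def)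
  show z: "\<eta> 0 = 0" using add[OF R_0 R_0] by (metis add_0 add_cancel_right_right)
  show "(\<And>i. i \<in> A \<Longrightarrow> f i \<in> R) \<Longrightarrow> \<eta> (sum f A) = (\<Sum>i\<in>A. \<eta> (f i))"
    by (induction A rule: infinite_finite_induct) (simp_all add: z add R_sum)
  show "\<eta> (u - v) = \<eta> u - \<eta> v" if "u \<in> R" "v \<in> R"
    using add[OF R_diff[OF that] that(2)] by simp
qed

lemma \<eta>_pev_mult:
  assumes "linear_on \<eta>" "u \<in> R"
  shows "\<eta> (pev \<iota> h t * u) = (\<Sum>i\<le>degree h. coeff h i * \<eta> (t ^ i * u))"
proof -
  have "pev \<iota> h t * u = (\<Sum>i\<le>degree h. \<iota> (coeff h i) * (t ^ i * u))"
    by (simp add: emb.pev_altdef sum_distrib_right mult.assoc)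
  then have "\<eta> (pev \<iota> h t * u) = (\<Sum>i\<le>degree h. \<eta> (\<iota> (coeff h i) * (t ^ i * u)))"
    using assms(2) by (simp only:) (intro linear_onD(4)[OF assms(1)] R_mult R_const R_power t_in_R)
  also have "\<dots> = (\<Sum>i\<le>degree h. coeff h i * \<eta> (t ^ i * u))"
    using assms(2) by (intro sum.cong refl linear_onD(2)[OF assms(1)] R_mult R_power t_in_R)
  finally show ?thesis .
qed

text \<open>Identifies the double sum in \<open>ekl_functional\<close> with the contraction for u =
  1, which is easier to transform.\<close>

lemma contraction_eq_sum:
  assumes "linear_on \<eta>"
  shows "(let H = difference_quotient G in
     (\<Sum>i\<le>degree H. \<Sum>j\<le>degree (coeff H i). \<iota> (\<eta> (\<iota> (coeff (coeff H i) j) * t ^ i)) * t ^ j)) = contraction \<eta> G 1"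
proof -
  define H where "H = difference_quotient G"
  have "contraction \<eta> G 1 = (\<Sum>i<Suc (degree H). pev \<iota> (coeff H i) t * \<iota> (\<eta> (t ^ i)))"
    unfolding contraction_def H_def[symmetric]
    using degree_map_poly_le[of "\<lambda>h. pev \<iota> h t" H]
    by (subst functional_on_poly_altdef[of _ "Suc (degree H)"]) (simp_all add: coeff_map_poly)
  also have "\<dots> = (\<Sum>i\<le>degree H. \<Sum>j\<le>degree (coeff H i). \<iota> (\<eta> (\<iota> (coeff (coeff H i) j) * t ^ i)) * t ^ j)"
    unfolding lessThan_Suc_atMost
    using linear_onD(2)[OF assms] R_power t_in_R
    by (intro sum.cong refl) (simp add: emb.pev_altdef sum_distrib_left sum_distrib_right emb.hom_mult mult_ac)
  finally show ?thesis by (simp add: H_def Let_def)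
qed

lemma contraction_in_R: "contraction \<eta> G u \<in> R"
  unfolding contraction_def functional_on_poly_def
  by (intro R_sum R_mult R_const) (simp add: coeff_map_poly pev_t_in_R)

text \<open>The difference quotient times t1 - t2 is G(t1) - G(t2), and G(t) is zero in the
  quotient. So multiplication by t in the contracted factor agrees with multiplication by t in the
  other one.\<close>

lemma contraction_mult_t:
  assumes \<eta>: "linear_on \<eta>" "\<And>u. u \<in> M N \<Longrightarrow> \<eta> u = 0" and u: "u \<in> R" and G: "pev \<iota> G t \<in> M N"
  shows "contraction \<eta> G (t * u) - t * contraction \<eta> G u \<in> M N"
proof -
  define E where "E = functional_on_poly (\<lambda>i. \<iota> (\<eta> (t ^ i * u)))"
  define H where "H = map_poly (\<lambda>h. pev \<iota> h t) (difference_quotient G)"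
  have "contraction \<eta> G (t * u) = E (pCons 0 H)"
    by (simp add: contraction_def E_def H_def functional_on_poly_pCons mult_ac)
  moreover have "contraction \<eta> G u = E H" by (simp add: contraction_def E_def H_def)
  moreover have "pCons 0 H = smult t H + map_poly \<iota> G - [:pev \<iota> G t:]"
    using emb.difference_quotient_eval[of t G] by (simp add: H_def algebra_simps)
  then have "pCons 0 H + [:pev \<iota> G t:] = smult t H + map_poly \<iota> G" by simp
  then have "E (pCons 0 H) + E [:pev \<iota> G t:] = t * E H + E (map_poly \<iota> G)"
    unfolding E_def by (metis functional_on_poly_add functional_on_poly_smult)
  moreover have "E (map_poly \<iota> G) = \<iota> (\<eta> (pev \<iota> G t * u))"
    by (simp add: E_def functional_on_poly_def \<eta>_pev_mult[OF \<eta>(1) u] emb.hom_sum emb.hom_mult)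
  moreover have "\<eta> (pev \<iota> G t * u) = 0" by (rule \<eta>(2)[OF M_mult_R[OF G u]])
  moreover have "E [:pev \<iota> G t:] = pev \<iota> G t * \<iota> (\<eta> u)"
    by (simp add: E_def functional_on_poly_def)
  ultimately have "contraction \<eta> G (t * u) - t * contraction \<eta> G u = pev \<iota> G t * - \<iota> (\<eta> u)"
    by (simp add: algebra_simps)
  moreover have "pev \<iota> G t * - \<iota> (\<eta> u) \<in> M N"
    by (intro M_mult_R[OF G] R_uminus R_const)
  ultimately show ?thesis by simp
qed

lemma contraction_linear:
  assumes "linear_on \<eta>" "u \<in> R" "v \<in> R"
  shows "contraction \<eta> G (u + v) = contraction \<eta> G u + contraction \<eta> G v"
    "contraction \<eta> G (\<iota> c * u) = \<iota> c * contraction \<eta> G u"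
proof -
  have "\<eta> (t ^ i * (u + v)) = \<eta> (t ^ i * u) + \<eta> (t ^ i * v)" for i
    using assms by (simp add: distrib_left linear_onD(1) R_mult R_power t_in_R)
  then show "contraction \<eta> G (u + v) = contraction \<eta> G u + contraction \<eta> G v"
    by (simp add: contraction_def functional_on_poly_def emb.hom_add distrib_left sum.distrib)
  have "\<eta> (t ^ i * (\<iota> c * u)) = c * \<eta> (t ^ i * u)" for i
    using linear_onD(2)[OF assms(1) R_mult[OF R_power[OF t_in_R] assms(2)], of c i]
    by (simp only: mult.left_commute)
  then show "contraction \<eta> G (\<iota> c * u) = \<iota> c * contraction \<eta> G u"
    by (simp add: contraction_def emb.hom_mult functional_on_poly_cmult)
qed

lemma contraction_mult_pev:
  assumes \<eta>: "linear_on \<eta>" "\<And>u. u \<in> M N \<Longrightarrow> \<eta> u = 0" and u: "u \<in> R" and G: "pev \<iota> G t \<in> M N"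
  shows "contraction \<eta> G (pev \<iota> h t * u) - pev \<iota> h t * contraction \<eta> G u \<in> M N"
proof (induction h)
  case 0
  have "\<eta> 0 = 0" by (rule linear_onD(3)[OF \<eta>(1)])
  then have "contraction \<eta> G 0 = 0"
    by (simp add: contraction_def functional_on_poly_def)
  then show ?case by (simp add: M_def R_0 \<Theta>_0)
next
  case (pCons a h)
  define v where "v = pev \<iota> h t * u"
  have v: "v \<in> R" by (simp add: v_def R_mult pev_t_in_R u)
  have "contraction \<eta> G (pev \<iota> (pCons a h) t * u) = contraction \<eta> G (\<iota> a * u + t * v)"
    by (simp add: v_def algebra_simps)
  also have "\<dots> = \<iota> a * contraction \<eta> G u + contraction \<eta> G (t * v)"
    using u v by (simp add: contraction_linear[OF \<eta>(1)] R_mult R_const t_in_R)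
  finally have "contraction \<eta> G (pev \<iota> (pCons a h) t * u) - pev \<iota> (pCons a h) t * contraction \<eta> G u =
      (contraction \<eta> G (t * v) - t * contraction \<eta> G v) +
      (contraction \<eta> G v - pev \<iota> h t * contraction \<eta> G u) * t"
    by (simp add: algebra_simps)
  moreover have "contraction \<eta> G (t * v) - t * contraction \<eta> G v \<in> M N"
    by (rule contraction_mult_t[OF \<eta> v G])
  moreover have "(contraction \<eta> G v - pev \<iota> h t * contraction \<eta> G u) * t \<in> M N"
    using pCons.IH unfolding v_def by (rule M_mult_R[OF _ t_in_R])
  ultimately show ?case by (simp add: M_add)
qed

text \<open>Elements with the same first N coefficients have the same value under \<eta>. For i < N,
  sending c to the value at a polynomial in t with expansion c s^i modulo s^N is an F-linear form on
  k, hence c to Tr(l_i c). Subtracting such polynomials coefficient by coefficient reduces u to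
  \<open>M N\<close>.\<close>

lemma functional_representation:
  assumes \<eta>: "linear_on \<eta>" "\<And>u. u \<in> M N \<Longrightarrow> \<eta> u = 0"
  obtains l where "\<And>u. u \<in> R \<Longrightarrow> \<eta> u = field_trace \<kappa> (\<Sum>i<N. l i * \<Theta> u $$$ i)"
proof -
  have "\<exists>w. \<forall>c. \<forall>u\<in>M i. (\<forall>j. i < j \<and> j < N \<longrightarrow> \<Theta> u $$$ j = 0) \<and> \<Theta> u $$$ i = c \<longrightarrow> \<eta> u = field_trace \<kappa> (w * c)"
    if i: "i < N" for i
  proof -
    have "\<forall>c. \<exists>h. \<forall>j<N. taylor h $$$ j = (fps_const c * fps_X ^ i) $$$ j" using taylor_dense by blast
    then obtain h where h: "\<forall>c. \<forall>j<N. taylor (h c) $$$ j = (fps_const c * fps_X ^ i) $$$ j"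
      by (rule choice[THEN exE])
    then have h: "taylor (h c) $$$ j = (if j = i then c else 0)" if "j < N" for c j
      using that by (simp add: fps_X_power_iff)
    define \<mu> where "\<mu> c = \<eta> (pev \<iota> (h c) t)" for c
    have cong: "\<eta> u = \<eta> v" if "u \<in> R" "v \<in> R" "\<And>j. j < N \<Longrightarrow> \<Theta> u $$$ j = \<Theta> v $$$ j" for u v
    proof -
      have "u - v \<in> M N" using that by (simp add: M_def R_diff \<Theta>_diff)
      then show ?thesis using \<eta>(2) linear_onD(5)[OF \<eta>(1) that(1,2)] by simp
    qed
    have "linear_form \<mu>"
      unfolding linear_form_def
    proof (intro conjI allI)
      fix c c'
      have "\<mu> (c + c') = \<eta> (pev \<iota> (h c) t + pev \<iota> (h c') t)"
        unfolding \<mu>_def by (rule cong) (simp_all add: R_add pev_t_in_R \<Theta>_add \<Theta>_pev h)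
      then show "\<mu> (c + c') = \<mu> c + \<mu> c'" by (simp add: \<mu>_def linear_onD(1)[OF \<eta>(1)] pev_t_in_R)
    next
      fix a c
      have "\<mu> (\<kappa> a * c) = \<eta> (\<iota> a * pev \<iota> (h c) t)"
        unfolding \<mu>_def by (rule cong) (simp_all add: R_mult R_const pev_t_in_R \<Theta>_mult \<Theta>_const \<Theta>_pev h)
      then show "\<mu> (\<kappa> a * c) = a * \<mu> c" by (simp add: \<mu>_def linear_onD(2)[OF \<eta>(1)] pev_t_in_R)
    qed
    then obtain w where w: "\<And>c. \<mu> c = field_trace \<kappa> (w * c)" by (rule linear_form_eq_trace) blast
    have "\<eta> u = field_trace \<kappa> (w * c)"
      if "u \<in> M i" "\<forall>j. i < j \<and> j < N \<longrightarrow> \<Theta> u $$$ j = 0" "\<Theta> u $$$ i = c" for c u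
    proof -
      have "\<eta> u = \<mu> c"
        unfolding \<mu>_def
      proof (rule cong)
        show "\<Theta> u $$$ j = \<Theta> (pev \<iota> (h c) t) $$$ j" if "j < N" for j
          using that \<open>u \<in> M i\<close> \<open>\<forall>j. i < j \<and> j < N \<longrightarrow> \<Theta> u $$$ j = 0\<close> \<open>\<Theta> u $$$ i = c\<close>
          by (cases j i rule: linorder_cases) (simp_all add: \<Theta>_pev h M_def)
      qed (use that M_R pev_t_in_R in blast)+
      then show ?thesis by (simp add: w)
    qed
    then show ?thesis by (intro exI[of _ w]) blast
  qed
  then have "\<forall>i. \<exists>w. i < N \<longrightarrow> (\<forall>c. \<forall>u\<in>M i. (\<forall>j. i < j \<and> j < N \<longrightarrow> \<Theta> u $$$ j = 0) \<and> \<Theta> u $$$ i = c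
      \<longrightarrow> \<eta> u = field_trace \<kappa> (w * c))" by blast
  then obtain l where "\<forall>i. i < N \<longrightarrow> (\<forall>c. \<forall>u\<in>M i. (\<forall>j. i < j \<and> j < N \<longrightarrow> \<Theta> u $$$ j = 0) \<and> \<Theta> u $$$ i = c
      \<longrightarrow> \<eta> u = field_trace \<kappa> (l i * c))" by (rule choice[THEN exE])
  then have l: "\<eta> u = field_trace \<kappa> (l i * \<Theta> u $$$ i)"
    if "i < N" "u \<in> M i" "\<And>j. i < j \<Longrightarrow> j < N \<Longrightarrow> \<Theta> u $$$ j = 0" for i u
    using that by blast
  have "\<eta> u = field_trace \<kappa> (\<Sum>i=k..<N. l i * \<Theta> u $$$ i)" if "u \<in> M k" "k \<le> N" for k u
    using that
  proof (induction "N - k" arbitrary: k u)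
    case 0
    then have "k = N" by simp
    with 0 show ?case by (simp add: \<eta>(2) linear_formD(3)[OF linear_form_trace])
  next
    case (Suc n)
    then have k: "k < N" by simp
    obtain h where h: "\<forall>j<N. taylor h $$$ j = (fps_const (\<Theta> u $$$ k) * fps_X ^ k) $$$ j"
      using taylor_dense by blast
    then have h: "taylor h $$$ j = (if j = k then \<Theta> u $$$ k else 0)" if "j < N" for j
      using that by (simp add: fps_X_power_iff)
    define v where "v = pev \<iota> h t"
    have v: "v \<in> M k" and v': "\<Theta> v $$$ j = (if j = k then \<Theta> u $$$ k else 0)" if "j < N" for j
      using h k by (simp_all add: v_def M_def pev_t_in_R \<Theta>_pev that)
    have uR: "u \<in> R" and vR: "v \<in> R" using Suc.prems M_R by (simp_all add: v_def pev_t_in_R)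
    have d: "u - v \<in> M (Suc k)"
      using Suc.prems v v' k by (simp add: M_def R_diff \<Theta>_diff less_Suc_eq all_conj_distrib)
    have "\<eta> (u - v) = field_trace \<kappa> (\<Sum>i=Suc k..<N. l i * \<Theta> (u - v) $$$ i)"
      using Suc.hyps(2) k by (intro Suc.hyps(1)[OF _ d]) simp_all
    also have "(\<Sum>i=Suc k..<N. l i * \<Theta> (u - v) $$$ i) = (\<Sum>i=Suc k..<N. l i * \<Theta> u $$$ i)"
      by (intro sum.cong refl) (simp add: \<Theta>_diff[OF uR vR] v')
    finally have "\<eta> u = field_trace \<kappa> (\<Sum>i=Suc k..<N. l i * \<Theta> u $$$ i) + \<eta> v"
      by (simp add: linear_onD(5)[OF \<eta>(1) uR vR] diff_eq_eq)
    also have "\<eta> v = field_trace \<kappa> (l k * \<Theta> u $$$ k)"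
      using l[OF k, of v] v[OF k] v' k by simp
    finally show ?case
      using k by (simp add: sum.atLeast_Suc_lessThan linear_formD(1)[OF linear_form_trace] add.commute)
  qed
  from this[of _ 0] have "\<eta> u = field_trace \<kappa> (\<Sum>i<N. l i * \<Theta> u $$$ i)" if "u \<in> R" for u
    using that by (simp add: M_0 lessThan_atLeast0)
  then show thesis by (rule that)
qed

end

context local_chart
begin

lemma contraction_residue:
  "\<Theta> (contraction \<eta> G u) $$$ 0 = functional_on_poly (\<lambda>i. \<kappa> (\<eta> (t ^ i * u)))
     (map_poly (\<lambda>h. pev \<kappa> h \<tau>) (difference_quotient G))"
proof -
  define H where "H = difference_quotient G"
  have "contraction \<eta> G u = (\<Sum>i<Suc (degree H). pev \<iota> (coeff H i) t * \<iota> (\<eta> (t ^ i * u)))"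
    unfolding contraction_def H_def[symmetric]
    using degree_map_poly_le[of "\<lambda>h. pev \<iota> h t" H]
    by (subst functional_on_poly_altdef[of _ "Suc (degree H)"]) (simp_all add: coeff_map_poly)
  then have "\<Theta> (contraction \<eta> G u) = (\<Sum>i<Suc (degree H). taylor (coeff H i) * fps_const (\<kappa> (\<eta> (t ^ i * u))))"
    by (simp add: \<Theta>_sum \<Theta>_mult \<Theta>_add \<Theta>_pev \<Theta>_const R_mult R_sum R_const pev_t_in_R)
  then have "\<Theta> (contraction \<eta> G u) $$$ 0 = (\<Sum>i<Suc (degree H). pev \<kappa> (coeff H i) \<tau> * \<kappa> (\<eta> (t ^ i * u)))"
    by (simp add: fps_sum_nth taylor_nth_0)
  also have "\<dots> = functional_on_poly (\<lambda>i. \<kappa> (\<eta> (t ^ i * u))) (map_poly (\<lambda>h. pev \<kappa> h \<tau>) H)"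
    using degree_map_poly_le[of "\<lambda>h. pev \<kappa> h \<tau>" H]
    by (subst functional_on_poly_altdef[of _ "Suc (degree H)"]) (simp_all add: coeff_map_poly)
  finally show ?thesis by (simp add: H_def)
qed

text \<open>With G = p^N e, specialising t2 to \<tau> turns the difference quotient into h times
  \<open>cofactor\<close>, where h = p^(N-1) e. As h(t) vanishes to order N - 1, \<eta> sees only
  its coefficient N - 1, which gives l_(N-1) p'(\<tau>)^(N-1) e(\<tau>); Euler's formula supplies
  one more p'(\<tau>), and p'(\<tau>)^N e(\<tau>) = \<delta>.\<close>

lemma contraction_one_residue:
  assumes \<eta>: "linear_on \<eta>" and l: "\<And>u. u \<in> R \<Longrightarrow> \<eta> u = field_trace \<kappa> (\<Sum>i<N. l i * \<Theta> u $$$ i)"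
    and N: "N > 0" and G: "\<And>i. i < N \<Longrightarrow> taylor G $$$ i = 0" "taylor G $$$ N = \<delta>"
  shows "\<Theta> (contraction \<eta> G 1) $$$ 0 = l (N - 1) * \<delta>"
proof -
  obtain N' where N': "N = Suc N'" using N gr0_conv_Suc by blast
  obtain e where e: "G = p ^ N * e" using p_power_dvd[of N G] G(1) by (auto elim: dvdE)
  have \<delta>: "\<delta> = p' ^ N * pev \<kappa> e \<tau>" using taylor_p_power_mult(2)[of N e] G(2) by (simp add: e)
  define h where "h = p ^ N' * e"
  define Q where "Q = map_poly (\<lambda>h. pev \<kappa> h \<tau>) (difference_quotient G)"
  have Gh: "G = h * p" by (simp add: e h_def N')
  have "pev \<kappa> G \<tau> = 0" by (simp add: Gh pev_mult root)
  then have "[:- \<tau>, 1:] * Q = map_poly \<kappa> G"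
    using difference_quotient_eval[of \<tau> G] by (simp add: Q_def)
  also have "\<dots> = map_poly \<kappa> h * map_poly \<kappa> p"
  proof -
    interpret K: map_poly_comm_ring_hom \<kappa> ..
    show ?thesis unfolding Gh by (rule K.hom_mult)
  qed
  also have "\<dots> = [:- \<tau>, 1:] * (map_poly \<kappa> h * cofactor)"
    unfolding cofactor by (simp only: mult_ac)
  finally have Q: "Q = map_poly \<kappa> h * cofactor"
    by (subst (asm) mult_cancel_left) simp
  have inner: "functional_on_poly (\<lambda>i. \<kappa> (\<eta> (t ^ (i + j)))) (map_poly \<kappa> h) =
      \<kappa> (field_trace \<kappa> (l N' * (p' ^ N' * pev \<kappa> e \<tau>) * \<tau> ^ j))" for j
  proof -
    have "functional_on_poly (\<lambda>i. \<kappa> (\<eta> (t ^ (i + j)))) (map_poly \<kappa> h) = \<kappa> (\<eta> (pev \<iota> h t * t ^ j))"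
      by (simp add: functional_on_poly_def \<eta>_pev_mult[OF \<eta>] R_power t_in_R hom_sum hom_mult power_add)
    also have "pev \<iota> h t * t ^ j = pev \<iota> (p ^ N' * (e * monom 1 j)) t"
      by (simp add: h_def emb.pev_mult emb.pev_monom mult.assoc)
    also have "\<eta> \<dots> = field_trace \<kappa> (\<Sum>i<N. l i * taylor (p ^ N' * (e * monom 1 j)) $$$ i)"
      by (simp add: l pev_t_in_R \<Theta>_pev)
    also have "(\<Sum>i<N. l i * taylor (p ^ N' * (e * monom 1 j)) $$$ i) = l N' * (p' ^ N' * pev \<kappa> (e * monom 1 j) \<tau>)"
      by (simp add: N' taylor_p_power_mult)
    also have "pev \<kappa> (e * monom 1 j) \<tau> = pev \<kappa> e \<tau> * \<tau> ^ j" by (simp add: pev_mult pev_monom)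
    finally show ?thesis by (simp only: mult.assoc)
  qed
  have "\<Theta> (contraction \<eta> G 1) $$$ 0 = functional_on_poly (\<lambda>i. \<kappa> (\<eta> (t ^ i))) (map_poly \<kappa> h * cofactor)"
    by (simp add: contraction_residue Q flip: Q_def)
  also have "\<dots> = l N' * (p' ^ N' * pev \<kappa> e \<tau>) * p'"
    by (simp only: functional_on_poly_mult inner trace_cofactor p'_def)
  also have "\<dots> = l (N - 1) * \<delta>" by (simp add: \<delta> N' mult_ac)
  finally show ?thesis .
qed

text \<open>The inclusion of ideals forces n \<ge> N, and N > 0 then gives 2 n \<ge> N + 1: the
  approximation G agrees with \<phi> up to and including the leading coefficient.\<close>

lemma taylor_eq_\<Theta>:
  assumes \<phi>: "has_order \<phi> N \<delta>" and n: "ideal_pow R m n \<subseteq> principal_ideal R \<phi>"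
    and G: "pev \<iota> G t - \<phi> \<in> ideal_pow R m (2 * n)" and N: "N > 0"
  shows "i < N \<Longrightarrow> taylor G $$$ i = 0" "taylor G $$$ N = \<delta>" "pev \<iota> G t \<in> M N"
proof -
  have "N \<le> n" using n by (simp add: principal_ideal_eq[OF \<phi>] ideal_pow_subset_iff)
  then have "Suc N \<le> 2 * n" using N by simp
  then have "pev \<iota> G t - \<phi> \<in> M (Suc N)" using G M_mono unfolding ideal_pow_eq by blast
  moreover have "\<phi> \<in> R" using \<phi> M_R by (auto simp: has_order_def)
  ultimately have eq: "taylor G $$$ i = \<Theta> \<phi> $$$ i" if "i < Suc N" for i
    using that by (simp add: M_def \<Theta>_diff pev_t_in_R \<Theta>_pev)
  show *: "taylor G $$$ i = 0" if "i < N" for i using eq[of i] \<phi> that by (simp add: has_order_def M_def)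
  show "taylor G $$$ N = \<delta>" using eq[of N] \<phi> by (simp add: has_order_def)
  show "pev \<iota> G t \<in> M N" using * by (simp add: M_def pev_t_in_R \<Theta>_pev)
qed

lemma ekl_functional_iff:
  assumes "has_order \<phi> N \<delta>"
  shows "ekl_functional \<iota> R t \<phi> G \<eta> \<longleftrightarrow>
    linear_on \<eta> \<and> (\<forall>u\<in>M N. \<eta> u = 0) \<and> contraction \<eta> G 1 - 1 \<in> M N"
proof -
  have "ekl_functional \<iota> R t \<phi> G \<eta> \<longleftrightarrow> linear_on \<eta> \<and> (\<forall>u\<in>M N. \<eta> u = 0) \<and>
    (let H = difference_quotient G in
     (\<Sum>i\<le>degree H. \<Sum>j\<le>degree (coeff H i). \<iota> (\<eta> (\<iota> (coeff (coeff H i) j) * t ^ i)) * t ^ j)) - 1 \<in> M N"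
    unfolding ekl_functional_def principal_ideal_eq[OF assms] linear_on_def Let_def by blast
  then show ?thesis using contraction_eq_sum by auto
qed

lemma ekl_functional_trace:
  assumes \<phi>: "has_order \<phi> N \<delta>" and n: "ideal_pow R m n \<subseteq> principal_ideal R \<phi>"
    and G: "pev \<iota> G t - \<phi> \<in> ideal_pow R m (2 * n)" and N: "N > 0"
    and \<eta>: "ekl_functional \<iota> R t \<phi> G \<eta>"
  obtains l where "\<And>u. u \<in> R \<Longrightarrow> \<eta> u = field_trace \<kappa> (\<Sum>i<N. l i * \<Theta> u $$$ i)" "l (N - 1) = 1 / \<delta>"
proof -
  have \<eta>': "linear_on \<eta>" "\<And>u. u \<in> M N \<Longrightarrow> \<eta> u = 0" and c: "contraction \<eta> G 1 - 1 \<in> M N"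
    using \<eta> unfolding ekl_functional_iff[OF \<phi>] by blast+
  obtain l where l: "\<And>u. u \<in> R \<Longrightarrow> \<eta> u = field_trace \<kappa> (\<Sum>i<N. l i * \<Theta> u $$$ i)"
    using functional_representation[OF \<eta>'] by blast
  have "\<Theta> (contraction \<eta> G 1 - 1) $$$ 0 = 0" using c N by (simp add: M_def)
  then have "\<Theta> (contraction \<eta> G 1) $$$ 0 = 1"
    by (simp add: \<Theta>_diff contraction_in_R R_1 \<Theta>_1)
  then have "l (N - 1) * \<delta> = 1"
    using contraction_one_residue[OF \<eta>'(1) l N taylor_eq_\<Theta>(1,2)[OF \<phi> n G N]] by simp
  then have "l (N - 1) = 1 / \<delta>" using \<phi> by (simp add: has_order_def eq_divide_eq)
  with l show thesis by (rule that)
qed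

text \<open>The functional supported on coefficient N - 1 with value 1/\<delta> has a contraction W
  with residue 1, so W is a unit. Precomposing with multiplication by a polynomial in t that
  approximates 1/W changes the contraction to 1 modulo \<phi>, because contraction is linear over
  the quotient.\<close>

lemma ekl_functional_exists:
  assumes \<phi>: "has_order \<phi> N \<delta>" and n: "ideal_pow R m n \<subseteq> principal_ideal R \<phi>"
    and G: "pev \<iota> G t - \<phi> \<in> ideal_pow R m (2 * n)" and N: "N > 0"
  shows "\<exists>\<eta>. ekl_functional \<iota> R t \<phi> G \<eta>"
proof -
  define l where "l i = (if i = N - 1 then 1 / \<delta> else 0)" for i
  define \<eta> where "\<eta> u = field_trace \<kappa> (\<Sum>i<N. l i * \<Theta> u $$$ i)" for u
  have lin: "linear_on \<eta>"
    unfolding linear_on_def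
  proof (intro conjI ballI allI)
    fix u v assume "u \<in> R" "v \<in> R"
    then show "\<eta> (u + v) = \<eta> u + \<eta> v"
      by (simp add: \<eta>_def \<Theta>_add distrib_left sum.distrib linear_formD(1)[OF linear_form_trace])
  next
    fix c u assume "u \<in> R"
    then have "(\<Sum>i<N. l i * \<Theta> (\<iota> c * u) $$$ i) = \<kappa> c * (\<Sum>i<N. l i * \<Theta> u $$$ i)"
      by (simp add: \<Theta>_mult \<Theta>_const R_const sum_distrib_left mult_ac)
    then show "\<eta> (\<iota> c * u) = c * \<eta> u"
      by (simp add: \<eta>_def linear_formD(2)[OF linear_form_trace])
  qed
  have zero: "\<eta> u = 0" if "u \<in> M N" for u
    using that by (simp add: \<eta>_def M_def linear_formD(3)[OF linear_form_trace])
  note tG = taylor_eq_\<Theta>[OF \<phi> n G N]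
  define W where "W = contraction \<eta> G 1"
  have W: "W \<in> R" by (simp add: W_def contraction_in_R)
  have "\<Theta> W $$$ 0 = l (N - 1) * \<delta>"
    unfolding W_def by (rule contraction_one_residue[OF lin \<eta>_def N tG(1,2)])
  also have "\<dots> = 1" using \<phi> by (simp add: l_def has_order_def)
  finally have "inverse W \<in> R" "W \<noteq> 0" using R_inverse[OF W] by (auto simp: \<Theta>_0)
  from R_approx[OF this(1)] obtain h where h: "inverse W - pev \<iota> h t \<in> M N" by blast
  define \<eta>' where "\<eta>' u = \<eta> (pev \<iota> h t * u)" for u
  have "linear_on \<eta>'"
    using linear_onD(1,2)[OF lin] R_mult[OF pev_t_in_R]
    unfolding linear_on_def \<eta>'_def by (simp add: distrib_left mult.left_commute)
  moreover have "\<eta>' u = 0" if "u \<in> M N" for u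
    using zero[OF M_mult_R[OF that pev_t_in_R]] by (simp add: \<eta>'_def mult.commute)
  moreover have "contraction \<eta>' G 1 - 1 \<in> M N"
  proof -
    have "contraction \<eta>' G 1 = contraction \<eta> G (pev \<iota> h t * 1)"
      by (simp add: contraction_def \<eta>'_def mult.commute)
    moreover have "contraction \<eta> G (pev \<iota> h t * 1) - pev \<iota> h t * W \<in> M N"
      unfolding W_def by (rule contraction_mult_pev[OF lin zero R_1 tG(3)])
    moreover have "pev \<iota> h t * W - 1 = - ((inverse W - pev \<iota> h t) * W)"
      using \<open>W \<noteq> 0\<close> by (simp add: algebra_simps)
    moreover have "(inverse W - pev \<iota> h t) * W \<in> M N" by (rule M_mult_R[OF h W])
    ultimately show ?thesis
      using M_diff[of "contraction \<eta> G (pev \<iota> h t * 1) - pev \<iota> h t * W" N "(inverse W - pev \<iota> h t) * W"]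
      by (simp add: algebra_simps)
  qed
  ultimately show ?thesis using ekl_functional_iff[OF \<phi>] by blast
qed

section \<open>Bases of the quotient and the Gram matrix\<close>

definition coords :: "nat \<Rightarrow> 'b \<Rightarrow> 'c vec" where
  "coords N u = vec N (\<lambda>i. \<Theta> u $$$ i)"

lemma \<Theta>_lincomb:
  assumes "set es \<subseteq> R"
  shows "(\<Sum>j<length es. \<iota> (c j) * es ! j) \<in> R"
    "\<Theta> (\<Sum>j<length es. \<iota> (c j) * es ! j) $$$ i = (\<Sum>j<length es. \<kappa> (c j) * \<Theta> (es ! j) $$$ i)"
proof -
  have es: "es ! j \<in> R" if "j < length es" for j using assms that by auto
  then show "(\<Sum>j<length es. \<iota> (c j) * es ! j) \<in> R"
    by (intro R_sum R_mult R_const) simp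
  have "\<Theta> (\<Sum>j<length es. \<iota> (c j) * es ! j) = (\<Sum>j<length es. \<Theta> (\<iota> (c j) * es ! j))"
    using es by (intro \<Theta>_sum R_mult R_const) simp
  also have "\<dots> = (\<Sum>j<length es. fps_const (\<kappa> (c j)) * \<Theta> (es ! j))"
    using es by (intro sum.cong refl) (simp add: \<Theta>_mult R_const \<Theta>_const)
  finally show "\<Theta> (\<Sum>j<length es. \<iota> (c j) * es ! j) $$$ i = (\<Sum>j<length es. \<kappa> (c j) * \<Theta> (es ! j) $$$ i)"
    by (simp add: fps_sum_nth)
qed

text \<open>The first N coefficients identify R/(\<phi>) with k^N as an F-space, which is where
  \<open>trace_form\<close> takes its bases.\<close>

lemma quotient_basis_iff:
  assumes "has_order \<phi> N \<delta>"
  shows "quotient_basis \<iota> R \<phi> es \<longleftrightarrow> set es \<subseteq> R \<and> basis_vec N (map (coords N) es)"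
proof (cases "set es \<subseteq> R")
  case True
  let ?L = "\<lambda>c. \<Sum>j<length es. \<iota> (c j) * es ! j"
  have eq: "u - ?L c \<in> M N \<longleftrightarrow> (\<forall>i<N. \<Theta> u $$$ i = (\<Sum>j<length es. \<kappa> (c j) * \<Theta> (es ! j) $$$ i))"
    if "u \<in> R" for u c
    using that \<Theta>_lincomb[OF True] by (simp add: M_def R_diff \<Theta>_diff)
  have nth: "(\<Sum>j<length (map (coords N) es). \<kappa> (c j) * map (coords N) es ! j $ i) =
      (\<Sum>j<length es. \<kappa> (c j) * \<Theta> (es ! j) $$$ i)" if "i < N" for c i
    using that by (simp add: coords_def)
  show ?thesis
  proof
    assume "quotient_basis \<iota> R \<phi> es"
    then have q: "\<exists>!c. c \<in> carrier_vec (length es) \<and> u - ?L (\<lambda>j. c $ j) \<in> M N" if "u \<in> R" for u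
      using that unfolding quotient_basis_def principal_ideal_eq[OF assms] by blast
    have "basis_vec N (map (coords N) es)"
    proof (rule basis_vecI)
      show "set (map (coords N) es) \<subseteq> carrier_vec N" by (auto simp: coords_def)
    next
      fix v :: "'c vec" assume "v \<in> carrier_vec N"
      obtain h where h: "\<forall>i<N. taylor h $$$ i = Abs_fps (\<lambda>i. v $ i) $$$ i"
        using taylor_dense by blast
      from q[OF pev_t_in_R[of h]] obtain c where "pev \<iota> h t - ?L (\<lambda>j. c $ j) \<in> M N" by blast
      then have "\<forall>i<N. taylor h $$$ i = (\<Sum>j<length es. \<kappa> (c $ j) * \<Theta> (es ! j) $$$ i)"
        by (simp add: eq[OF pev_t_in_R] \<Theta>_pev)
      with h have "v $ i = (\<Sum>j<length (map (coords N) es). \<kappa> (c $ j) * map (coords N) es ! j $ i)" if "i < N" for i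
        using that by (simp only: nth) simp
      then show "\<exists>c. \<forall>i<N. v $ i = (\<Sum>j<length (map (coords N) es). \<kappa> (c j) * map (coords N) es ! j $ i)"
        by blast
    next
      fix c assume "\<And>i. i < N \<Longrightarrow> (\<Sum>j<length (map (coords N) es). \<kappa> (c j) * map (coords N) es ! j $ i) = 0"
      then have "0 - ?L c \<in> M N" by (simp only: eq[OF R_0] nth) (simp add: \<Theta>_0)
      then have "0 - ?L (\<lambda>j. vec (length es) c $ j) \<in> M N" by simp
      moreover have "0 - ?L (\<lambda>j. vec (length es) (\<lambda>_. 0) $ j) \<in> M N"
        by (simp add: M_def R_0 \<Theta>_0)
      ultimately have "vec (length es) c = vec (length es) (\<lambda>_. 0)"
        using q[OF R_0] vec_carrier by blast
      then have "vec (length es) c $ j = vec (length es) (\<lambda>_. 0) $ j" for j by (simp only:)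
      then show "\<forall>j<length (map (coords N) es). c j = 0" by (metis index_vec length_map)
    qed
    with True show "set es \<subseteq> R \<and> basis_vec N (map (coords N) es)" by blast
  next
    assume "set es \<subseteq> R \<and> basis_vec N (map (coords N) es)"
    then have b: "basis_vec N (map (coords N) es)" by blast
    show "quotient_basis \<iota> R \<phi> es"
      unfolding quotient_basis_def principal_ideal_eq[OF assms]
    proof (intro conjI True ballI)
      fix u assume u: "u \<in> R"
      obtain c where "\<forall>i<N. coords N u $ i = (\<Sum>j<length (map (coords N) es). \<kappa> (c j) * map (coords N) es ! j $ i)"
        using basis_vecD(2)[OF b, of "coords N u"] by (auto simp: coords_def)
      then have "coords N u $ i = (\<Sum>j<length es. \<kappa> (c j) * \<Theta> (es ! j) $$$ i)" if "i < N" for i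
        using that nth[OF that, of c] by (simp only:)
      then have c: "u - ?L c \<in> M N"
        unfolding eq[OF u] by (simp add: coords_def)
      show "\<exists>!c. c \<in> carrier_vec (length es) \<and> u - ?L (\<lambda>j. c $ j) \<in> M N"
      proof (intro ex1I[of _ "vec (length es) c"] conjI)
        show "u - ?L (\<lambda>j. vec (length es) c $ j) \<in> M N" using c by simp
      next
        fix c' assume c': "c' \<in> carrier_vec (length es) \<and> u - ?L (\<lambda>j. c' $ j) \<in> M N"
        have "c' $ j - c j = 0" if j: "j < length es" for j
        proof (rule basis_vecD(3)[OF b, of "\<lambda>j. c' $ j - c j"])
          fix i assume i: "i < N"
          have "(\<Sum>j<length es. \<kappa> (c' $ j) * \<Theta> (es ! j) $$$ i) = (\<Sum>j<length es. \<kappa> (c j) * \<Theta> (es ! j) $$$ i)"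
            using c c' i unfolding eq[OF u] by simp
          then show "(\<Sum>j<length (map (coords N) es). \<kappa> (c' $ j - c j) * map (coords N) es ! j $ i) = 0"
            by (simp only: nth[OF i]) (simp add: hom_minus left_diff_distrib sum_subtractf)
        qed (use j in simp)
        then show "c' = vec (length es) c" using c' by (intro eq_vecI) simp_all
      qed simp
    qed
  qed
qed (simp add: quotient_basis_def)

lemma quotient_basis_exists:
  assumes "has_order \<phi> N \<delta>"
  shows "\<exists>es. quotient_basis \<iota> R \<phi> es"
proof -
  obtain bs where bs: "basis_vec N bs" using basis_vec_exists by blast
  have "\<forall>b. \<exists>h. \<forall>i<N. taylor h $$$ i = Abs_fps (\<lambda>i. b $ i) $$$ i"
    using taylor_dense by blast
  then obtain h where h: "\<forall>b. \<forall>i<N. taylor (h b) $$$ i = Abs_fps (\<lambda>i. b $ i) $$$ i"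
    by (rule choice[THEN exE])
  define es where "es = map (\<lambda>b. pev \<iota> (h b) t) bs"
  have "map (coords N) es = bs"
  proof (rule nth_equalityI)
    fix j assume "j < length (map (coords N) es)"
    then have j: "j < length bs" by (simp add: es_def)
    then have "bs ! j \<in> carrier_vec N" using basis_vecD(1)[OF bs] by auto
    then show "map (coords N) es ! j = bs ! j"
      using j h by (intro eq_vecI) (simp_all add: es_def coords_def \<Theta>_pev)
  qed (simp add: es_def)
  moreover have "set es \<subseteq> R" by (auto simp: es_def pev_t_in_R)
  ultimately show ?thesis using bs quotient_basis_iff[OF assms] by metis
qed

theorem index_class:
  assumes two: "(2::'c) \<noteq> 0"
    and \<phi>: "has_order \<phi> N \<delta>" and n: "ideal_pow R m n \<subseteq> principal_ideal R \<phi>"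
    and G: "pev \<iota> G t - \<phi> \<in> ideal_pow R m (2 * n)" and N: "N > 0"
    and \<eta>: "ekl_functional \<iota> R t \<phi> G \<eta>" and es: "quotient_basis \<iota> R \<phi> es"
  shows "gw_class (mat (length es) (length es) (\<lambda>(i, j). \<eta> (es ! i * es ! j))) =
    gw_trace \<kappa> ((\<Sum>_<N div 2. gw_hyperbolic) + (if odd N then gw_unary (1 / \<delta>) else 0))"
proof -
  obtain l where l: "\<And>u. u \<in> R \<Longrightarrow> \<eta> u = field_trace \<kappa> (\<Sum>i<N. l i * \<Theta> u $$$ i)" "l (N - 1) = 1 / \<delta>"
    using ekl_functional_trace[OF \<phi> n G N \<eta>] by blast
  have R: "set es \<subseteq> R" and b: "basis_vec N (map (coords N) es)"
    using es unfolding quotient_basis_iff[OF \<phi>] by blast+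
  \<comment> \<open>Truncation at N reflects that the functional vanishes on \<open>M N\<close>; it
    makes the Hankel matrix antitriangular, with l_(N-1) = 1/\<delta> on the antidiagonal.\<close>
  define a where "a x y = (if x + y < N then l (x + y) else 0)" for x y
  define A where "A = mat N N (\<lambda>(x, y). a x y)"
  have A: "nondeg_sym_form A \<and> gw_class A =
      (\<Sum>_<N div 2. gw_hyperbolic) + (if odd N then gw_unary (1 / \<delta>) else 0)"
    unfolding A_def
  proof (rule antitriangular_form[OF two])
    show "1 / \<delta> \<noteq> 0" using \<phi> by (simp add: has_order_def)
    show "a x y = 1 / \<delta>" if "x + y + 1 = N" for x y
    proof -
      have "x + y = N - 1" "N - 1 < N" using that by simp_all
      then show ?thesis by (simp add: a_def l(2)[unfolded One_nat_def])
    qed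
  qed (simp_all add: a_def add.commute)
  have cA: "A \<in> carrier_mat N N" by (simp add: A_def)
  have gram: "mat (length es) (length es) (\<lambda>(i, j). \<eta> (es ! i * es ! j)) = trace_gram A (map (coords N) es)"
  proof (rule eq_matI)
    fix i j assume "i < dim_row (trace_gram A (map (coords N) es))" "j < dim_col (trace_gram A (map (coords N) es))"
    then have ij: "i < length es" "j < length es" by simp_all
    define u v where "u = es ! i" and "v = es ! j"
    have uv: "u \<in> R" "v \<in> R" using R ij by (auto simp: u_def v_def)
    \<comment> \<open>The coefficients of u v are Cauchy products, so summing over k < N means
      summing over the pairs with x + y < N; zeros extend this triangle to the full square.\<close>
    have "(\<Sum>k<N. l k * \<Theta> (u * v) $$$ k) = (\<Sum>k<N. \<Sum>x\<le>k. l k * (\<Theta> u $$$ x * \<Theta> v $$$ (k - x)))"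
      by (simp add: \<Theta>_mult[OF uv] fps_mult_nth sum_distrib_left atLeast0AtMost)
    also have "\<dots> = (\<Sum>(x, y) | x + y < N. l (x + y) * (\<Theta> u $$$ x * \<Theta> v $$$ y))"
      by (subst sum.triangle_reindex) simp
    also have "\<dots> = (\<Sum>(x, y) \<in> {..<N} \<times> {..<N}. \<Theta> u $$$ x * a x y * \<Theta> v $$$ y)"
      by (rule sum.mono_neutral_cong_left) (auto simp: a_def split: if_splits)
    also have "\<dots> = (\<Sum>x<N. \<Sum>y<N. \<Theta> u $$$ x * a x y * \<Theta> v $$$ y)"
      by (rule sum.cartesian_product[symmetric])
    also have "\<dots> = (\<Sum>x<N. \<Sum>y<N. map (coords N) es ! i $ x * A $$ (x, y) * map (coords N) es ! j $ y)"
      using ij by (intro sum.cong refl) (simp add: coords_def A_def u_def v_def)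
    finally show "mat (length es) (length es) (\<lambda>(i, j). \<eta> (es ! i * es ! j)) $$ (i, j) =
        trace_gram A (map (coords N) es) $$ (i, j)"
      using ij l(1)[OF R_mult[OF uv]] trace_gram_index[OF cA basis_vecD(1)[OF b], of i j]
      by (simp add: u_def v_def)
  qed simp_all
  have "trace_form \<kappa> A (trace_gram A (map (coords N) es))"
    unfolding trace_form_altdef using b cA by (intro exI[of _ "map (coords N) es"]) simp
  from gw_trace_eq[OF conjunct1[OF A] this] A gram show ?thesis by simp
qed

theorem index_exists:
  assumes \<phi>: "has_order \<phi> N \<delta>" and N: "N > 0"
  shows "\<exists>n G \<eta> es. ideal_pow R m n \<subseteq> principal_ideal R \<phi> \<and>
     pev \<iota> G t - \<phi> \<in> ideal_pow R m (2 * n) \<and>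
     ekl_functional \<iota> R t \<phi> G \<eta> \<and> quotient_basis \<iota> R \<phi> es"
proof -
  have n: "ideal_pow R m N \<subseteq> principal_ideal R \<phi>"
    by (simp add: principal_ideal_eq[OF \<phi>] ideal_pow_eq)
  have "\<phi> \<in> R" using \<phi> M_R by (auto simp: has_order_def)
  then obtain G where "\<phi> - pev \<iota> G t \<in> M (2 * N)" by (rule R_approx)
  moreover have "0 \<in> M (2 * N)" by (simp add: M_def R_0 \<Theta>_0)
  ultimately have "0 - (\<phi> - pev \<iota> G t) \<in> M (2 * N)" by (rule M_diff[rotated])
  then have G: "pev \<iota> G t - \<phi> \<in> ideal_pow R m (2 * N)" by (simp add: ideal_pow_eq)
  show ?thesis
    using n G ekl_functional_exists[OF \<phi> n G N] quotient_basis_exists[OF \<phi>] by blast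
qed

end


section \<open>The leading coefficient of the Wronskian\<close>

text \<open>The j-th member of the series with m = l - g, as a formula over any commutative ring: it
  is applied to functions, to power series, to leading coefficients and to integral
  polynomials.\<close>

definition lam :: "nat \<Rightarrow> 'a::comm_ring_1 \<Rightarrow> 'a \<Rightarrow> nat \<Rightarrow> 'a" where
  "lam m X Y j = (if j < 2 * m then X ^ (j div 2) * Y ^ (j mod 2) else X ^ (j - m))"

text \<open>The order of vanishing of \<^term>\<open>lam m X Y j\<close> when \<open>X\<close> and \<open>Y\<close> vanish to order 2 and 1.\<close>

definition lam_order :: "nat \<Rightarrow> nat \<Rightarrow> nat" where
  "lam_order m j = (if j < 2 * m then j else 2 * (j - m))"

text \<open>Recentring the basis at another point of the plane is a unitriangular transformation. This is applied
  both to germs on the curve and to the integral polynomials \<open>X = (1 + s)\<^sup>2\<close>, \<open>Y = 1 + s\<close>.\<close>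

locale center_change =
  e: comm_ring_hom e for e :: "'k::comm_ring_1 \<Rightarrow> 'b::comm_ring_1" +
  fixes m :: nat and U V :: 'b
begin

definition lower_span :: "nat \<Rightarrow> 'b set" where
  "lower_span j = {\<Sum>i<j. e (c i) * lam m U V i | c. True}"

lemma lower_span_add:
  assumes "u \<in> lower_span j" "v \<in> lower_span j"
  shows "u + v \<in> lower_span j"
proof -
  obtain c c' where "u = (\<Sum>i<j. e (c i) * lam m U V i)" "v = (\<Sum>i<j. e (c' i) * lam m U V i)"
    using assms unfolding lower_span_def by blast
  then have "u + v = (\<Sum>i<j. e (c i + c' i) * lam m U V i)"
    by (simp add: e.hom_add distrib_right sum.distrib)
  then show ?thesis unfolding lower_span_def by (intro CollectI exI[of _ "\<lambda>i. c i + c' i"]) simp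
qed

lemma lower_span_scale:
  assumes "u \<in> lower_span j"
  shows "e a * u \<in> lower_span j"
proof -
  obtain c where "u = (\<Sum>i<j. e (c i) * lam m U V i)"
    using assms unfolding lower_span_def by blast
  then have "e a * u = (\<Sum>i<j. e (a * c i) * lam m U V i)"
    by (simp add: e.hom_mult sum_distrib_left mult_ac)
  then show ?thesis unfolding lower_span_def by (intro CollectI exI[of _ "\<lambda>i. a * c i"]) simp
qed

lemma lower_span_0: "0 \<in> lower_span j"
  unfolding lower_span_def by (intro CollectI exI[of _ "\<lambda>_. 0"]) simp

lemma lower_span_sum: "(\<And>i. i \<in> A \<Longrightarrow> f i \<in> lower_span j) \<Longrightarrow> sum f A \<in> lower_span j"
  by (induction A rule: infinite_finite_induct) (simp_all add: lower_span_0 lower_span_add)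

lemma lam_in_lower_span:
  assumes "i < j"
  shows "lam m U V i \<in> lower_span j"
proof -
  have "lam m U V i = (\<Sum>k<j. if k = i then lam m U V k else 0)" using assms by simp
  also have "\<dots> = (\<Sum>k<j. e (if k = i then 1 else 0) * lam m U V k)" by (intro sum.cong) auto
  finally show ?thesis unfolding lower_span_def by (intro CollectI exI[of _ "\<lambda>k. if k = i then 1 else 0"]) simp
qed

lemma power_even_span: "i < m \<Longrightarrow> 2 * i < j \<Longrightarrow> U ^ i \<in> lower_span j"
  using lam_in_lower_span[of "2 * i" j] by (simp add: lam_def)

lemma power_odd_span: "i < m \<Longrightarrow> 2 * i + 1 < j \<Longrightarrow> U ^ i * V \<in> lower_span j"
  using lam_in_lower_span[of "2 * i + 1" j] by (simp add: lam_def)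

lemma power_high_span: "m \<le> i \<Longrightarrow> i + m < j \<Longrightarrow> U ^ i \<in> lower_span j"
  using lam_in_lower_span[of "i + m" j] by (simp add: lam_def)

lemma shifted_power:
  "(e x + U) ^ q = U ^ q + (\<Sum>i<q. e (of_nat (q choose i) * x ^ (q - i)) * U ^ i)"
proof -
  have "(e x + U) ^ q = (\<Sum>i\<le>q. of_nat (q choose i) * U ^ i * e x ^ (q - i))"
    by (simp only: add.commute[of "e x"] binomial_ring)
  also have "\<dots> = (\<Sum>i\<le>q. e (of_nat (q choose i) * x ^ (q - i)) * U ^ i)"
    by (intro sum.cong refl) (simp add: e.hom_mult e.hom_power e.hom_of_nat mult_ac)
  finally show ?thesis by (simp flip: lessThan_Suc_atMost)
qed

text \<open>In the expansion every further term is a multiple of some U^i or U^i V. The power U^i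
  stands at position 2 i if i < m and at i + m otherwise, U^i V at 2 i + 1; all positions that occur
  are below j. The closest one is U^q, produced by \<open>e y\<close>, at position j - 1 when j = 2
  q + 1.\<close>

lemma lam_shift: "lam m (e x + U) (e y + V) j - lam m U V j \<in> lower_span j"
proof (cases "j < 2 * m")
  case False
  have "U ^ i \<in> lower_span j" if "i < j - m" for i
  proof (cases "i < m")
    case True
    then show ?thesis using False by (intro power_even_span) auto
  next
    case False
    then show ?thesis using that by (intro power_high_span) auto
  qed
  then show ?thesis
    using False by (simp add: lam_def shifted_power) (intro lower_span_sum lower_span_scale, simp)
next
  case True
  define q where "q = j div 2"
  have q: "q < m" using True by (simp add: q_def)
  show ?thesis
  proof (cases "even j")
    case True
    then have j: "j = 2 * q" by (simp add: q_def)
    have "U ^ i \<in> lower_span j" if "i < q" for i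
      using that q j by (intro power_even_span) auto
    then have "(\<Sum>i<q. e (of_nat (q choose i) * x ^ (q - i)) * U ^ i) \<in> lower_span j"
      by (intro lower_span_sum lower_span_scale) simp
    then show ?thesis using j q by (simp add: lam_def shifted_power)
  next
    case False
    then have j: "j = 2 * q + 1" unfolding q_def by presburger
    have ev: "U ^ i \<in> lower_span j" if "i \<le> q" for i
      using that q j by (intro power_even_span) auto
    have od: "U ^ i * V \<in> lower_span j" if "i < q" for i
      using that q j by (intro power_odd_span) auto
    define S where "S = (\<Sum>i<q. e (of_nat (q choose i) * x ^ (q - i)) * U ^ i)"
    have "S \<in> lower_span j" unfolding S_def using ev by (intro lower_span_sum lower_span_scale) simp
    moreover have "S * V \<in> lower_span j"
      unfolding S_def sum_distrib_right mult.assoc using od by (intro lower_span_sum lower_span_scale) simp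
    ultimately have span: "e y * (U ^ q + S) + S * V \<in> lower_span j"
      using ev[of q] by (intro lower_span_add lower_span_scale) simp_all
    have "lam m A B j = A ^ q * B" for A B :: 'b
      using j q by (simp add: lam_def)
    then have "lam m (e x + U) (e y + V) j - lam m U V j = (U ^ q + S) * (e y + V) - U ^ q * V"
      by (simp only: shifted_power S_def)
    also have "\<dots> = e y * (U ^ q + S) + S * V" by (simp add: algebra_simps)
    finally have "lam m (e x + U) (e y + V) j - lam m U V j = e y * (U ^ q + S) + S * V" .
    with span show ?thesis by simp
  qed
qed

text \<open>The new columns arise from the old ones by a matrix with unit diagonal and zeros below
  it. The scalars act on the values through \<open>e'\<close>, which covers both Hasse derivatives
  of power series and coefficients of integral polynomials.\<close>

lemma det_lam_shift:
  fixes L :: "nat \<Rightarrow> 'b \<Rightarrow> 'd::comm_ring_1"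
  assumes L_add: "\<And>i u v. L i (u + v) = L i u + L i v" and L_scale: "\<And>i c u. L i (e c * u) = e' c * L i u"
  shows "det (mat n n (\<lambda>(i, j). L i (lam m (e x + U) (e y + V) j))) = det (mat n n (\<lambda>(i, j). L i (lam m U V j)))"
proof -
  have "\<forall>j. \<exists>c. lam m (e x + U) (e y + V) j - lam m U V j = (\<Sum>i<j. e (c i) * lam m U V i)"
    using lam_shift unfolding lower_span_def by blast
  then obtain c where "\<forall>j. lam m (e x + U) (e y + V) j - lam m U V j = (\<Sum>i<j. e (c j i) * lam m U V i)"
    by (rule choice[THEN exE])
  then have c: "lam m (e x + U) (e y + V) j = lam m U V j + (\<Sum>i<j. e (c j i) * lam m U V i)" for j
    by (simp add: diff_eq_eq add.commute)
  have L0: "L i 0 = 0" for i using L_add[of i 0 0] by simp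
  have Lsum: "L i (\<Sum>k\<in>A. f k) = (\<Sum>k\<in>A. L i (f k))" for i f and A :: "nat set"
    by (induction A rule: infinite_finite_induct) (simp_all add: L0 L_add)
  define A where "A = mat n n (\<lambda>(i, j). L i (lam m U V j))"
  define P where "P = mat n n (\<lambda>(k, j). if k < j then e' (c j k) else if k = j then 1 else 0)"
  have cA: "A \<in> carrier_mat n n" and cP: "P \<in> carrier_mat n n" by (simp_all add: A_def P_def)
  have "mat n n (\<lambda>(i, j). L i (lam m (e x + U) (e y + V) j)) = A * P"
  proof (rule eq_matI)
    fix i j assume "i < dim_row (A * P)" "j < dim_col (A * P)"
    then have ij: "i < n" "j < n" using cA cP by simp_all
    have "(A * P) $$ (i, j) = (\<Sum>k<n. A $$ (i, k) * P $$ (k, j))"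
      by (rule mult_mat_index_sum[OF cA cP ij])
    also have "\<dots> = (\<Sum>k<Suc j. A $$ (i, k) * P $$ (k, j))"
      using ij by (intro sum.mono_neutral_right) (auto simp: P_def)
    also have "\<dots> = (\<Sum>k<j. e' (c j k) * L i (lam m U V k)) + L i (lam m U V j)"
      using ij by (simp add: P_def A_def mult.commute)
    also have "\<dots> = L i (lam m (e x + U) (e y + V) j)"
      by (simp add: c L_add Lsum L_scale)
    finally show "mat n n (\<lambda>(i, j). L i (lam m (e x + U) (e y + V) j)) $$ (i, j) = (A * P) $$ (i, j)"
      using ij by simp
  qed (use cA cP in simp_all)
  moreover have "det P = 1"
  proof -
    have "upper_triangular P" by (auto simp: P_def)
    then have "det P = prod_list (diag_mat P)" by (rule det_upper_triangular[OF _ cP])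
    also have "diag_mat P = replicate n 1"
      by (rule nth_equalityI) (simp_all add: diag_mat_def P_def)
    finally show ?thesis by simp
  qed
  ultimately show ?thesis using det_mult[OF cA cP] by (simp add: A_def)
qed

end

text \<open>In each Leibniz summand every row factor and every column factor occurs once. Stated
  without division, it applies where the factors are powers of s or of 2.\<close>

lemma det_scaling:
  fixes A B :: "nat \<Rightarrow> nat \<Rightarrow> 'a::comm_ring_1"
  assumes "\<And>i j. i < n \<Longrightarrow> j < n \<Longrightarrow> a i * A i j = b j * B i j"
  shows "(\<Prod>i<n. a i) * det (mat n n (\<lambda>(i, j). A i j)) = (\<Prod>j<n. b j) * det (mat n n (\<lambda>(i, j). B i j))"
proof -
  let ?S = "{q. q permutes {0..<n}}"
  have d: "det (mat n n (\<lambda>(i, j). f i j)) = (\<Sum>q\<in>?S. signof q * (\<Prod>i<n. f i (q i)))" for f :: "nat \<Rightarrow> nat \<Rightarrow> 'a"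
  proof -
    have "det (mat n n (\<lambda>(i, j). f i j)) = (\<Sum>q\<in>?S. signof q * (\<Prod>i=0..<n. mat n n (\<lambda>(i, j). f i j) $$ (i, q i)))"
      by (rule det_def') simp
    also have "\<dots> = (\<Sum>q\<in>?S. signof q * (\<Prod>i=0..<n. f i (q i)))"
    proof (intro sum.cong refl arg_cong2[where f = "(*)"] prod.cong)
      fix q i assume "q \<in> ?S" "i \<in> {0..<n}"
      then have "i < n" "q i < n" using permutes_in_image[of q "{0..<n}" i] by auto
      then show "mat n n (\<lambda>(i, j). f i j) $$ (i, q i) = f i (q i)" by simp
    qed
    finally show ?thesis by (simp only: lessThan_atLeast0)
  qed
  have "(\<Prod>i<n. a i) * (signof q * (\<Prod>i<n. A i (q i))) = (\<Prod>j<n. b j) * (signof q * (\<Prod>i<n. B i (q i)))"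
    if q: "q \<in> ?S" for q
  proof -
    have qi: "q i < n" if "i < n" for i using q permutes_in_image[of q "{0..<n}" i] that by auto
    have "(\<Prod>i<n. a i) * (\<Prod>i<n. A i (q i)) = (\<Prod>i<n. b (q i) * B i (q i))"
      unfolding prod.distrib[symmetric] by (intro prod.cong refl) (simp add: assms qi)
    also have "\<dots> = (\<Prod>i<n. b (q i)) * (\<Prod>i<n. B i (q i))" by (rule prod.distrib)
    also have "(\<Prod>i<n. b (q i)) = (\<Prod>j<n. b j)"
      using q permutes_imp_bij[of q "{0..<n}"] by (intro prod.reindex_bij_betw) (simp add: lessThan_atLeast0)
    finally show ?thesis by (simp only: mult.left_commute)
  qed
  then show ?thesis unfolding d sum_distrib_left by (intro sum.cong refl)
qed

section \<open>Determinants of Hasse derivatives of power series\<close>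

definition hasse :: "nat \<Rightarrow> 'a::comm_ring_1 fps \<Rightarrow> 'a fps" where
  "hasse k f = Abs_fps (\<lambda>n. of_nat ((n + k) choose k) * f $$$ (n + k))"

lemma hasse_nth [simp]: "hasse k f $$$ n = of_nat ((n + k) choose k) * f $$$ (n + k)"
  by (simp add: hasse_def)

lemma hasse_add: "hasse k (f + g) = hasse k f + hasse k g"
  by (rule fps_ext) (simp add: distrib_left)

lemma hasse_scale: "hasse k (fps_const c * f) = fps_const c * hasse k f"
  by (rule fps_ext) (simp add: mult_ac)

text \<open>The operator s^i D_i multiplies the coefficient of s^k by binom(k, i), so it does not
  lower the order. Once row i is scaled by s^i, column j is divisible by s^(o' j); comparing
  exponents leaves s^N, and the reduced matrix has constant terms c_j binom(o' j, i).\<close>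

lemma hasse_determinant_leading:
  fixes h :: "nat \<Rightarrow> 'a::idom fps" and o' :: "nat \<Rightarrow> nat"
  assumes h: "\<And>j k. j < n \<Longrightarrow> k < o' j \<Longrightarrow> h j $$$ k = 0" "\<And>j. j < n \<Longrightarrow> h j $$$ o' j = c j"
    and N: "(\<Sum>j<n. o' j) = (\<Sum>i<n. i) + N"
  shows "\<exists>D. det (mat n n (\<lambda>(i, j). hasse i (h j))) = fps_X ^ N * D \<and>
    D $$$ 0 = (\<Prod>j<n. c j) * det (mat n n (\<lambda>(i, j). of_nat (o' j choose i)))"
proof -
  define w where "w i j = fps_shift (o' j) (fps_X ^ i * hasse i (h j))" for i j
  have nth: "(fps_X ^ i * hasse i f) $$$ k = of_nat (k choose i) * f $$$ k" for i k and f :: "'a fps"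
    by (auto simp: fps_X_power_mult_nth binomial_eq_0)
  have w: "fps_X ^ i * hasse i (h j) = fps_X ^ o' j * w i j" if "j < n" for i j
  proof (rule fps_ext)
    fix k show "(fps_X ^ i * hasse i (h j)) $$$ k = (fps_X ^ o' j * w i j) $$$ k"
      using h(1)[OF that, of k] by (simp add: nth w_def fps_X_power_mult_nth[of "o' j"] del: hasse_nth)
  qed
  define D where "D = det (mat n n (\<lambda>(i, j). w i j))"
  have "(\<Prod>i<n. fps_X ^ i) * det (mat n n (\<lambda>(i, j). hasse i (h j))) = (\<Prod>j<n. fps_X ^ o' j) * D"
    unfolding D_def by (rule det_scaling) (rule w)
  then have "fps_X ^ (\<Sum>i<n. i) * det (mat n n (\<lambda>(i, j). hasse i (h j))) = fps_X ^ (\<Sum>i<n. i) * (fps_X ^ N * D)"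
    by (simp add: power_sum[symmetric] N power_add mult.assoc)
  then have "det (mat n n (\<lambda>(i, j). hasse i (h j))) = fps_X ^ N * D" by simp
  moreover have "D $$$ 0 = (\<Prod>j<n. c j) * det (mat n n (\<lambda>(i, j). of_nat (o' j choose i)))"
  proof -
    interpret z: comm_ring_hom "\<lambda>f :: 'a fps. f $$$ 0"
      by unfold_locales simp_all
    have "D $$$ 0 = det (map_mat (\<lambda>f. f $$$ 0) (mat n n (\<lambda>(i, j). w i j)))"
      by (simp add: D_def)
    also have "map_mat (\<lambda>f. f $$$ 0) (mat n n (\<lambda>(i, j). w i j)) = mat n n (\<lambda>(i, j). of_nat (o' j choose i) * c j)"
      by (rule eq_matI) (simp_all add: w_def nth h(2) del: hasse_nth)
    also have "det \<dots> = (\<Prod>j<n. c j) * det (mat n n (\<lambda>(i, j). of_nat (o' j choose i)))"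
      using det_scaling[of n "\<lambda>_. 1" "\<lambda>i j. of_nat (o' j choose i) * c j" c "\<lambda>i j. of_nat (o' j choose i)"]
      by (simp add: mult.commute)
    finally show ?thesis .
  qed
  ultimately show ?thesis by blast
qed

lemma coeff_monic_linear_power:
  "coeff ([:a, 1:] ^ n) i = of_nat (n choose i) * (a :: 'a::idom) ^ (n - i)"
proof (cases "i \<le> n")
  case True
  then show ?thesis by (simp only: coeff_linear_poly_power) simp
next
  case False
  then have "degree ([:a, 1:] ^ n) < i" by (simp only: degree_linear_power not_le)
  then show ?thesis using False by (simp only: coeff_eq_0) (simp add: binomial_eq_0)
qed

text \<open>The column operations that pass from the basis \<open>(1 + s)\<^sup>e\<close> to powers of \<open>(1 + s)\<^sup>2 - 1 = s (s + 2)\<close>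
  turn the determinant of the gap sequence into \<^const>\<open>binomial_matrix\<close>.\<close>

lemma det_gap_binomials:
  assumes "l > g"
  defines "m \<equiv> l - g" and "n \<equiv> 2 * (l - g) + (g + 1)"
  shows "det (mat n n (\<lambda>(i, j). int (lam_order m j choose i))) = 2 ^ (\<Sum>i<g + 1. i) * det (binomial_matrix l g)"
proof -
  \<comment> \<open>Chosen so that 1 + U = (1 + s)^2 and 1 + V = 1 + s: \<open>lam\<close> at the
    shifted arguments is (1 + s)^e with e the order of vanishing, and its coefficients are the
    binomials in question.\<close>
  define U V :: "int poly" where "U = [:0, 2, 1:]" and "V = [:0, 1:]"
  interpret center_change "\<lambda>c::int. [:c:]" m U V
    by unfold_locales simp_all
  have UV: "[:1:] + U = [:1, 1:]\<^sup>2" "[:1:] + V = [:1, 1:]"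
  proof -
    have "[:a:] + [:b, c, d:] = [:a + b, c, d:]" "[:a:] + [:b, c:] = [:a + b, c:]"
      "[:a, b:]\<^sup>2 = [:a * a, a * b + b * a, b * b:]" for a b c d :: int
      by (simp_all add: power2_eq_square)
    from this(1)[of 1 0 2 1] this(2)[of 1 0 1] this(3)[of 1 1]
    show "[:1:] + U = [:1, 1:]\<^sup>2" "[:1:] + V = [:1, 1:]"
      unfolding U_def V_def by (simp_all only: add_0_right mult_1 one_add_one)
  qed
  have lam1: "lam m ([:1:] + U) ([:1:] + V) j = [:1, 1:] ^ lam_order m j" for j
    unfolding UV lam_def lam_order_def power_mult[symmetric] power_add[symmetric] by simp
  have Upow: "U ^ q = monom 1 q * [:2, 1:] ^ q" for q
  proof -
    have "U = monom 1 1 * [:2, 1:]" by (simp add: U_def monom_altdef)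
    then show ?thesis by (simp only: power_mult_distrib monom_power) simp
  qed
  have coeffU: "coeff (U ^ q) k = (if k < q then 0 else int (q choose (k - q)) * 2 ^ (q - (k - q)))" for q k
    unfolding Upow coeff_monom_mult coeff_monic_linear_power by simp
  define A where "A = mat n n (\<lambda>(i, j). coeff (lam m U V j) i)"
  have "det (mat n n (\<lambda>(i, j). coeff (lam m ([:1:] + U) ([:1:] + V) j) i)) = det A"
    unfolding A_def by (rule det_lam_shift[where e' = "\<lambda>c. c"]) simp_all
  then have detA: "det (mat n n (\<lambda>(i, j). int (lam_order m j choose i))) = det A"
    unfolding lam1 coeff_monic_linear_power by simp
  define UL where "UL = mat (2 * m) (2 * m) (\<lambda>(i, j). coeff (lam m U V j) i)"
  define UR where "UR = mat (2 * m) (g + 1) (\<lambda>(i, j). coeff (lam m U V (2 * m + j)) i)"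
  define LR where "LR = mat (g + 1) (g + 1) (\<lambda>(i, j). coeff (U ^ (m + j)) (2 * m + i))"
  \<comment> \<open>For j < 2 m the polynomial U^q V^r with j = 2 q + r is monic of degree j. Hence
    the first 2 m columns are upper triangular with unit diagonal, and only the lower right block
    matters.\<close>
  have low: "coeff (lam m U V j) i = (if i = j then 1 else 0)" if "j < 2 * m" "j \<le> i" for i j
  proof -
    define q r where "q = j div 2" and "r = j mod 2"
    have r: "r = 0 \<or> r = 1" and j: "j = 2 * q + r" by (auto simp: q_def r_def)
    have "lam m U V j = U ^ q * V ^ r" using that by (simp add: lam_def q_def r_def)
    also have "V ^ r = monom 1 r" by (simp add: V_def monom_altdef)
    finally have "coeff (lam m U V j) i = (if i < r then 0 else coeff (U ^ q) (i - r))"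
      by (simp add: coeff_monom_mult mult.commute[of _ "monom 1 r"])
    then show ?thesis using that(2) j by (auto simp: coeffU)
  qed
  have A: "A = four_block_mat UL UR (0\<^sub>m (g + 1) (2 * m)) LR"
  proof (rule eq_matI)
    fix i j assume "i < dim_row (four_block_mat UL UR (0\<^sub>m (g + 1) (2 * m)) LR)"
      "j < dim_col (four_block_mat UL UR (0\<^sub>m (g + 1) (2 * m)) LR)"
    then have ij: "i < 2 * m + (g + 1)" "j < 2 * m + (g + 1)" by (simp_all add: UL_def LR_def)
    have "coeff (lam m U V j) i = coeff (U ^ (m + (j - 2 * m))) (2 * m + (i - 2 * m))" if "\<not> j < 2 * m" "\<not> i < 2 * m"
      using that by (simp add: lam_def)
    then show "A $$ (i, j) = four_block_mat UL UR (0\<^sub>m (g + 1) (2 * m)) LR $$ (i, j)"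
      using ij low[of j i] by (auto simp: A_def UL_def UR_def LR_def n_def m_def)
  qed (simp_all add: A_def UL_def LR_def n_def m_def)
  have "det A = det UL * det LR"
    unfolding A by (rule det_four_block_mat_lower_left_zero[of _ "2 * m" _ "g + 1"])
      (simp_all add: UL_def UR_def LR_def)
  also have "det UL = 1"
  proof -
    have "upper_triangular UL" by (auto simp: UL_def low)
    then have "det UL = prod_list (diag_mat UL)"
      by (rule det_upper_triangular[of _ "2 * m"]) (simp add: UL_def)
    also have "diag_mat UL = replicate (2 * m) 1"
      by (rule nth_equalityI) (simp_all add: diag_mat_def UL_def low)
    finally show ?thesis by simp
  qed
  finally have "det A = det LR" by simp
  moreover have "det LR = 2 ^ (\<Sum>i<g + 1. i) * det (binomial_matrix l g)"
  proof -
    let ?B = "\<lambda>i j. if i \<le> 2 * j then int ((m + j) choose (2 * j - i)) else 0"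
    \<comment> \<open>The coefficient of U^(m+j) at 2 m + i is binom(m + j, m + i - j) 2^(2j-i), and
      the binomial equals binom(m + j, 2 j - i) by symmetry. The row factors 2^i and the column
      factors 4^j differ in total by 2 to the sum of all i \<le> g. The first two cases are those
      where both sides vanish.\<close>
    have scale: "2 ^ i * coeff (U ^ (m + j)) (2 * m + i) = 2 ^ (2 * j) * ?B i j" for i j
    proof -
      consider "2 * m + i < m + j" | "m + j \<le> 2 * m + i" "2 * j < i" | "m + j \<le> 2 * m + i" "i \<le> 2 * j"
        by linarith
      then show ?thesis
      proof cases
        case 1
        then have "m + j < 2 * j - i" by simp
        then show ?thesis using 1 by (simp add: coeffU)
      next
        case 2
        then have "m + j < 2 * m + i - (m + j)" by simp
        then show ?thesis using 2 by (simp add: coeffU)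
      next
        case 3
        then have k: "2 * m + i - (m + j) = (m + j) - (2 * j - i)" "2 * j - i \<le> m + j" by simp_all
        have "(m + j) choose (2 * m + i - (m + j)) = (m + j) choose (2 * j - i)"
          unfolding k(1) by (rule binomial_symmetric[OF k(2), symmetric])
        moreover have "m + j - (2 * m + i - (m + j)) = 2 * j - i"
          unfolding k(1) by (rule diff_diff_cancel[OF k(2)])
        moreover have "(2::int) ^ (2 * j) = 2 ^ i * 2 ^ (2 * j - i)"
          by (simp only: power_add[symmetric] le_add_diff_inverse[OF 3(2)])
        moreover have "\<not> 2 * m + i < m + j" using 3(1) by (simp only: not_less)
        ultimately show ?thesis by (simp only: coeffU 3(2) if_True if_False) (simp only: mult_ac)
      qed
    qed
    have "(\<Prod>i<g + 1. 2 ^ i) * det LR = (\<Prod>j<g + 1. 2 ^ (2 * j)) * det (mat (g + 1) (g + 1) (\<lambda>(i, j). ?B i j))"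
      unfolding LR_def by (rule det_scaling) (rule scale)
    moreover have "mat (g + 1) (g + 1) (\<lambda>(i, j). ?B i j) = binomial_matrix l g"
      by (simp add: binomial_matrix_def m_def cong: if_cong)
    moreover have "(\<Prod>i<g + 1. (2::int) ^ i) = 2 ^ (\<Sum>i<g + 1. i)" by (rule power_sum[symmetric])
    moreover have "(\<Prod>j<g + 1. (2::int) ^ (2 * j)) = 2 ^ (\<Sum>i<g + 1. i) * 2 ^ (\<Sum>i<g + 1. i)"
      by (simp only: mult_2 power_add prod.distrib power_sum)
    ultimately have "2 ^ (\<Sum>i<g + 1. i) * det LR =
        2 ^ (\<Sum>i<g + 1. i) * (2 ^ (\<Sum>i<g + 1. i) * det (binomial_matrix l g))"
      by (simp only: mult.assoc)
    then show ?thesis by (subst (asm) mult_cancel_left) simp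
  qed
  ultimately show ?thesis using detA by simp
qed

definition leads :: "'a::comm_ring_1 fps \<Rightarrow> nat \<Rightarrow> 'a \<Rightarrow> bool" where
  "leads f n c \<longleftrightarrow> (\<exists>h. f = fps_X ^ n * h \<and> h $$$ 0 = c)"

lemma leads_mult: "leads f a c \<Longrightarrow> leads h b d \<Longrightarrow> leads (f * h) (a + b) (c * d)"
proof -
  assume "leads f a c" "leads h b d"
  then obtain u v where uv: "f = fps_X ^ a * u" "u $$$ 0 = c" "h = fps_X ^ b * v" "v $$$ 0 = d"
    unfolding leads_def by blast
  have "f * h = fps_X ^ (a + b) * (u * v)" unfolding uv(1,3) power_add by (simp only: mult_ac)
  moreover have "(u * v) $$$ 0 = c * d" using uv by simp
  ultimately show ?thesis unfolding leads_def by blast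
qed

lemma leads_1: "leads 1 0 1"
  unfolding leads_def by (intro exI[of _ 1]) simp

lemma leads_power: "leads f a c \<Longrightarrow> leads (f ^ n) (n * a) (c ^ n)"
proof (induction n)
  case (Suc n)
  from leads_mult[OF Suc.prems Suc.IH[OF Suc.prems]] show ?case by simp
qed (simp add: leads_1)

lemma leadsD: "leads f n c \<Longrightarrow> k < n \<Longrightarrow> f $$$ k = 0" "leads f n c \<Longrightarrow> f $$$ n = c"
  unfolding leads_def by (auto simp: fps_X_power_mult_nth)

lemma leadsI:
  assumes "\<And>k. k < n \<Longrightarrow> f $$$ k = 0" "f $$$ n = c"
  shows "leads f n c"
  unfolding leads_def
proof (intro exI[of _ "fps_shift n f"] conjI fps_ext)
  show "f $$$ k = (fps_X ^ n * fps_shift n f) $$$ k" for k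
    using assms(1)[of k] by (simp add: fps_X_power_mult_nth)
qed (simp add: assms(2))

lemma leads_lam:
  assumes "leads U 2 u" "leads V 1 v"
  shows "leads (lam m U V j) (lam_order m j) (lam m u v j)"
proof (cases "j < 2 * m")
  case True
  have "(j div 2) * 2 + (j mod 2) * 1 = j" by simp
  with leads_mult[OF leads_power[OF assms(1), of "j div 2"] leads_power[OF assms(2), of "j mod 2"]]
  show ?thesis using True by (simp only: lam_def lam_order_def if_True)
next
  case False
  then show ?thesis using leads_power[OF assms(1), of "j - m"] by (simp add: lam_def lam_order_def mult.commute)
qed

text \<open>The first 2 m orders are 0, 1, ..., 2 m - 1; the order at position 2 m + i is 2 m + 2 i,
  which exceeds the position by i.\<close>

lemma sum_lam_order: "(\<Sum>j<2 * m + k. lam_order m j) = (\<Sum>j<2 * m + k. j) + (\<Sum>i<k. i)"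
proof -
  have split: "(\<Sum>j<a + b. f j) = (\<Sum>j<a. f j) + (\<Sum>j<b. f (a + j))" for f :: "nat \<Rightarrow> nat" and a b
    by (induction b) simp_all
  have "(\<Sum>j<2 * m. lam_order m j) = (\<Sum>j<2 * m. j)"
    by (intro sum.cong) (simp_all add: lam_order_def)
  moreover have "(\<Sum>i<k. lam_order m (2 * m + i)) = (\<Sum>i<k. (2 * m + i) + i)"
    by (intro sum.cong) (simp_all add: lam_order_def)
  ultimately show ?thesis by (simp only: split sum.distrib add.assoc)
qed

lemma linear_power_nth: "((fps_const \<tau> + fps_X) ^ n) $$$ i = of_nat (n choose i) * (\<tau> :: 'a::idom) ^ (n - i)"
proof -
  have "fps_const \<tau> + fps_X = fps_of_poly [:\<tau>, 1:]"
    by (rule fps_ext) (simp add: fps_X_def coeff_pCons split: nat.splits)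
  then have "(fps_const \<tau> + fps_X) ^ n = fps_of_poly ([:\<tau>, 1:] ^ n)" by (simp only: fps_of_poly_power)
  then show ?thesis by (simp only: fps_of_poly_nth coeff_monic_linear_power)
qed

lemma hasse_linear_power:
  "hasse k ((fps_const \<tau> + fps_X) ^ n) = of_nat (n choose k) * (fps_const (\<tau> :: 'a::idom) + fps_X) ^ (n - k)"
proof (rule fps_ext)
  fix i
  have "((i + k) choose k) * (n choose (i + k)) = (n choose k) * ((n - k) choose i)"
  proof (cases "i + k \<le> n")
    case True
    then show ?thesis using choose_mult[of k "i + k" n] by (simp add: mult.commute)
  next
    case False
    then have "n < i + k" "n < k \<or> n - k < i" by linarith+
    then show ?thesis by (auto simp: binomial_eq_0)
  qed
  then have "(of_nat ((i + k) choose k) * of_nat (n choose (i + k)) :: 'a) = of_nat (n choose k) * of_nat ((n - k) choose i)"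
    unfolding of_nat_mult[symmetric] by (rule arg_cong)
  moreover have "n - (i + k) = n - k - i" by simp
  ultimately have "of_nat ((i + k) choose k) * (of_nat (n choose (i + k)) * \<tau> ^ (n - (i + k))) =
      of_nat (n choose k) * (of_nat ((n - k) choose i) * \<tau> ^ (n - k - i))"
    by (simp only: mult.assoc[symmetric])
  then show "hasse k ((fps_const \<tau> + fps_X) ^ n) $$$ i = (of_nat (n choose k) * (fps_const \<tau> + fps_X) ^ (n - k)) $$$ i"
    by (simp only: hasse_nth linear_power_nth fps_of_nat[symmetric] fps_mult_left_const_nth)
qed

lemma hasse_0: "hasse k 0 = 0"
  by (rule fps_ext) simp

lemma hasse_sum: "hasse k (\<Sum>i\<in>A. f i) = (\<Sum>i\<in>A. hasse k (f i))"
  by (induction A rule: infinite_finite_induct) (simp_all add: hasse_0 hasse_add)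

section \<open>Hasse derivatives and the Wronskian in a chart\<close>

context local_chart
begin

lemma \<Theta>_of_nat: "of_nat n \<in> R" "\<Theta> (of_nat n) = of_nat n"
  using R_const[of "of_nat n"] \<Theta>_const[of "of_nat n"]
  by (simp_all add: emb.hom_of_nat hom_of_nat fps_of_nat)

text \<open>\<Theta> is additive and multiplicative only on the subset \<open>R\<close>, so it is
  not a ring homomorphism of the ambient type; the Leibniz formula is transported term by
  term.\<close>

lemma det_in_R:
  assumes "\<And>i j. i < n \<Longrightarrow> j < n \<Longrightarrow> f i j \<in> R"
  shows "det (mat n n (\<lambda>(i, j). f i j)) \<in> R"
    "\<Theta> (det (mat n n (\<lambda>(i, j). f i j))) = det (mat n n (\<lambda>(i, j). \<Theta> (f i j)))"
proof -
  let ?S = "{q. q permutes {0..<n}}"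
  have expand: "det (mat n n (\<lambda>(i, j). h i j)) = (\<Sum>q\<in>?S. signof q * (\<Prod>i=0..<n. h i (q i)))"
    for h :: "nat \<Rightarrow> nat \<Rightarrow> 'z::comm_ring_1"
  proof -
    have "det (mat n n (\<lambda>(i, j). h i j)) = (\<Sum>q\<in>?S. signof q * (\<Prod>i=0..<n. mat n n (\<lambda>(i, j). h i j) $$ (i, q i)))"
      by (rule det_def') simp
    also have "\<dots> = (\<Sum>q\<in>?S. signof q * (\<Prod>i=0..<n. h i (q i)))"
    proof (intro sum.cong refl arg_cong2[where f = "(*)"] prod.cong)
      fix q i assume "q \<in> ?S" "i \<in> {0..<n}"
      then have "i < n" "q i < n" using permutes_in_image[of q "{0..<n}" i] by auto
      then show "mat n n (\<lambda>(i, j). h i j) $$ (i, q i) = h i (q i)" by simp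
    qed
    finally show ?thesis .
  qed
  have f: "f i (q i) \<in> R" if "q \<in> ?S" "i \<in> {0..<n}" for q i
    using that permutes_in_image[of q "{0..<n}" i] by (intro assms) auto
  have sgn: "signof q \<in> R" "\<Theta> (signof q) = signof q" for q :: "nat \<Rightarrow> nat"
    using R_1 R_uminus[OF R_1] \<Theta>_1 \<Theta>_diff[OF R_0 R_1] by (auto simp: sign_def \<Theta>_0)
  show "det (mat n n (\<lambda>(i, j). f i j)) \<in> R"
    unfolding expand using f sgn by (intro R_sum R_mult R_prod) auto
  show "\<Theta> (det (mat n n (\<lambda>(i, j). f i j))) = det (mat n n (\<lambda>(i, j). \<Theta> (f i j)))"
    unfolding expand
  proof (subst \<Theta>_sum)
    show "signof q * (\<Prod>i = 0..<n. f i (q i)) \<in> R" if "q \<in> ?S" for q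
      using f[OF that] sgn by (intro R_mult R_prod) auto
    show "(\<Sum>q\<in>?S. \<Theta> (signof q * (\<Prod>i = 0..<n. f i (q i)))) = (\<Sum>q\<in>?S. signof q * (\<Prod>i = 0..<n. \<Theta> (f i (q i))))"
    proof (rule sum.cong[OF refl])
      fix q assume q: "q \<in> ?S"
      have "\<Theta> (signof q * (\<Prod>i = 0..<n. f i (q i))) = \<Theta> (signof q) * \<Theta> (\<Prod>i = 0..<n. f i (q i))"
        using f[OF q] sgn by (intro \<Theta>_mult R_prod) auto
      also have "\<Theta> (\<Prod>i = 0..<n. f i (q i)) = (\<Prod>i = 0..<n. \<Theta> (f i (q i)))"
        using f[OF q] by (intro \<Theta>_prod) auto
      finally show "\<Theta> (signof q * (\<Prod>i = 0..<n. f i (q i))) = signof q * (\<Prod>i = 0..<n. \<Theta> (f i (q i)))"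
        by (simp only: sgn)
    qed
  qed
qed

lemma hasse_derivativesD:
  assumes "hasse_derivatives \<iota> R t D"
  shows "u \<in> R \<Longrightarrow> D k u \<in> R" "u \<in> R \<Longrightarrow> v \<in> R \<Longrightarrow> D k (u + v) = D k u + D k v"
    "u \<in> R \<Longrightarrow> D k (\<iota> c * u) = \<iota> c * D k u" "u \<in> R \<Longrightarrow> D 0 u = u"
    "u \<in> R \<Longrightarrow> v \<in> R \<Longrightarrow> D k (u * v) = (\<Sum>i\<le>k. D i u * D (k - i) v)"
    "D k (t ^ n) = of_nat (n choose k) * t ^ (n - k)"
  using assms unfolding hasse_derivatives_def by blast+

text \<open>By the Leibniz rule for \<pi> w, each term either keeps the factor \<pi>, which adds one
  to the order, or spends at least one derivative on \<pi> and leaves at most k - 1 for w.\<close>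

lemma hasse_derivative_M:
  assumes D: "hasse_derivatives \<iota> R t D" and u: "u \<in> M n"
  shows "D k u \<in> M (n - k)"
  using u
proof (induction n arbitrary: u k)
  case 0
  then show ?case using hasse_derivativesD(1)[OF D] by (simp add: M_0)
next
  case (Suc n)
  then obtain v where v: "v \<in> R" "u = \<pi> ^ Suc n * v" unfolding M_eq by blast
  define w where "w = \<pi> ^ n * v"
  have w: "w \<in> M n" unfolding M_eq w_def using v(1) by blast
  have "D k u = D k (\<pi> * w)" by (simp add: v(2) w_def mult.assoc)
  also have "\<dots> = (\<Sum>i\<le>k. D i \<pi> * D (k - i) w)"
    by (rule hasse_derivativesD(5)[OF D \<pi>_in_R M_R[OF w]])
  also have "\<dots> \<in> M (Suc n - k)"
  proof (rule M_sum)
    fix i assume i: "i \<in> {..k}"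
    show "D i \<pi> * D (k - i) w \<in> M (Suc n - k)"
    proof (cases "i = 0")
      case True
      have "\<pi> * D k w \<in> M (1 + (n - k))"
        using \<pi>_in_m Suc.IH[OF w] by (intro M_mult) (simp_all add: M_1[unfolded One_nat_def])
      moreover have "M (1 + (n - k)) \<subseteq> M (Suc n - k)" by (rule M_mono) simp
      ultimately show ?thesis using True hasse_derivativesD(4)[OF D \<pi>_in_R] by auto
    next
      case False
      have "D (k - i) w * D i \<pi> \<in> M (n - (k - i))"
        by (rule M_mult_R[OF Suc.IH[OF w] hasse_derivativesD(1)[OF D \<pi>_in_R]])
      moreover have "M (n - (k - i)) \<subseteq> M (Suc n - k)" using False i by (intro M_mono) auto
      ultimately show ?thesis by (auto simp: mult.commute)
    qed
  qed
  finally show ?case .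
qed

text \<open>The axioms prescribe D on powers of t, hence on F[t]. Polynomials in t approximate u to
  any order and D k lowers orders by at most k, so an approximation modulo
  \<open>M (n + 1 + k)\<close> already fixes coefficient n. In particular all admissible D give the
  same expansions.\<close>

lemma \<Theta>_hasse_derivative:
  assumes D: "hasse_derivatives \<iota> R t D" and u: "u \<in> R"
  shows "\<Theta> (D k u) = hasse k (\<Theta> u)"
proof (rule fps_ext)
  note D' = hasse_derivativesD[OF D]
  have sum: "D k (\<Sum>i\<in>A. f i) = (\<Sum>i\<in>A. D k (f i))" if "\<And>i. i \<in> A \<Longrightarrow> f i \<in> R" for f and A :: "nat set"
  proof -
    have "D k 0 = 0" using D'(2)[OF R_0 R_0, of k] by (metis add_0 add_cancel_right_right)
    then show ?thesis
      using that by (induction A rule: infinite_finite_induct) (simp_all add: D'(2) R_sum)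
  qed
  have poly: "\<Theta> (D k (pev \<iota> h t)) = hasse k (taylor h)" for h
  proof -
    have "D k (pev \<iota> h t) = (\<Sum>i\<le>degree h. \<iota> (coeff h i) * (of_nat (i choose k) * t ^ (i - k)))"
      unfolding emb.pev_altdef
      by (simp add: sum R_mult R_const R_power t_in_R D'(3) D'(6))
    then have "\<Theta> (D k (pev \<iota> h t)) = (\<Sum>i\<le>degree h. fps_const (\<kappa> (coeff h i)) *
        (of_nat (i choose k) * (fps_const \<tau> + fps_X) ^ (i - k)))"
      by (simp add: \<Theta>_sum \<Theta>_mult \<Theta>_power \<Theta>_const \<Theta>_of_nat \<Theta>_t R_mult R_const R_power t_in_R)
    also have "\<dots> = hasse k (taylor h)"
      by (simp add: taylor_def const.pev_altdef hasse_sum hasse_scale hasse_linear_power)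
    finally show ?thesis .
  qed
  fix n
  obtain h where h: "u - pev \<iota> h t \<in> M (n + 1 + k)" by (rule R_approx[OF u])
  define v where "v = u - pev \<iota> h t"
  have v: "v \<in> M (n + 1 + k)" "u = pev \<iota> h t + v" using h by (simp_all add: v_def)
  have "D k v \<in> M (n + 1)" using hasse_derivative_M[OF D v(1), of k] by simp
  then have "\<Theta> (D k v) $$$ n = 0" by (simp add: M_def)
  moreover have "\<Theta> v $$$ (n + k) = 0" using v(1) by (simp add: M_def)
  moreover have "D k u = D k (pev \<iota> h t) + D k v"
    unfolding v(2) by (rule D'(2)[OF pev_t_in_R M_R[OF v(1)]])
  ultimately show "\<Theta> (D k u) $$$ n = hasse k (\<Theta> u) $$$ n"
    using M_R[OF v(1)] by (simp add: \<Theta>_add D'(1) pev_t_in_R poly v(2) \<Theta>_pev)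
qed

lemma wronskian_order:
  assumes D: "hasse_derivatives \<iota> R t D" and l: "l > g"
    and ls: "length ls = 2 * (l - g) + (g + 1)" "set ls \<subseteq> R"
      "\<And>j. j < length ls \<Longrightarrow> \<Theta> (ls ! j) = lam (l - g) (fps_const x0 + U) V j"
    and U: "leads U 2 u" "u \<noteq> 0" and V: "leads V 1 v" "v \<noteq> 0"
    and two: "(2::'c) \<noteq> 0" and dM: "of_int (det (binomial_matrix l g)) \<noteq> (0::'c)"
  shows "has_order (wronskian D ls) (\<Sum>i<g + 1. i)
    ((\<Prod>j<length ls. lam (l - g) u v j) * (2 ^ (\<Sum>i<g + 1. i) * of_int (det (binomial_matrix l g))))"
proof -
  define n m where "n = length ls" and "m = l - g"
  define N where "N = (\<Sum>i<g + 1. i)"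
  have lsR: "ls ! j \<in> R" if "j < n" for j using ls(2) that by (auto simp: n_def)
  have R: "wronskian D ls \<in> R"
    unfolding wronskian_def n_def[symmetric] using lsR by (intro det_in_R(1) hasse_derivativesD(1)[OF D])
  have "\<Theta> (wronskian D ls) = det (mat n n (\<lambda>(i, j). \<Theta> (D i (ls ! j))))"
    unfolding wronskian_def n_def[symmetric] using lsR by (intro det_in_R(2) hasse_derivativesD(1)[OF D])
  also have "mat n n (\<lambda>(i, j). \<Theta> (D i (ls ! j))) =
      mat n n (\<lambda>(i, j). hasse i (lam m (fps_const x0 + U) (fps_const 0 + V) j))"
  proof (rule cong_mat[OF refl refl])
    fix i j assume "i < n" "j < n"
    then show "(case (i, j) of (i, j) \<Rightarrow> \<Theta> (D i (ls ! j))) =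
        (case (i, j) of (i, j) \<Rightarrow> hasse i (lam m (fps_const x0 + U) (fps_const 0 + V) j))"
      using \<Theta>_hasse_derivative[OF D lsR] ls(3) by (simp add: n_def m_def)
  qed
  also have "det \<dots> = det (mat n n (\<lambda>(i, j). hasse i (lam m U V j)))"
  proof -
    interpret c: center_change "fps_const :: 'c \<Rightarrow> 'c fps" m U V
      by unfold_locales simp_all
    show ?thesis by (rule c.det_lam_shift[where e' = fps_const]) (simp_all add: hasse_add hasse_scale)
  qed
  finally have W: "\<Theta> (wronskian D ls) = det (mat n n (\<lambda>(i, j). hasse i (lam m U V j)))" .
  note lead = leads_lam[OF U(1) V(1), of m]
  have "(\<Sum>j<n. lam_order m j) = (\<Sum>j<n. j) + N"
    unfolding n_def ls(1) m_def N_def by (rule sum_lam_order)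
  from hasse_determinant_leading[of n "lam_order m" "\<lambda>j. lam m U V j" "\<lambda>j. lam m u v j", OF leadsD(1)[OF lead] leadsD(2)[OF lead] this]
  obtain E where E: "\<Theta> (wronskian D ls) = fps_X ^ N * E"
    "E $$$ 0 = (\<Prod>j<n. lam m u v j) * det (mat n n (\<lambda>(i, j). of_nat (lam_order m j choose i)))"
    unfolding W by blast
  \<comment> \<open>The determinant of binomials is evaluated over the integers, where the power of
    2 could be cancelled, and mapped to k afterwards.\<close>
  have "det (mat n n (\<lambda>(i, j). of_nat (lam_order m j choose i) :: 'c)) =
      of_int (det (mat n n (\<lambda>(i, j). int (lam_order m j choose i))))"
  proof -
    have "map_mat of_int (mat n n (\<lambda>(i, j). int (lam_order m j choose i))) =
        mat n n (\<lambda>(i, j). of_nat (lam_order m j choose i) :: 'c)"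
      by (rule eq_matI) simp_all
    then show ?thesis by (metis of_int_hom.hom_det)
  qed
  also have "det (mat n n (\<lambda>(i, j). int (lam_order m j choose i))) = 2 ^ N * det (binomial_matrix l g)"
    unfolding n_def ls(1) m_def N_def by (rule det_gap_binomials[OF l])
  finally have E0: "E $$$ 0 = (\<Prod>j<n. lam m u v j) * (2 ^ N * of_int (det (binomial_matrix l g)))"
    using E(2) by simp
  have "lam m u v j \<noteq> 0" for j using U(2) V(2) by (simp add: lam_def)
  then have "E $$$ 0 \<noteq> 0" using two dM by (simp add: E0)
  then show ?thesis
    unfolding has_order_def M_def using R E(1) E0
    by (simp add: fps_X_power_mult_nth n_def m_def N_def)
qed

end

lemma (in comm_ring_hom) fps_const_hom: "comm_ring_hom (\<lambda>c. fps_const (hom c))"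
  by unfold_locales (simp_all add: hom_add hom_mult)

lemma pev_shift_eq_compose:
  fixes x0 :: "'d::field"
  assumes "comm_ring_hom \<phi>" and U: "U $$$ 0 = 0"
  shows "pev (\<lambda>c. fps_const (\<phi> c)) f (fps_const x0 + U) = fps_of_poly (map_poly \<phi> f \<circ>\<^sub>p [:x0, 1:]) oo U"
proof -
  interpret comm_ring_hom \<phi> by (rule assms)
  interpret C: comm_ring_hom "\<lambda>c. fps_const (\<phi> c)" by (rule fps_const_hom)
  show ?thesis
  proof (induction f)
    case 0
    then show ?case by simp
  next
    case (pCons a f)
    have "fps_of_poly [:x0, 1:] oo U = fps_const x0 + U"
      using U by (simp add: fps_of_poly_pCons fps_compose_add_distrib fps_compose_mult_distrib)
    moreover have "map_poly \<phi> (pCons a f) \<circ>\<^sub>p [:x0, 1:] = [:\<phi> a:] + [:x0, 1:] * (map_poly \<phi> f \<circ>\<^sub>p [:x0, 1:])"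
      by (simp add: map_poly_pCons_hom pcompose_pCons)
    ultimately show ?case
      using U pCons.IH
      by (simp add: fps_of_poly_add fps_of_poly_mult fps_compose_add_distrib fps_compose_mult_distrib
          fps_of_poly_const del: mult_pCons_left)
  qed
qed


section \<open>Expansions on the curve\<close>

text \<open>The curve \<open>y\<^sup>2 = f(x)\<close> can be parametrised near \<open>(x0, y0)\<close> by the linear coordinate
  \<open>a (x - x0) + b (y - y0)\<close>: solve for \<open>x\<close> in terms of \<open>y\<close> first.\<close>

lemma branch_exists:
  fixes x0 y0 :: "'d::field"
  assumes "comm_ring_hom \<phi>" and y0: "y0\<^sup>2 = pev \<phi> f x0" and f': "pev \<phi> (pderiv f) x0 \<noteq> 0"
    and nz: "b * pev \<phi> (pderiv f) x0 + 2 * y0 * a \<noteq> 0"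
  shows "\<exists>U V. U $$$ 0 = 0 \<and> V $$$ 0 = 0 \<and>
    (fps_const y0 + V)\<^sup>2 = pev (\<lambda>c. fps_const (\<phi> c)) f (fps_const x0 + U) \<and>
    fps_const a * U + fps_const b * V = fps_X"
proof -
  interpret comm_ring_hom \<phi> by (rule assms)
  define F where "F = fps_of_poly (map_poly \<phi> f \<circ>\<^sub>p [:x0, 1:])"
  define d where "d = pev \<phi> (pderiv f) x0"
  have F0: "F $$$ 0 = y0\<^sup>2" by (simp add: F_def y0 pev_def flip: poly_0_coeff_0) (simp add: poly_pcompose)
  have F1: "F $$$ 1 = d"
  proof -
    have "F $$$ 1 = coeff (pderiv (map_poly \<phi> f \<circ>\<^sub>p [:x0, 1:])) 0" by (simp add: F_def coeff_pderiv)
    also have "\<dots> = poly (pderiv (map_poly \<phi> f)) x0"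
      by (simp add: pderiv_pcompose pderiv_pCons poly_pcompose flip: poly_0_coeff_0)
    also have "pderiv (map_poly \<phi> f) = map_poly \<phi> (pderiv f)"
      by (rule poly_eqI) (simp add: coeff_pderiv hom_mult hom_of_nat hom_add)
    finally show ?thesis by (simp add: d_def pev_def)
  qed
  \<comment> \<open>G(s) = f(x0 + s) - y0^2 has no constant term and slope f'(x0), hence a
    compositional inverse H.\<close>
  define G where "G = F - fps_const (y0\<^sup>2)"
  have G0: "G $$$ 0 = 0" and G1: "G $$$ 1 = d" by (simp_all add: G_def F0 F1[unfolded One_nat_def])
  define H where "H = fps_inv G"
  have H0: "H $$$ 0 = 0" by (simp add: H_def fps_inv_def)
  have GH: "G oo H = fps_X" unfolding H_def by (rule fps_inv_right[OF G0]) (use G1 f' d_def in simp)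
  have H1: "H $$$ 1 = 1 / d"
  proof -
    have "(G oo H) $$$ 1 = G $$$ 1 * H $$$ 1" by (simp add: fps_compose_nth fps_power_first_eq)
    then show ?thesis using GH G1 f' by (simp add: d_def field_simps)
  qed
  \<comment> \<open>Q(s) = (y0 + s)^2 - y0^2, so the curve reads G(x - x0) = Q(y - y0), and U0 =
    H(Q) is x - x0 as a series in y - y0.\<close>
  define Q where "Q = fps_const y0 * fps_X + fps_const y0 * fps_X + fps_X\<^sup>2"
  have Q0: "Q $$$ 0 = 0" and Q1: "Q $$$ 1 = 2 * y0" by (simp_all add: Q_def power2_eq_square)
  define U0 where "U0 = H oo Q"
  have U00: "U0 $$$ 0 = 0" by (simp add: U0_def H0)
  have U01: "U0 $$$ 1 = 2 * y0 / d"
    using H1 Q0 Q1 by (simp add: U0_def fps_compose_nth)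
  \<comment> \<open>The linear coordinate as a series in y - y0. Its slope is (b f'(x0) + 2 y0
    a)/f'(x0), nonzero by hypothesis, so y - y0 can be written as a series W in the
    coordinate.\<close>
  define S where "S = fps_const a * U0 + fps_const b * fps_X"
  have S0: "S $$$ 0 = 0" by (simp add: S_def U00)
  have S1: "S $$$ 1 \<noteq> 0"
  proof -
    have "S $$$ 1 = (b * d + 2 * y0 * a) / d"
      using f' U01[unfolded One_nat_def] by (simp add: S_def d_def[symmetric] field_simps)
    then show ?thesis using nz f' by (simp add: d_def[symmetric])
  qed
  define W where "W = fps_inv S"
  have W0: "W $$$ 0 = 0" by (simp add: W_def fps_inv_def)
  have SW: "S oo W = fps_X" unfolding W_def by (rule fps_inv_right[OF S0 S1])
  define U where "U = U0 oo W"
  have U0': "U $$$ 0 = 0" by (simp add: U_def U00)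
  have "G oo U = fps_const y0 * W + fps_const y0 * W + W\<^sup>2"
  proof -
    have "G oo U = (G oo H) oo (Q oo W)"
      unfolding U_def U0_def by (simp add: fps_compose_assoc[symmetric] H0 Q0 W0)
    also have "\<dots> = Q oo W" using GH W0 Q0 by simp
    also have "\<dots> = fps_const y0 * W + fps_const y0 * W + W\<^sup>2"
      using W0 by (simp add: Q_def fps_compose_add_distrib fps_compose_mult_distrib power2_eq_square)
    finally show ?thesis .
  qed
  moreover have "G oo U = (F oo U) - fps_const (y0\<^sup>2)"
    by (simp add: G_def fps_compose_sub_distrib)
  ultimately have "F oo U = (fps_const y0 + W)\<^sup>2"
    by (simp add: power2_eq_square algebra_simps flip: fps_const_mult)
  then have "(fps_const y0 + W)\<^sup>2 = pev (\<lambda>c. fps_const (\<phi> c)) f (fps_const x0 + U)"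
    using pev_shift_eq_compose[OF assms(1) U0', of f x0] by (simp add: F_def)
  moreover have "fps_const a * U + fps_const b * W = fps_X"
    using SW W0 by (simp add: S_def U_def fps_compose_add_distrib fps_compose_mult_distrib)
  ultimately show ?thesis using U0' W0 by blast
qed

text \<open>First-order Taylor approximation: if U starts at order n, then f(x0 + U) agrees with
  f(x0) + f'(x0) U through order n. Applied with n = 1 and then n = 2, it reads off the order of x -
  \<gamma> from y^2 = f(x).\<close>

lemma branch_first_order:
  fixes x0 :: "'d::field"
  assumes "comm_ring_hom \<phi>" and U: "\<And>i. i < n \<Longrightarrow> U $$$ i = 0" and n: "n > 0"
  shows "(\<forall>i. 0 < i \<and> i < n \<longrightarrow> pev (\<lambda>c. fps_const (\<phi> c)) f (fps_const x0 + U) $$$ i = 0) \<and>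
    pev (\<lambda>c. fps_const (\<phi> c)) f (fps_const x0 + U) $$$ 0 = pev \<phi> f x0 \<and>
    pev (\<lambda>c. fps_const (\<phi> c)) f (fps_const x0 + U) $$$ n = pev \<phi> (pderiv f) x0 * U $$$ n"
proof -
  interpret comm_ring_hom \<phi> by (rule assms)
  interpret C: comm_ring_hom "\<lambda>c. fps_const (\<phi> c)" by (rule fps_const_hom)
  show ?thesis
  proof (induction f)
    case 0
    then show ?case by simp
  next
    case (pCons a f)
    define T where "T = pev (\<lambda>c. fps_const (\<phi> c)) f (fps_const x0 + U)"
    have IH: "T $$$ i = 0" if "0 < i" "i < n" for i using pCons.IH that by (simp add: T_def)
    have T0: "T $$$ 0 = pev \<phi> f x0" and Tn: "T $$$ n = pev \<phi> (pderiv f) x0 * U $$$ n"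
      using pCons.IH by (simp_all add: T_def)
    have UT: "(U * T) $$$ i = 0" if "i < n" for i
      unfolding fps_mult_nth using U that by (intro sum.neutral) auto
    have UTn: "(U * T) $$$ n = U $$$ n * T $$$ 0"
    proof -
      have "(U * T) $$$ n = (\<Sum>i=0..n. U $$$ i * T $$$ (n - i))" by (rule fps_mult_nth)
      also have "\<dots> = (\<Sum>i\<in>{n}. U $$$ i * T $$$ (n - i))"
        using U by (intro sum.mono_neutral_right) auto
      finally show ?thesis by simp
    qed
    define Z where "Z = U * T"
    have e: "pev (\<lambda>c. fps_const (\<phi> c)) (pCons a f) (fps_const x0 + U) = fps_const (\<phi> a) + (fps_const x0 * T + Z)"
      by (simp add: T_def Z_def distrib_right)
    have "Z $$$ i = 0" if "i < n" for i using UT[OF that] by (simp only: Z_def)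
    moreover have "Z $$$ n = U $$$ n * T $$$ 0" using UTn by (simp only: Z_def)
    ultimately show ?case
      unfolding e using n IH
      by (simp add: T0 Tn pderiv_pCons pev_add algebra_simps)
  qed
qed

lemma eval2_pev: "eval2 \<phi> h x y = pev (\<lambda>c. pev \<phi> c x) h y"
  by (simp add: eval2_def pev_def)

lemma bivariate_division:
  fixes h :: "'a::comm_ring_1 poly poly"
  shows "\<exists>q A B. h = q * [:- f, 0, 1:] + [:A, B:]"
proof (induction h)
  case 0
  show ?case by (intro exI[of _ 0]) simp
next
  case (pCons c h)
  then obtain q A B where h: "h = q * [:- f, 0, 1:] + [:A, B:]" by blast
  have "pCons c h = (pCons 0 q + [:B:]) * [:- f, 0, 1:] + [:c + B * f, A:]"
    by (simp add: h algebra_simps)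
  then show ?case by blast
qed

lemma (in field_hom) minimal_polynomial:
  assumes "f \<noteq> 0" "pev hom f c = 0"
  shows "\<exists>p. lead_coeff p = 1 \<and> pev hom p c = 0 \<and> (\<forall>h. pev hom h c = 0 \<longrightarrow> p dvd h)"
proof -
  define d where "d = (LEAST d. \<exists>h. h \<noteq> 0 \<and> pev hom h c = 0 \<and> degree h = d)"
  have "\<exists>d h. h \<noteq> 0 \<and> pev hom h c = 0 \<and> degree h = d" using assms by blast
  then have "\<exists>h. h \<noteq> 0 \<and> pev hom h c = 0 \<and> degree h = d" unfolding d_def by (rule LeastI_ex)
  then obtain h0 where h0: "h0 \<noteq> 0" "pev hom h0 c = 0" "degree h0 = d" by blast
  have lc: "coeff h0 d \<noteq> 0" using h0(1) unfolding h0(3)[symmetric] by simp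
  define p where "p = smult (inverse (lead_coeff h0)) h0"
  have p: "lead_coeff p = 1" "pev hom p c = 0" "degree p = d" "p \<noteq> 0"
    using h0 lc by (simp_all add: p_def pev_smult)
  have "p dvd h" if h: "pev hom h c = 0" for h
  proof (rule ccontr)
    assume "\<not> p dvd h"
    then have nz: "h mod p \<noteq> 0" by (simp add: dvd_eq_mod_eq_0)
    have "pev hom h c = pev hom (h div p * p + h mod p) c" by simp
    then have "pev hom (h mod p) c = 0" using h p(2) by (simp only: pev_add pev_mult) simp
    moreover have "degree (h mod p) < d"
      using degree_mod_less[OF p(4), of h] nz p(3) by simp
    ultimately show False using nz unfolding d_def using not_less_Least by blast
  qed
  with p show ?thesis by blast
qed

locale plane_curve = emb: field_hom \<iota> for \<iota> :: "'a::field \<Rightarrow> 'b::field" +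
  fixes f :: "'a poly" and x y :: 'b
  assumes transcendental: "pev \<iota> h x = 0 \<Longrightarrow> h = 0"
    and curve: "y\<^sup>2 = pev \<iota> f x" and odd_degree: "odd (degree f)"
begin

text \<open>Relations between x and y are multiples of y^2 - f. Modulo this, h is A + B y; a
  relation gives A^2 = B^2 f, which for nonzero B contradicts the odd degree of f. Hence relations
  persist at every point of the curve in every commutative ring, which makes evaluation of fractions
  well defined.\<close>

lemma eval_zero_transfer:
  assumes "eval2 \<iota> h x y = 0" and "comm_ring_hom \<phi>" and "Y\<^sup>2 = pev \<phi> f X"
  shows "pev (\<lambda>c. pev \<phi> c X) h Y = 0"
proof -
  obtain q A B where h: "h = q * [:- f, 0, 1:] + [:A, B:]" using bivariate_division by blast
  have red: "pev (\<lambda>c. pev \<psi> c X) h Y = pev \<psi> A X + Y * pev \<psi> B X"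
    if "comm_ring_hom \<psi>" "Y\<^sup>2 = pev \<psi> f X" for \<psi> :: "'a \<Rightarrow> 'z::comm_ring_1" and X Y
  proof -
    interpret comm_ring_hom \<psi> by (rule that)
    interpret E: comm_ring_hom "\<lambda>c. pev \<psi> c X" by (rule pev_comm_ring_hom)
    have "pev (\<lambda>c. pev \<psi> c X) [:- f, 0, 1:] Y = 0"
      using that(2) by (simp add: pev_uminus power2_eq_square)
    then show ?thesis by (simp only: h E.pev_add E.pev_mult mult_zero_right) simp
  qed
  have hom: "comm_ring_hom \<iota>" by unfold_locales
  have "pev \<iota> A x + y * pev \<iota> B x = 0"
    using assms(1) red[OF hom curve] by (simp add: eval2_pev)
  then have "pev \<iota> A x = - (y * pev \<iota> B x)" by (simp add: eq_neg_iff_add_eq_0)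
  then have "(pev \<iota> A x)\<^sup>2 = (y * pev \<iota> B x)\<^sup>2" by simp
  then have "pev \<iota> (A\<^sup>2 - B\<^sup>2 * f) x = 0"
    by (simp add: emb.pev_diff emb.pev_mult emb.pev_power power_mult_distrib curve mult.commute)
  then have AB: "A\<^sup>2 = B\<^sup>2 * f" using transcendental by fastforce
  have "B = 0"
  proof (rule ccontr)
    assume "B \<noteq> 0"
    have "f \<noteq> 0" using odd_degree by auto
    then have "degree (B\<^sup>2 * f) = 2 * degree B + degree f"
      using \<open>B \<noteq> 0\<close> by (simp add: degree_mult_eq degree_power_eq)
    moreover have "A \<noteq> 0" using AB \<open>B \<noteq> 0\<close> \<open>f \<noteq> 0\<close> by auto
    then have "degree (A\<^sup>2) = 2 * degree A" by (simp add: degree_power_eq)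
    ultimately show False using AB odd_degree by (metis even_add even_mult_iff dvd_refl)
  qed
  then have "A = 0" using AB by simp
  interpret P: comm_ring_hom \<phi> by (rule assms(2))
  show ?thesis using red[OF assms(2,3)] by (simp add: \<open>A = 0\<close> \<open>B = 0\<close>)
qed

lemma eval2_hom: "comm_ring_hom (\<lambda>h. eval2 \<iota> h x y)"
proof -
  interpret E: comm_ring_hom "\<lambda>c. pev \<iota> c x" by (rule emb.pev_comm_ring_hom)
  show ?thesis unfolding eval2_pev by (rule E.pev_comm_ring_hom)
qed

end

locale ramification_point = plane_curve \<iota> f x y + res: field_hom \<kappa>
  for \<iota> :: "'a::field \<Rightarrow> 'b::field" and f x y and \<kappa> :: "'a \<Rightarrow> 'c::field" +
  fixes \<gamma> :: 'c
  assumes root_\<gamma>: "pev \<kappa> f \<gamma> = 0" and simple_root: "pev \<kappa> (pderiv f) \<gamma> \<noteq> 0"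
    and generated_\<gamma>: "\<exists>h. c = pev \<kappa> h \<gamma>"
begin

definition P where "P = point_ideal \<kappa> \<gamma> 0"
definition R where "R = local_ring \<iota> x y P"
definition m where "m = local_ideal \<iota> x y P"

sublocale ev: comm_ring_hom "\<lambda>h. eval2 \<iota> h x y" by (rule eval2_hom)

lemma eval2_residue: "eval2 \<kappa> h \<gamma> 0 = pev \<kappa> (coeff h 0) \<gamma>"
proof -
  interpret E: comm_ring_hom "\<lambda>c. pev \<kappa> c \<gamma>" by (rule res.pev_comm_ring_hom)
  show ?thesis unfolding eval2_pev by (cases h) simp
qed

lemma P_iff: "h \<in> P \<longleftrightarrow> pev \<kappa> (coeff h 0) \<gamma> = 0"
  by (simp add: P_def point_ideal_def eval2_residue)

lemma not_P_mult: "u \<notin> P \<Longrightarrow> v \<notin> P \<Longrightarrow> u * v \<notin> P"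
  by (simp add: P_iff coeff_mult_0 res.pev_mult)

lemma one_not_P: "1 \<notin> P"
  by (simp add: P_iff)

lemma eval2_nonzero: "v \<notin> P \<Longrightarrow> eval2 \<iota> v x y \<noteq> 0"
proof
  assume v: "v \<notin> P" and z: "eval2 \<iota> v x y = 0"
  from z have "pev (\<lambda>c. pev \<kappa> c \<gamma>) v 0 = 0"
    by (rule eval_zero_transfer) (use root_\<gamma> in \<open>simp_all add: res.comm_ring_hom_axioms\<close>)
  with v show False by (simp add: P_def point_ideal_def eval2_pev)
qed

lemma R_cases:
  assumes "r \<in> R"
  obtains u v where "v \<notin> P" "r = eval2 \<iota> u x y / eval2 \<iota> v x y"
  using assms unfolding R_def local_ring_def by blast

lemma R_intro: "v \<notin> P \<Longrightarrow> eval2 \<iota> u x y / eval2 \<iota> v x y \<in> R"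
  unfolding R_def local_ring_def by blast

lemma eval2_in_R: "eval2 \<iota> u x y \<in> R"
  using R_intro[OF one_not_P, of u] by simp

lemma eval2_const: "eval2 \<iota> [:[:c:]:] x y = \<iota> c"
  and eval2_x: "eval2 \<iota> [:h:] x y = pev \<iota> h x"
  and eval2_y: "eval2 \<iota> [:0, 1:] x y = y"
proof -
  interpret E: comm_ring_hom "\<lambda>c. pev \<iota> c x" by (rule emb.pev_comm_ring_hom)
  show "eval2 \<iota> [:[:c:]:] x y = \<iota> c" "eval2 \<iota> [:h:] x y = pev \<iota> h x" "eval2 \<iota> [:0, 1:] x y = y"
    unfolding eval2_pev by simp_all
qed

lemma R_const: "\<iota> c \<in> R" and R_poly_x: "pev \<iota> h x \<in> R" and y_in_R: "y \<in> R"
  using eval2_in_R eval2_const eval2_x eval2_y by metis+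

lemma R_add: "r \<in> R \<Longrightarrow> s \<in> R \<Longrightarrow> r + s \<in> R"
proof -
  assume "r \<in> R" "s \<in> R"
  then obtain u v u' v' where *: "v \<notin> P" "r = eval2 \<iota> u x y / eval2 \<iota> v x y"
    "v' \<notin> P" "s = eval2 \<iota> u' x y / eval2 \<iota> v' x y" by (metis R_cases)
  have "r + s = eval2 \<iota> (u * v' + u' * v) x y / eval2 \<iota> (v * v') x y"
    using eval2_nonzero[OF *(1)] eval2_nonzero[OF *(3)] unfolding *(2,4) ev.hom_add ev.hom_mult
    by (simp add: field_simps)
  then show ?thesis using R_intro[OF not_P_mult[OF *(1,3)]] by simp
qed

lemma R_mult: "r \<in> R \<Longrightarrow> s \<in> R \<Longrightarrow> r * s \<in> R"
proof -
  assume "r \<in> R" "s \<in> R"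
  then obtain u v u' v' where *: "v \<notin> P" "r = eval2 \<iota> u x y / eval2 \<iota> v x y"
    "v' \<notin> P" "s = eval2 \<iota> u' x y / eval2 \<iota> v' x y" by (metis R_cases)
  have "r * s = eval2 \<iota> (u * u') x y / eval2 \<iota> (v * v') x y"
    unfolding *(2,4) ev.hom_mult by simp
  then show ?thesis using R_intro[OF not_P_mult[OF *(1,3)]] by simp
qed

lemma inverse_in_R: "v \<notin> P \<Longrightarrow> inverse (eval2 \<iota> v x y) \<in> R"
  using R_intro[of v 1] by (simp add: inverse_eq_divide)

text \<open>Let p be the minimal polynomial of \<gamma> and f = p q. Since \<gamma> is a simple
  root, q(\<gamma>) is nonzero and q(x) is a unit, so p(x) = y^2/q(x). A polynomial in x vanishing
  at \<gamma> is a multiple of p(x), hence in y^2 R; in general the y-free part is of this kind and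
  the rest is divisible by y.\<close>

lemma vanishing_numerator:
  assumes "u \<in> P"
  shows "\<exists>r\<in>R. eval2 \<iota> u x y = y * r"
    and "u = [:h:] \<Longrightarrow> \<exists>r\<in>R. eval2 \<iota> u x y = y\<^sup>2 * r"
proof -
  have "f \<noteq> 0" using odd_degree by auto
  then obtain p where "pev \<kappa> p \<gamma> = 0" and min: "\<forall>h. pev \<kappa> h \<gamma> = 0 \<longrightarrow> p dvd h"
    using res.minimal_polynomial[OF _ root_\<gamma>] by blast
  with root_\<gamma> have p: "p dvd f" "pev \<kappa> p \<gamma> = 0" by blast+
  obtain q where q: "f = p * q" using p(1) by (rule dvdE)
  have "pev \<kappa> (pderiv f) \<gamma> = pev \<kappa> (pderiv p) \<gamma> * pev \<kappa> q \<gamma>"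
    by (simp add: q pderiv_mult res.pev_add res.pev_mult p(2) mult.commute)
  then have "pev \<kappa> q \<gamma> \<noteq> 0" using simple_root by auto
  then have q': "[:q:] \<notin> P" by (simp add: P_iff)
  have key: "\<exists>r\<in>R. pev \<iota> A x = y\<^sup>2 * r" if A: "pev \<kappa> A \<gamma> = 0" for A
  proof -
    have "p dvd A" using min A by blast
    then obtain A' where A': "A = p * A'" by (rule dvdE)
    have nz: "pev \<iota> q x \<noteq> 0" using eval2_nonzero[OF q'] by (simp add: eval2_x)
    have "pev \<iota> A x = y\<^sup>2 * (pev \<iota> A' x / pev \<iota> q x)"
      using nz by (simp add: A' curve q emb.pev_mult)
    moreover have "pev \<iota> A' x / pev \<iota> q x \<in> R" using R_intro[OF q', of "[:A':]"] by (simp add: eval2_x)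
    ultimately show ?thesis by blast
  qed
  show "\<exists>r\<in>R. eval2 \<iota> u x y = y\<^sup>2 * r" if "u = [:h:]"
    using key[of h] assms that by (simp add: P_iff eval2_x)
  show "\<exists>r\<in>R. eval2 \<iota> u x y = y * r"
  proof -
    obtain A u' where u: "u = pCons A u'" by (cases u)
    then obtain r where r: "r \<in> R" "pev \<iota> A x = y\<^sup>2 * r" using key[of A] assms by (auto simp: P_iff)
    interpret E: comm_ring_hom "\<lambda>c. pev \<iota> c x" by (rule emb.pev_comm_ring_hom)
    have "eval2 \<iota> u x y = y * (y * r + eval2 \<iota> u' x y)"
      using r(2) by (simp add: u eval2_pev power2_eq_square algebra_simps)
    moreover have "y * r + eval2 \<iota> u' x y \<in> R" by (intro R_add R_mult y_in_R r eval2_in_R)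
    ultimately show ?thesis by blast
  qed
qed

end

text \<open>A point (X, Y) of the curve with power series coordinates, at whose constant term no
  admissible denominator vanishes. It is used for the branch through (\<gamma>, 0) over the residue
  field and for the branch through the generic point (x, y).\<close>

locale expansion = ramification_point \<iota> f x y \<kappa> \<gamma> + K: field_hom \<phi>
  for \<iota> :: "'a::field \<Rightarrow> 'b::field" and f x y and \<kappa> :: "'a \<Rightarrow> 'c::field" and \<gamma>
    and \<phi> :: "'a \<Rightarrow> 'd::field" +
  fixes X Y :: "'d fps"
  assumes curve_XY: "Y\<^sup>2 = pev (\<lambda>c. fps_const (\<phi> c)) f X"
    and unit: "v \<notin> P \<Longrightarrow> pev (\<lambda>c. pev \<phi> c (X $$$ 0)) v (Y $$$ 0) \<noteq> 0"
begin

sublocale kc: comm_ring_hom "\<lambda>c. fps_const (\<phi> c)" by (rule K.fps_const_hom)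
sublocale kx: comm_ring_hom "\<lambda>c. pev (\<lambda>c. fps_const (\<phi> c)) c X" by (rule kc.pev_comm_ring_hom)

definition subst :: "'a poly poly \<Rightarrow> 'd fps" where
  "subst h = pev (\<lambda>c. pev (\<lambda>c. fps_const (\<phi> c)) c X) h Y"

lemma subst_hom: "subst (u + v) = subst u + subst v" "subst (u * v) = subst u * subst v"
    "subst 1 = 1" "subst (u - v) = subst u - subst v"
  by (simp_all add: subst_def kx.pev_add kx.pev_mult kx.pev_diff)

lemma subst_nth_0: "subst v $$$ 0 = pev (\<lambda>c. pev \<phi> c (X $$$ 0)) v (Y $$$ 0)"
proof -
  have *: "pev (\<lambda>c. fps_const (\<phi> c)) h X $$$ 0 = pev \<phi> h (X $$$ 0)" for h
    by (induction h) simp_all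
  interpret E: comm_ring_hom "\<lambda>c. pev \<phi> c (X $$$ 0)" by (rule K.pev_comm_ring_hom)
  show ?thesis unfolding subst_def by (induction v) (simp_all add: *)
qed

lemma subst_unit: "v \<notin> P \<Longrightarrow> subst v $$$ 0 \<noteq> 0"
  using unit by (simp add: subst_nth_0)

definition expand :: "'b \<Rightarrow> 'd fps" where
  "expand r = (SOME s. \<exists>u v. v \<notin> P \<and> r = eval2 \<iota> u x y / eval2 \<iota> v x y \<and> s = subst u * inverse (subst v))"

text \<open>Equality of two fractions is a polynomial relation between x and y, so it transfers to
  the power series point; the value chosen in \<open>expand\<close> is therefore the same for every
  representation.\<close>

lemma expand_fraction:
  assumes v: "v \<notin> P"
  shows "expand (eval2 \<iota> u x y / eval2 \<iota> v x y) = subst u * inverse (subst v)"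
  unfolding expand_def
proof (rule some_equality)
  show "\<exists>u' v'. v' \<notin> P \<and> eval2 \<iota> u x y / eval2 \<iota> v x y = eval2 \<iota> u' x y / eval2 \<iota> v' x y \<and>
      subst u * inverse (subst v) = subst u' * inverse (subst v')"
    using v by blast
next
  fix s assume "\<exists>u' v'. v' \<notin> P \<and> eval2 \<iota> u x y / eval2 \<iota> v x y = eval2 \<iota> u' x y / eval2 \<iota> v' x y \<and>
      s = subst u' * inverse (subst v')"
  then obtain u' v' where v': "v' \<notin> P" "eval2 \<iota> u x y / eval2 \<iota> v x y = eval2 \<iota> u' x y / eval2 \<iota> v' x y"
    and s: "s = subst u' * inverse (subst v')" by blast
  have "eval2 \<iota> u x y * eval2 \<iota> v' x y = eval2 \<iota> u' x y * eval2 \<iota> v x y"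
    using v'(2) eval2_nonzero[OF v] eval2_nonzero[OF v'(1)] by (simp add: field_simps)
  then have "eval2 \<iota> (u * v' - u' * v) x y = 0" by (simp add: ev.hom_minus ev.hom_mult)
  then have "subst (u * v' - u' * v) = 0"
    unfolding subst_def using kc.comm_ring_hom_axioms curve_XY by (rule eval_zero_transfer)
  then have eq: "subst u * subst v' = subst u' * subst v" by (simp add: subst_hom)
  have inv: "subst w * inverse (subst w) = 1" if "w \<notin> P" for w
    using subst_unit[OF that] by (simp add: inverse_mult_eq_1')
  have "s = subst u' * inverse (subst v') * (subst v * inverse (subst v))" by (simp add: s inv[OF v])
  also have "\<dots> = (subst u' * subst v) * (inverse (subst v') * inverse (subst v))" by (simp only: mult_ac)
  also have "\<dots> = (subst u * subst v') * (inverse (subst v') * inverse (subst v))" by (simp only: eq)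
  also have "\<dots> = subst u * inverse (subst v) * (subst v' * inverse (subst v'))" by (simp only: mult_ac)
  also have "\<dots> = subst u * inverse (subst v)" by (simp add: inv[OF v'(1)])
  finally show "s = subst u * inverse (subst v)" .
qed

lemma subst_inverse: "v \<notin> P \<Longrightarrow> subst v * inverse (subst v) = 1"
  using subst_unit by (simp add: inverse_mult_eq_1')

lemma expand_add:
  assumes "r \<in> R" "s \<in> R"
  shows "expand (r + s) = expand r + expand s"
proof -
  from assms obtain u v u' v' where *: "v \<notin> P" "r = eval2 \<iota> u x y / eval2 \<iota> v x y"
    "v' \<notin> P" "s = eval2 \<iota> u' x y / eval2 \<iota> v' x y" by (metis R_cases)
  have "r + s = eval2 \<iota> (u * v' + u' * v) x y / eval2 \<iota> (v * v') x y"
    using eval2_nonzero[OF *(1)] eval2_nonzero[OF *(3)] unfolding *(2,4) ev.hom_add ev.hom_mult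
    by (simp add: field_simps)
  then have "expand (r + s) = subst (u * v' + u' * v) * inverse (subst (v * v'))"
    using expand_fraction[OF not_P_mult[OF *(1,3)]] by simp
  also have "\<dots> = subst u * inverse (subst v) * (subst v' * inverse (subst v')) +
      subst u' * inverse (subst v') * (subst v * inverse (subst v))"
    unfolding subst_hom fps_inverse_mult by (simp only: ring_distribs mult_ac)
  also have "\<dots> = expand r + expand s"
    by (simp only: subst_inverse[OF *(1)] subst_inverse[OF *(3)] *(2,4)
        expand_fraction[OF *(1)] expand_fraction[OF *(3)] mult_1_right)
  finally show ?thesis .
qed

lemma expand_mult:
  assumes "r \<in> R" "s \<in> R"
  shows "expand (r * s) = expand r * expand s"
proof -
  from assms obtain u v u' v' where *: "v \<notin> P" "r = eval2 \<iota> u x y / eval2 \<iota> v x y"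
    "v' \<notin> P" "s = eval2 \<iota> u' x y / eval2 \<iota> v' x y" by (metis R_cases)
  have "r * s = eval2 \<iota> (u * u') x y / eval2 \<iota> (v * v') x y"
    unfolding *(2,4) ev.hom_mult by simp
  then have "expand (r * s) = subst (u * u') * inverse (subst (v * v'))"
    using expand_fraction[OF not_P_mult[OF *(1,3)]] by simp
  then show ?thesis
    unfolding *(2,4) expand_fraction[OF *(1)] expand_fraction[OF *(3)] subst_hom fps_inverse_mult
    by (simp only: mult_ac)
qed

lemma expand_eval2: "expand (eval2 \<iota> u x y) = subst u"
  using expand_fraction[OF one_not_P, of u] by (simp add: subst_hom)

lemma expand_const: "expand (\<iota> c) = fps_const (\<phi> c)"
  and expand_x: "expand (pev \<iota> h x) = pev (\<lambda>c. fps_const (\<phi> c)) h X"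
  and expand_y: "expand y = Y"
  using expand_eval2[of "[:[:c:]:]"] expand_eval2[of "[:h:]"] expand_eval2[of "[:0, 1:]"]
  by (simp_all add: eval2_const eval2_x eval2_y subst_def)

lemma expand_nth_0:
  assumes "v \<notin> P"
  shows "expand (eval2 \<iota> u x y / eval2 \<iota> v x y) $$$ 0 = subst u $$$ 0 / subst v $$$ 0"
  unfolding expand_fraction[OF assms] by (simp add: divide_inverse)

end

section \<open>Expansions at the ramification point and at the generic point\<close>

context ramification_point
begin

text \<open>At y0 = 0 the curve reads V^2 = f(\<gamma> + U) with f(\<gamma>) = 0. The square V^2 has
  no linear term, which forces U_1 = 0; then a U + b V = s gives V_1 = 1/b, and order 2 gives
  f'(\<gamma>) U_2 = V_1^2.\<close>

lemma residue_expansion_exists: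
  assumes b: "b \<noteq> 0"
  shows "\<exists>U V. expansion \<iota> f x y \<kappa> \<gamma> \<kappa> (fps_const \<gamma> + U) V \<and>
    fps_const (\<kappa> a) * (fps_const \<gamma> + U) + fps_const (\<kappa> b) * V = fps_const (\<kappa> a * \<gamma>) + fps_X \<and>
    leads V 1 (1 / \<kappa> b) \<and> leads U 2 ((1 / \<kappa> b)\<^sup>2 / pev \<kappa> (pderiv f) \<gamma>)"
proof -
  define d where "d = pev \<kappa> (pderiv f) \<gamma>"
  have \<kappa>b: "\<kappa> b \<noteq> 0" using b by simp
  have hom: "comm_ring_hom \<kappa>" by (rule res.comm_ring_hom_axioms)
  have "0\<^sup>2 = pev \<kappa> f \<gamma>" "\<kappa> b * pev \<kappa> (pderiv f) \<gamma> + 2 * 0 * \<kappa> a \<noteq> 0"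
    using root_\<gamma> simple_root \<kappa>b by simp_all
  from branch_exists[OF hom this(1) simple_root this(2)]
  obtain U V where UV: "U $$$ 0 = 0" "V $$$ 0 = 0"
    "(fps_const 0 + V)\<^sup>2 = pev (\<lambda>c. fps_const (\<kappa> c)) f (fps_const \<gamma> + U)"
    "fps_const (\<kappa> a) * U + fps_const (\<kappa> b) * V = fps_X"
    by blast
  have VV: "V\<^sup>2 = pev (\<lambda>c. fps_const (\<kappa> c)) f (fps_const \<gamma> + U)" using UV(3) by simp
  have V2: "(V\<^sup>2) $$$ 1 = 0" "(V\<^sup>2) $$$ 2 = (V $$$ 1)\<^sup>2"
    using UV(2) by (simp_all add: power2_eq_square fps_mult_nth numeral_2_eq_2)
  have "d * U $$$ 1 = 0"
    using branch_first_order[OF hom, of 1 U f \<gamma>] UV(1) V2(1) by (simp add: VV d_def)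
  then have U1: "U $$$ 1 = 0" using simple_root by (simp add: d_def)
  have "U $$$ i = 0" if "i < 2" for i using that UV(1) U1 by (auto simp: less_2_cases_iff)
  from branch_first_order[of \<kappa> 2 U f \<gamma>, OF hom this] have U2: "(V $$$ 1)\<^sup>2 = d * U $$$ 2"
    using V2(2) by (simp add: VV d_def)
  have "(fps_const (\<kappa> a) * U + fps_const (\<kappa> b) * V) $$$ 1 = 1" unfolding UV(4) by simp
  then have V1: "V $$$ 1 = 1 / \<kappa> b" using U1 \<kappa>b by (simp add: field_simps)
  have "expansion \<iota> f x y \<kappa> \<gamma> \<kappa> (fps_const \<gamma> + U) V"
  proof
    show "V\<^sup>2 = pev (\<lambda>c. fps_const (\<kappa> c)) f (fps_const \<gamma> + U)" by (rule VV)
    show "pev (\<lambda>c. pev \<kappa> c ((fps_const \<gamma> + U) $$$ 0)) v (V $$$ 0) \<noteq> 0" if "v \<notin> P" for v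
      using that UV(1,2) by (simp add: P_def point_ideal_def eval2_pev)
  qed
  moreover have "leads V 1 (1 / \<kappa> b)"
    using UV(2) V1 by (intro leadsI) simp_all
  moreover have "leads U 2 ((1 / \<kappa> b)\<^sup>2 / d)"
  proof (rule leadsI)
    have "U $$$ 2 = (d * U $$$ 2) / d" using simple_root by (simp add: d_def)
    then show "U $$$ 2 = (1 / \<kappa> b)\<^sup>2 / d" unfolding U2[symmetric] V1 .
  qed (use UV(1) U1 in \<open>auto simp: less_2_cases_iff\<close>)
  moreover have "fps_const (\<kappa> a) * (fps_const \<gamma> + U) + fps_const (\<kappa> b) * V = fps_const (\<kappa> a * \<gamma>) + fps_X"
    unfolding distrib_left add.assoc UV(4) by simp
  ultimately show ?thesis unfolding d_def by blast
qed

text \<open>Expansion at the generic point \<open>(x, y)\<close>: its coefficients are the Hasse derivatives with respect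
  to \<open>x + y\<close>, and they stay in the local ring.\<close>

definition Rfps :: "'b fps set" where
  "Rfps = {F. \<forall>n. F $$$ n \<in> R}"

lemma R_0: "0 \<in> R" and R_1: "1 \<in> R"
  using R_const[of 0] R_const[of 1] by simp_all

lemma R_uminus: "r \<in> R \<Longrightarrow> - r \<in> R"
  using R_mult[OF R_const[of "- 1"]] by (simp add: emb.hom_uminus)

lemma R_diff: "r \<in> R \<Longrightarrow> s \<in> R \<Longrightarrow> r - s \<in> R"
  using R_add[OF _ R_uminus] by simp

lemma R_sum: "(\<And>i. i \<in> A \<Longrightarrow> h i \<in> R) \<Longrightarrow> sum h A \<in> R"
  by (induction A rule: infinite_finite_induct) (simp_all add: R_0 R_add)

lemma Rfps_add: "F \<in> Rfps \<Longrightarrow> G \<in> Rfps \<Longrightarrow> F + G \<in> Rfps"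
  by (simp add: Rfps_def R_add)

lemma Rfps_mult: "F \<in> Rfps \<Longrightarrow> G \<in> Rfps \<Longrightarrow> F * G \<in> Rfps"
  by (simp add: Rfps_def fps_mult_nth R_sum R_mult)

lemma Rfps_const: "r \<in> R \<Longrightarrow> fps_const r \<in> Rfps"
  by (simp add: Rfps_def R_0)

lemma Rfps_inverse:
  assumes F: "F \<in> Rfps" and i: "inverse (F $$$ 0) \<in> R" "F $$$ 0 \<noteq> 0"
  shows "inverse F \<in> Rfps"
proof -
  define G where "G = inverse F"
  have FG: "F * G = 1" using i(2) by (simp add: G_def inverse_mult_eq_1')
  have "G $$$ n \<in> R" for n
  proof (induction n rule: less_induct)
    case (less n)
    have "(\<Sum>i=0..n. F $$$ i * G $$$ (n - i)) = (if n = 0 then 1 else 0)"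
      using arg_cong[OF FG, of "\<lambda>H. H $$$ n"] by (simp add: fps_mult_nth)
    moreover have "(\<Sum>i=0..n. F $$$ i * G $$$ (n - i)) = F $$$ 0 * G $$$ n + (\<Sum>i=1..n. F $$$ i * G $$$ (n - i))"
      by (simp add: sum.atLeast_Suc_atMost)
    ultimately have "F $$$ 0 * G $$$ n = (if n = 0 then 1 else 0) - (\<Sum>i=1..n. F $$$ i * G $$$ (n - i))"
      by (simp add: eq_diff_eq)
    then have "G $$$ n = inverse (F $$$ 0) * ((if n = 0 then 1 else 0) - (\<Sum>i=1..n. F $$$ i * G $$$ (n - i)))"
      using i(2) by (metis mult.assoc left_inverse mult_1)
    moreover have "(\<Sum>i=1..n. F $$$ i * G $$$ (n - i)) \<in> R"
      using F less by (intro R_sum R_mult) (auto simp: Rfps_def)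
    moreover have "(if n = 0 then 1 else 0) \<in> R" using R_0 R_1 by simp
    ultimately show "G $$$ n \<in> R" using i(1) by (simp add: R_mult R_diff)
  qed
  then show ?thesis by (simp add: Rfps_def G_def)
qed

text \<open>Among the coefficients of U up to index n only U_n is not yet known to lie in
  \<open>R\<close>; in the n-th coefficient of h(x + U) it occurs linearly with factor h'(x), and
  the remaining terms lie in \<open>R\<close>.\<close>

lemma branch_coefficient_mod_R:
  assumes "n > 0" "U $$$ 0 = 0" "\<And>i. i < n \<Longrightarrow> U $$$ i \<in> R"
  shows "(\<forall>i<n. pev (\<lambda>c. fps_const (\<iota> c)) h (fps_const x + U) $$$ i \<in> R) \<and>
    pev (\<lambda>c. fps_const (\<iota> c)) h (fps_const x + U) $$$ 0 = pev \<iota> h x \<and>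
    pev (\<lambda>c. fps_const (\<iota> c)) h (fps_const x + U) $$$ n - pev \<iota> (pderiv h) x * U $$$ n \<in> R"
proof -
  interpret C: comm_ring_hom "\<lambda>c. fps_const (\<iota> c)" by (rule emb.fps_const_hom)
  have xR: "x \<in> R" using R_poly_x[of "[:0, 1:]"] by simp
  show ?thesis
  proof (induction h)
    case 0
    then show ?case by (simp add: R_0)
  next
    case (pCons a h)
    define T where "T = pev (\<lambda>c. fps_const (\<iota> c)) h (fps_const x + U)"
    have T: "T $$$ i \<in> R" if "i < n" for i using pCons.IH that by (simp add: T_def)
    have T0: "T $$$ 0 = pev \<iota> h x" and Tn: "T $$$ n - pev \<iota> (pderiv h) x * U $$$ n \<in> R"
      using pCons.IH by (simp_all add: T_def)
    define Z where "Z = U * T"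
    have Zi: "Z $$$ i \<in> R" if "i < n" for i
      unfolding Z_def fps_mult_nth using that assms(3) T by (intro R_sum R_mult) auto
    have "Z $$$ n = (\<Sum>i=0..n. U $$$ i * T $$$ (n - i))" unfolding Z_def by (rule fps_mult_nth)
    also have "\<dots> = (\<Sum>i=0..<n. U $$$ i * T $$$ (n - i)) + U $$$ n * T $$$ 0"
      by (simp add: atLeastLessThanSuc_atLeastAtMost[symmetric] atLeastLessThanSuc)
    finally have Zn: "Z $$$ n - U $$$ n * pev \<iota> h x = (\<Sum>i=0..<n. U $$$ i * T $$$ (n - i))" by (simp add: T0)
    have "(\<Sum>i=0..<n. U $$$ i * T $$$ (n - i)) \<in> R"
    proof (rule R_sum)
      fix i assume "i \<in> {0..<n}"
      then show "U $$$ i * T $$$ (n - i) \<in> R"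
        using assms(2,3) T by (cases "i = 0") (simp_all add: R_0 R_mult)
    qed
    then have Zn': "Z $$$ n - U $$$ n * pev \<iota> h x \<in> R" by (simp add: Zn)
    have e: "pev (\<lambda>c. fps_const (\<iota> c)) (pCons a h) (fps_const x + U) = fps_const (\<iota> a) + (fps_const x * T + Z)"
      by (simp add: T_def Z_def distrib_right)
    have "(fps_const (\<iota> a) + (fps_const x * T + Z)) $$$ n - pev \<iota> (pderiv (pCons a h)) x * U $$$ n =
        x * (T $$$ n - pev \<iota> (pderiv h) x * U $$$ n) + (Z $$$ n - U $$$ n * pev \<iota> h x)"
      using assms(1) by (simp add: pderiv_pCons emb.pev_add algebra_simps)
    also have "\<dots> \<in> R" by (intro R_add R_mult xR Tn Zn')
    finally have "(fps_const (\<iota> a) + (fps_const x * T + Z)) $$$ n - pev \<iota> (pderiv (pCons a h)) x * U $$$ n \<in> R" .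
    moreover have "\<forall>i<n. (fps_const (\<iota> a) + (fps_const x * T + Z)) $$$ i \<in> R"
      using Zi T R_const xR by (simp add: R_add R_mult R_0)
    moreover have "(fps_const (\<iota> a) + (fps_const x * T + Z)) $$$ 0 = pev \<iota> (pCons a h) x"
      using assms(2) by (simp add: Z_def T0)
    ultimately show ?case unfolding e by (intro conjI)
  qed
qed

text \<open>Comparing n-th coefficients in the curve equation and eliminating V_n through U + V = s
  shows that (2 y + f'(x)) U_n lies in \<open>R\<close>. The factor is a unit there, its value at
  (\<gamma>, 0) being f'(\<gamma>).\<close>

lemma branch_in_Rfps:
  assumes U: "U $$$ 0 = 0" and V: "V $$$ 0 = 0"
    and eq: "(fps_const y + V)\<^sup>2 = pev (\<lambda>c. fps_const (\<iota> c)) f (fps_const x + U)" and UV: "U + V = fps_X"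
  shows "U \<in> Rfps" "V \<in> Rfps"
proof -
  define d where "d = pev \<iota> (pderiv f) x"
  define w where "w = [:pderiv f, 2:]"
  interpret E: comm_ring_hom "\<lambda>c. pev \<iota> c x" by (rule emb.pev_comm_ring_hom)
  have "w \<notin> P" using simple_root by (simp add: P_iff w_def)
  moreover have "eval2 \<iota> w x y = 2 * y + d"
  proof -
    have "pev \<iota> 2 x = 2" using E.hom_of_nat[of 2] by simp
    then show ?thesis by (simp add: eval2_pev w_def d_def)
  qed
  ultimately have unit: "inverse (2 * y + d) \<in> R" "2 * y + d \<noteq> 0"
    using inverse_in_R eval2_nonzero by metis+
  have Vn: "V $$$ n = (if n = 1 then 1 else 0) - U $$$ n" for n
    using arg_cong[OF UV, of "\<lambda>F. F $$$ n"] by (simp add: eq_diff_eq add.commute fps_X_def)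
  have "U $$$ n \<in> R" for n
  proof (induction n rule: less_induct)
    case (less n)
    show ?case
    proof (cases "n = 0")
      case True
      then show ?thesis by (simp add: U R_0)
    next
      case False
      then have n: "n > 0" by simp
      have VR: "V $$$ i \<in> R" if "i < n" for i
        using less[OF that] by (simp add: Vn R_diff R_0 R_1)
      define L where "L = pev (\<lambda>c. fps_const (\<iota> c)) f (fps_const x + U) $$$ n"
      have 1: "L - d * U $$$ n \<in> R"
        unfolding L_def d_def using branch_coefficient_mod_R[of n U f, OF n U less] by blast
      have "(fps_const y + V)\<^sup>2 = fps_const (y\<^sup>2) + (fps_const (2 * y) * V + V * V)"
        by (simp add: power2_eq_square algebra_simps flip: fps_const_mult numeral_fps_const)
      then have "L = 2 * y * V $$$ n + (V * V) $$$ n"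
        using n unfolding L_def eq[symmetric] by simp
      moreover have VV: "(V * V) $$$ n \<in> R"
        unfolding fps_mult_nth
      proof (rule R_sum)
        fix i assume "i \<in> {0..n}"
        then show "V $$$ i * V $$$ (n - i) \<in> R"
          using V VR n by (cases "i = 0"; cases "i = n") (simp_all add: R_0 R_mult)
      qed
      ultimately have "(2 * y + d) * U $$$ n = (if n = 1 then 2 * y else 0) + (V * V) $$$ n - (L - d * U $$$ n)"
        by (simp add: Vn algebra_simps)
      then have Un: "U $$$ n = inverse (2 * y + d) * ((if n = 1 then 2 * y else 0) + (V * V) $$$ n - (L - d * U $$$ n))"
        using unit(2) by (metis mult.assoc left_inverse mult_1)
      have "2 * y \<in> R" using R_add[OF y_in_R y_in_R] by (simp only: mult_2)
      then have "(if n = 1 then 2 * y else 0) \<in> R" using R_0 by simp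
      then have "(if n = 1 then 2 * y else 0) + (V * V) $$$ n - (L - d * U $$$ n) \<in> R"
        by (intro R_diff R_add VV 1)
      from R_mult[OF unit(1) this] show ?thesis by (simp only: Un[symmetric])
    qed
  qed
  then show "U \<in> Rfps" by (simp add: Rfps_def)
  then show "V \<in> Rfps" by (simp add: Rfps_def Vn R_diff R_0 R_1)
qed

text \<open>D_k r is the k-th coefficient of r expanded at the generic point with t = (x + y) + s.
  The Leibniz rule is the Cauchy product, and the values on powers of t are the binomial theorem.
  The single coordinate x + y suffices for existence of the index.\<close>

lemma hasse_derivatives_exist: "\<exists>D. hasse_derivatives \<iota> R (x + y) D"
proof -
  have hom: "comm_ring_hom \<iota>" by (rule emb.comm_ring_hom_axioms)
  interpret E: comm_ring_hom "\<lambda>c. pev \<iota> c x" by (rule emb.pev_comm_ring_hom)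
  have d: "pev \<iota> (pderiv f) x \<noteq> 0"
    using eval2_nonzero[of "[:pderiv f:]"] simple_root by (simp add: P_iff eval2_x)
  have "[:pderiv f, 2:] \<notin> P" using simple_root by (simp add: P_iff)
  then have "eval2 \<iota> [:pderiv f, 2:] x y \<noteq> 0" by (rule eval2_nonzero)
  moreover have "pev \<iota> 2 x = 2" using E.hom_of_nat[of 2] by simp
  ultimately have "1 * pev \<iota> (pderiv f) x + 2 * y * 1 \<noteq> 0"
    by (simp add: eval2_pev mult.commute)
  from branch_exists[OF hom curve d this] obtain U V where UV: "U $$$ 0 = 0" "V $$$ 0 = 0"
    "(fps_const y + V)\<^sup>2 = pev (\<lambda>c. fps_const (\<iota> c)) f (fps_const x + U)"
    "fps_const 1 * U + fps_const 1 * V = fps_X" by blast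
  have "U + V = fps_X" using UV(4) by (simp only: fps_const_1_eq_1 mult_1)
  note UV = UV(1-3) this
  note UVR = branch_in_Rfps[OF UV]
  interpret T: expansion \<iota> f x y \<kappa> \<gamma> \<iota> "fps_const x + U" "fps_const y + V"
  proof
    show "(fps_const y + V)\<^sup>2 = pev (\<lambda>c. fps_const (\<iota> c)) f (fps_const x + U)" by (rule UV(3))
    show "pev (\<lambda>c. pev \<iota> c ((fps_const x + U) $$$ 0)) v ((fps_const y + V) $$$ 0) \<noteq> 0" if "v \<notin> P" for v
      using eval2_nonzero[OF that] UV(1,2) by (simp add: eval2_pev)
  qed
  have xR: "x \<in> R" using R_poly_x[of "[:0, 1:]"] by simp
  have substR: "T.subst h \<in> Rfps" for h
  proof -
    have 0: "(0::'b fps) \<in> Rfps" by (simp add: Rfps_def R_0)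
    have "pev (\<lambda>c. fps_const (\<iota> c)) h (fps_const x + U) \<in> Rfps" for h
      by (induction h) (simp_all add: 0 Rfps_add Rfps_mult Rfps_const R_const xR UVR)
    then show ?thesis
      unfolding T.subst_def by (induction h) (simp_all add: 0 Rfps_add Rfps_mult Rfps_const y_in_R UVR)
  qed
  have subst0: "T.subst v $$$ 0 = eval2 \<iota> v x y" for v
    using UV(1,2) by (simp add: T.subst_nth_0 eval2_pev)
  have expR: "T.expand r \<in> Rfps" if "r \<in> R" for r
    using that
  proof (rule R_cases)
    fix u v assume v: "v \<notin> P" and r: "r = eval2 \<iota> u x y / eval2 \<iota> v x y"
    have "inverse (T.subst v) \<in> Rfps"
      by (rule Rfps_inverse[OF substR]) (simp_all add: subst0 inverse_in_R[OF v] eval2_nonzero[OF v])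
    then show ?thesis unfolding r T.expand_fraction[OF v] by (rule Rfps_mult[OF substR])
  qed
  have exp0: "T.expand r $$$ 0 = r" if "r \<in> R" for r
    using that
  proof (rule R_cases)
    fix u v assume v: "v \<notin> P" and r: "r = eval2 \<iota> u x y / eval2 \<iota> v x y"
    show ?thesis unfolding r T.expand_nth_0[OF v] subst0 ..
  qed
  have expt: "T.expand (x + y) = fps_const (x + y) + fps_X"
  proof -
    have "T.expand (x + y) = (fps_const x + U) + (fps_const y + V)"
      using T.expand_x[of "[:0, 1:]"] T.expand_add[OF xR y_in_R] T.expand_y by simp
    then show ?thesis by (simp add: UV(4)[symmetric] algebra_simps)
  qed
  have expt_power: "T.expand ((x + y) ^ n) = (fps_const (x + y) + fps_X) ^ n \<and> (x + y) ^ n \<in> R" for n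
  proof (induction n)
    case 0
    then show ?case using T.expand_const[of 1] R_1 by simp
  next
    case (Suc n)
    then show ?case using T.expand_mult[OF R_add[OF xR y_in_R], of "(x + y) ^ n"] R_add[OF xR y_in_R]
      by (simp add: expt R_mult)
  qed
  have "hasse_derivatives \<iota> R (x + y) (\<lambda>k r. T.expand r $$$ k)"
    unfolding hasse_derivatives_def
  proof (intro conjI allI ballI)
    show "T.expand u $$$ k \<in> R" if "u \<in> R" for u k using expR[OF that] by (simp add: Rfps_def)
    show "T.expand (u + v) $$$ k = T.expand u $$$ k + T.expand v $$$ k" if "u \<in> R" "v \<in> R" for u v k
      by (simp add: T.expand_add[OF that])
    show "T.expand (\<iota> c * u) $$$ k = \<iota> c * T.expand u $$$ k" if "u \<in> R" for u c k
      by (simp add: T.expand_mult[OF R_const that] T.expand_const)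
    show "T.expand u $$$ 0 = u" if "u \<in> R" for u by (rule exp0[OF that])
    show "T.expand (u * v) $$$ k = (\<Sum>i\<le>k. T.expand u $$$ i * T.expand v $$$ (k - i))" if "u \<in> R" "v \<in> R" for u v k
      by (simp add: T.expand_mult[OF that] fps_mult_nth atLeast0AtMost)
    show "T.expand ((x + y) ^ n) $$$ k = of_nat (n choose k) * (x + y) ^ (n - k)" for n k
      by (simp add: expt_power linear_power_nth del: fps_const_add)
  qed
  then show ?thesis by blast
qed

end


section \<open>The index at a ramification point\<close>

lemma pev_eq_poly: "poly (map_poly \<phi> h) c = pev \<phi> h c"
  by (simp add: pev_def)

context local_chart
begin

text \<open>If h(t) = 0, all powers of p divide h, so h = 0. The element p(t) has order 1 and
  generates m, and approximation modulo \<open>M 1\<close> gives the residue field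
  condition.\<close>

lemma nisnevich: "nisnevich_coordinate \<iota> R m t"
  unfolding nisnevich_coordinate_def pev_eq_poly
proof (intro conjI)
  show "transcendental_over \<iota> t"
    unfolding transcendental_over_def pev_eq_poly
  proof (intro allI impI)
    fix h assume "pev \<iota> h t = 0"
    then have "taylor h = 0" using \<Theta>_pev[of h] \<Theta>_0 by simp
    then have dvd: "p ^ n dvd h" for n by (intro p_power_dvd) simp
    show "h = 0"
    proof (rule ccontr)
      assume "h \<noteq> 0"
      then have "degree (p ^ Suc (degree h)) \<le> degree h" by (rule dvd_imp_degree_le[OF dvd])
      moreover have "degree (p ^ Suc (degree h)) = Suc (degree h) * d"
        using p_nonzero by (simp add: degree_power_eq d_def del: power_Suc)
      moreover have "Suc (degree h) * 1 \<le> Suc (degree h) * d" using d_pos by (intro mult_le_mono) simp_all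
      ultimately have "Suc (degree h) * 1 \<le> degree h" by (metis order.trans)
      then show False by simp
    qed
  qed
  show "\<forall>u\<in>R. \<exists>h. u - pev \<iota> h t \<in> m"
  proof
    fix u assume "u \<in> R"
    then obtain h where "u - pev \<iota> h t \<in> M 1" by (rule R_approx)
    then show "\<exists>h. u - pev \<iota> h t \<in> m" by (auto simp only: M_1)
  qed
  show "m = ideal_span R {pev \<iota> h t | h. pev \<iota> h t \<in> m}"
  proof
    have "has_order (pev \<iota> p t) 1 p'"
      using root p'_nonzero taylor_nth_0[of p] taylor_nth_1[of p]
      by (simp add: has_order_def M_def pev_t_in_R \<Theta>_pev p'_def)
    then have pm: "m = principal_ideal R (pev \<iota> p t)" by (simp only: principal_ideal_eq M_1)
    have "pev \<iota> p t \<in> m" using root taylor_nth_0[of p] by (simp add: m_eq pev_t_in_R \<Theta>_pev)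
    then have gen: "pev \<iota> p t \<in> {pev \<iota> h t | h. pev \<iota> h t \<in> m}" by blast
    show "m \<subseteq> ideal_span R {pev \<iota> h t | h. pev \<iota> h t \<in> m}"
    proof
      fix u assume "u \<in> m"
      then obtain v where v: "v \<in> R" "u = pev \<iota> p t * v" using pm by blast
      show "u \<in> ideal_span R {pev \<iota> h t | h. pev \<iota> h t \<in> m}"
        unfolding ideal_span_def
      proof (rule CollectI, rule exI[of _ "1::nat"], rule exI[of _ "\<lambda>_. v"],
          rule exI[of _ "\<lambda>_. pev \<iota> p t"], intro conjI allI impI)
        show "u = (\<Sum>i<(1::nat). v * pev \<iota> p t)" by (simp add: v(2) mult.commute)
      qed (rule v(1) gen)+
    qed
    show "ideal_span R {pev \<iota> h t | h. pev \<iota> h t \<in> m} \<subseteq> m"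
      unfolding ideal_span_def
    proof (rule subsetI, elim CollectE exE conjE)
      fix u a s and k :: nat
      assume u: "u = (\<Sum>i<k. a i * s i)" and *: "\<forall>i<k. a i \<in> R \<and> s i \<in> {pev \<iota> h t | h. pev \<iota> h t \<in> m}"
      have "a i * s i \<in> M 1" if "i < k" for i
        using * that M_mult_R[of "s i" 1 "a i"] by (auto simp only: M_1 mult.commute)
      then have "u \<in> M 1" unfolding u by (intro M_sum) simp
      then show "u \<in> m" by (simp only: M_1)
    qed
  qed
qed (rule t_in_R)

end

text \<open>If p'(c) were 0, minimality would make p divide p'; but p is irreducible, hence coprime
  to p' over a perfect field, and would be a unit.\<close>

lemma (in field_hom) perfect_imp_separable:
  assumes perfect: "perfect_field TYPE('a)"
    and p: "lead_coeff p = 1" "pev hom p c = 0" "\<forall>h. pev hom h c = 0 \<longrightarrow> p dvd h"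
  shows "pev hom (pderiv p) c \<noteq> 0"
proof
  assume "pev hom (pderiv p) c = 0"
  then have "p dvd pderiv p" using p(3) by blast
  have "\<not> is_unit p"
  proof
    assume "is_unit p"
    then obtain q where "1 = p * q" by (rule dvdE)
    from arg_cong[OF this, of "\<lambda>h. pev hom h c"] have "pev hom 1 c = pev hom p c * pev hom q c"
      by (simp only: pev_mult)
    with p(2) show False by simp
  qed
  moreover have "irreducible p"
  proof (rule irreducibleI)
    show p0: "p \<noteq> 0" using p(1) by auto
    show "is_unit u \<or> is_unit v" if uv: "p = u * v" for u v
    proof -
      have unit: "is_unit v'" if "p = u' * v'" "pev hom u' c = 0" for u' v'
      proof -
        have "p dvd u'" using p(3) that(2) by blast
        then obtain w where w: "u' = p * w" by (rule dvdE)
        then have "p * 1 = p * (w * v')" using that(1)[unfolded w] by (simp only: mult.assoc mult_1_right)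
        then have "1 = w * v'" unfolding mult_left_cancel[OF p0] .
        then show ?thesis by (metis dvd_triv_right)
      qed
      have "pev hom u c * pev hom v c = 0" using p(2) by (simp add: uv pev_mult)
      then show ?thesis using unit[OF uv] unit[of v u] uv by (auto simp: mult.commute)
    qed
  qed (rule \<open>\<not> is_unit p\<close>)
  then have "coprime p (pderiv p)" using perfect by (simp add: perfect_field_def)
  then have "is_unit p" using \<open>p dvd pderiv p\<close> by (meson coprime_common_divisor dvd_refl)
  ultimately show False by simp
qed

lemma (in comm_ring_hom) pev_pcompose: "pev hom (h \<circ>\<^sub>p q) c = pev hom h (pev hom q c)"
  by (induction h) (simp_all add: pcompose_pCons pev_add pev_mult)

section \<open>The basis as a list and the product of its leading coefficients\<close>

lemma length_series_basis: "length (series_basis l g x y) = 2 * (l - g) + (l + 1 - (l - g))"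
proof -
  have "length (concat (map (\<lambda>i. [x ^ i, x ^ i * y]) [0..<k])) = 2 * k" for k
    by (induction k) simp_all
  then show ?thesis by (simp add: series_basis_def)
qed

lemma nth_series_basis:
  assumes "j < length (series_basis l g x y)"
  shows "series_basis l g x y ! j = lam (l - g) x y j"
proof -
  have len: "length (concat (map (\<lambda>i. [x ^ i, x ^ i * y]) [0..<k])) = 2 * k" for k
    by (induction k) simp_all
  have nth: "concat (map (\<lambda>i. [x ^ i, x ^ i * y]) [0..<k]) ! j = x ^ (j div 2) * y ^ (j mod 2)"
    if "j < 2 * k" for j k
    using that
  proof (induction k)
    case (Suc k)
    have "j < 2 * k \<or> j = 2 * k \<or> j = 2 * k + 1" using Suc.prems by arith
    then consider "j < 2 * k" | "j = 2 * k" | "j = 2 * k + 1" by blast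
    then show ?case
    proof cases
      case 1
      then show ?thesis using Suc.IH by (simp add: nth_append len)
    qed (simp_all add: nth_append len)
  qed simp
  show ?thesis
  proof (cases "j < 2 * (l - g)")
    case True
    then show ?thesis by (simp add: series_basis_def lam_def nth_append len nth)
  next
    case False
    then have "j - 2 * (l - g) < l + 1 - (l - g)"
      using assms unfolding length_series_basis by linarith
    moreover have "l - g + (j - 2 * (l - g)) = j - (l - g)" using False by linarith
    ultimately show ?thesis
      using False by (simp add: series_basis_def lam_def nth_append len del: upt_Suc)
  qed
qed

lemma sum_lessThan_choose_two: "(\<Sum>i<n. i) = n choose 2"
  by (induction n) (simp_all add: numeral_2_eq_2)

lemma prod_lam:
  fixes u v :: "'a::comm_ring_1"
  shows "(\<Prod>j<2 * m + k. lam m u v j) = (u ^ (\<Sum>q<m. q))\<^sup>2 * v ^ m * u ^ (m * k + (\<Sum>i<k. i))"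
proof -
  have low: "(\<Prod>j<2 * m'. u ^ (j div 2) * v ^ (j mod 2)) = (u ^ (\<Sum>q<m'. q))\<^sup>2 * v ^ m'" for m'
    by (induction m') (simp_all add: power_add power2_eq_square mult_ac mod_Suc)
  have split: "(\<Prod>j<a + b. f j) = (\<Prod>j<a. f j) * (\<Prod>j<b. f (a + j))" for f :: "nat \<Rightarrow> 'a" and a b
    by (induction b) (simp_all add: mult.assoc)
  have "(\<Prod>j<2 * m. lam m u v j) = (\<Prod>j<2 * m. u ^ (j div 2) * v ^ (j mod 2))"
    by (intro prod.cong) (simp_all add: lam_def)
  moreover have "(\<Prod>i<k. lam m u v (2 * m + i)) = (\<Prod>i<k. u ^ (m + i))"
    by (intro prod.cong) (simp_all add: lam_def)
  moreover have "(\<Prod>i<k. u ^ (m + i)) = u ^ (m * k + (\<Sum>i<k. i))"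
    by (simp add: sum.distrib mult.commute[of k m] flip: power_sum)
  ultimately show ?thesis by (simp only: split low)
qed

text \<open>For even m the power v^m is a square, and u occurs outside a square with the odd
  exponent 2 e + 1. So the product has the square class of u = v^2/d, which is that of d: the choice
  of coordinate, present only in v, drops out.\<close>

lemma prod_lam_square_class:
  fixes u v d :: "'a::field"
  assumes "even m" "even k" "odd (\<Sum>i<k. i)" and u: "u = v\<^sup>2 / d" and nz: "v \<noteq> 0" "d \<noteq> 0"
  shows "\<exists>s. s \<noteq> 0 \<and> (\<Prod>j<2 * m + k. lam m u v j) = d * s\<^sup>2"
proof -
  obtain m' where m': "m = 2 * m'" using assms(1) by (rule evenE)
  have "odd (m * k + (\<Sum>i<k. i))" using assms(1,3) by simp
  then obtain e where e: "m * k + (\<Sum>i<k. i) = 2 * e + 1" by (rule oddE)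
  have "u \<noteq> 0" using u nz by simp
  define s where "s = u ^ (\<Sum>q<m. q) * v ^ m' * u ^ e * (v / d)"
  have "(\<Prod>j<2 * m + k. lam m u v j) = (u ^ (\<Sum>q<m. q))\<^sup>2 * (v ^ m')\<^sup>2 * ((u ^ e)\<^sup>2 * u)"
    by (simp add: prod_lam e) (simp add: m' power_mult mult.commute[of 2])
  also have "\<dots> = (u ^ (\<Sum>q<m. q))\<^sup>2 * (v ^ m')\<^sup>2 * ((u ^ e)\<^sup>2 * (d * (v / d)\<^sup>2))"
    using nz by (simp add: u power2_eq_square)
  also have "\<dots> = d * s\<^sup>2"
    unfolding s_def power_mult_distrib by (simp only: mult_ac)
  finally show ?thesis
    using \<open>u \<noteq> 0\<close> nz by (intro exI[of _ s]) (simp add: s_def)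
qed

context ramification_point
begin

lemma m_cases:
  assumes "r \<in> m"
  obtains u v where "u \<in> P" "v \<notin> P" "r = eval2 \<iota> u x y / eval2 \<iota> v x y"
  using assms unfolding m_def local_ideal_def by blast

lemma eval2_in_m_iff: "eval2 \<iota> w x y \<in> m \<longleftrightarrow> w \<in> P"
proof
  assume "w \<in> P"
  moreover have "eval2 \<iota> w x y = eval2 \<iota> w x y / eval2 \<iota> 1 x y" by simp
  ultimately show "eval2 \<iota> w x y \<in> m" unfolding m_def local_ideal_def using one_not_P by blast
next
  assume "eval2 \<iota> w x y \<in> m"
  then obtain u v where uv: "u \<in> P" "v \<notin> P" "eval2 \<iota> w x y = eval2 \<iota> u x y / eval2 \<iota> v x y" by (rule m_cases)
  have "eval2 \<iota> (w * v - u) x y = 0"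
    using uv(3) eval2_nonzero[OF uv(2)] by (simp add: ev.hom_minus ev.hom_mult)
  from this res.comm_ring_hom_axioms have "pev (\<lambda>c. pev \<kappa> c \<gamma>) (w * v - u) 0 = 0"
    by (rule eval_zero_transfer) (simp add: root_\<gamma>)
  then have "w * v - u \<in> P" by (simp add: P_def point_ideal_def eval2_pev)
  then have "pev \<kappa> (coeff w 0) \<gamma> * pev \<kappa> (coeff v 0) \<gamma> = 0"
    using uv(1) by (simp add: P_iff coeff_mult_0 res.pev_diff res.pev_mult)
  then show "w \<in> P" using uv(2) by (simp add: P_iff)
qed

lemma m_mult_R: "r \<in> m \<Longrightarrow> s \<in> R \<Longrightarrow> r * s \<in> m"
proof -
  assume "r \<in> m" "s \<in> R"
  then obtain u v u' v' where *: "u \<in> P" "v \<notin> P" "r = eval2 \<iota> u x y / eval2 \<iota> v x y"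
    "v' \<notin> P" "s = eval2 \<iota> u' x y / eval2 \<iota> v' x y" by (metis R_cases m_cases)
  have "r * s = eval2 \<iota> (u * u') x y / eval2 \<iota> (v * v') x y"
    unfolding *(3,5) ev.hom_mult by simp
  moreover have "u * u' \<in> P" using *(1) by (simp add: P_iff coeff_mult_0 res.pev_mult)
  ultimately show "r * s \<in> m"
    unfolding m_def local_ideal_def using not_P_mult[OF *(2,4)] by blast
qed

lemma y_in_m: "y \<in> m"
  using eval2_in_m_iff[of "[:0, 1:]"] by (simp add: eval2_y P_iff)

lemma one_not_in_m: "1 \<notin> m"
  using eval2_in_m_iff[of 1] one_not_P by simp

text \<open>A polynomial in \<open>x\<close> vanishing at the point lies in \<open>y\<^sup>2 R\<close>, so \<open>x\<close> alone is never unramified.\<close>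

lemma nisnevich_b_nonzero:
  assumes "nisnevich_coordinate \<iota> R m (\<iota> a * x + \<iota> b * y)"
  shows "b \<noteq> 0"
proof
  assume "b = 0"
  then have span: "m = ideal_span R {pev \<iota> h (\<iota> a * x) | h. pev \<iota> h (\<iota> a * x) \<in> m}"
    using assms unfolding nisnevich_coordinate_def pev_eq_poly by simp
  have gens: "\<exists>r\<in>R. pev \<iota> h (\<iota> a * x) = y\<^sup>2 * r" if "pev \<iota> h (\<iota> a * x) \<in> m" for h
  proof -
    have e: "pev \<iota> h (\<iota> a * x) = eval2 \<iota> [:h \<circ>\<^sub>p [:0, a:]:] x y"
      by (simp add: eval2_x emb.pev_pcompose mult.commute)
    then have "[:h \<circ>\<^sub>p [:0, a:]:] \<in> P" using that eval2_in_m_iff by simp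
    from vanishing_numerator(2)[OF this refl] show ?thesis unfolding e .
  qed
  have "u \<in> ideal_span R {pev \<iota> h (\<iota> a * x) | h. pev \<iota> h (\<iota> a * x) \<in> m} \<Longrightarrow> \<exists>r\<in>R. u = y\<^sup>2 * r" for u
    unfolding ideal_span_def
  proof (elim CollectE exE conjE)
    fix c s and k :: nat
    assume u: "u = (\<Sum>i<k. c i * s i)" and *: "\<forall>i<k. c i \<in> R \<and> s i \<in> {pev \<iota> h (\<iota> a * x) | h. pev \<iota> h (\<iota> a * x) \<in> m}"
    have "\<exists>r\<in>R. (\<Sum>i<j. c i * s i) = y\<^sup>2 * r" if "j \<le> k" for j
      using that
    proof (induction j)
      case 0
      then show ?case using R_0 by (intro bexI[of _ 0]) simp_all
    next
      case (Suc j)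
      then obtain r where r: "r \<in> R" "(\<Sum>i<j. c i * s i) = y\<^sup>2 * r" by auto
      have "c j \<in> R" "s j \<in> {pev \<iota> h (\<iota> a * x) | h. pev \<iota> h (\<iota> a * x) \<in> m}" using * Suc.prems by simp_all
      moreover from this(2) obtain h where "s j = pev \<iota> h (\<iota> a * x)" "pev \<iota> h (\<iota> a * x) \<in> m" by blast
      then have "\<exists>r\<in>R. s j = y\<^sup>2 * r" using gens[of h] by simp
      ultimately obtain r' where "c j \<in> R" and r': "r' \<in> R" "s j = y\<^sup>2 * r'" by blast
      have "(\<Sum>i<Suc j. c i * s i) = y\<^sup>2 * (r + c j * r')" by (simp add: r r' algebra_simps)
      moreover have "r + c j * r' \<in> R" by (intro R_add R_mult r r' \<open>c j \<in> R\<close>)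
      ultimately show ?case by blast
    qed
    then show "\<exists>r\<in>R. u = y\<^sup>2 * r" unfolding u by blast
  qed
  then obtain r where r: "r \<in> R" "y = y\<^sup>2 * r" using span y_in_m by blast
  have "y \<noteq> 0"
  proof
    assume "y = 0"
    then have "pev \<iota> f x = 0" using curve by simp
    then have "f = 0" by (rule transcendental)
    with odd_degree show False by simp
  qed
  then have "y * r = 1" using r(2) by (simp add: power2_eq_square)
  with m_mult_R[OF y_in_m r(1)] one_not_in_m show False by simp
qed

text \<open>Since y vanishes at the point, t has residue \<tau> = a \<gamma>. The two alternatives
  in \<open>gen\<close> serve the two halves of the definite description: existence, where \<tau> =
  \<gamma> generates k, and uniqueness, where t is an arbitrary Nisnevich coordinate.\<close>

lemma chart_exists:
  assumes b: "b \<noteq> 0" and perfect: "perfect_field TYPE('a)"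
    and gen: "(\<forall>c. \<exists>h. c = pev \<kappa> h (\<kappa> a * \<gamma>)) \<or> nisnevich_coordinate \<iota> R m (\<iota> a * x + \<iota> b * y)"
  shows "\<exists>p \<Theta> U V. local_chart \<kappa> (\<kappa> a * \<gamma>) p \<iota> R m (\<iota> a * x + \<iota> b * y) y \<Theta> \<and>
    \<Theta> x = fps_const \<gamma> + U \<and> \<Theta> y = V \<and>
    leads V 1 (1 / \<kappa> b) \<and> leads U 2 ((1 / \<kappa> b)\<^sup>2 / pev \<kappa> (pderiv f) \<gamma>)"
proof -
  define \<tau> t where "\<tau> = \<kappa> a * \<gamma>" and "t = \<iota> a * x + \<iota> b * y"
  obtain U V where S: "expansion \<iota> f x y \<kappa> \<gamma> \<kappa> (fps_const \<gamma> + U) V"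
    and lin: "fps_const (\<kappa> a) * (fps_const \<gamma> + U) + fps_const (\<kappa> b) * V = fps_const \<tau> + fps_X"
    and lead: "leads V 1 (1 / \<kappa> b)" "leads U 2 ((1 / \<kappa> b)\<^sup>2 / pev \<kappa> (pderiv f) \<gamma>)"
    unfolding \<tau>_def using residue_expansion_exists[OF b] by blast
  interpret S: expansion \<iota> f x y \<kappa> \<gamma> \<kappa> "fps_const \<gamma> + U" V by (rule S)
  have UV0: "U $$$ 0 = 0" "V $$$ 0 = 0" using leadsD(1)[OF lead(2), of 0] leadsD(1)[OF lead(1), of 0] by simp_all
  have subst0: "S.subst v $$$ 0 = eval2 \<kappa> v \<gamma> 0" for v
    using UV0 by (simp add: S.subst_nth_0 eval2_pev)
  have xR: "x \<in> R" using R_poly_x[of "[:0, 1:]"] by simp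
  have exp_x: "S.expand x = fps_const \<gamma> + U" using S.expand_x[of "[:0, 1:]"] by simp
  have tR: "t \<in> R" unfolding t_def by (intro R_add R_mult R_const xR y_in_R)
  have exp_t: "S.expand t = fps_const \<tau> + fps_X"
    unfolding t_def
    by (simp add: S.expand_add S.expand_mult S.expand_const S.expand_y R_mult R_const xR y_in_R exp_x lin)
  have m_eq: "m = {u \<in> R. S.expand u $$$ 0 = 0}"
  proof (intro Set.set_eqI iffI)
    fix r assume "r \<in> m"
    then obtain u v where "u \<in> P" "v \<notin> P" "r = eval2 \<iota> u x y / eval2 \<iota> v x y" by (rule m_cases)
    then show "r \<in> {u \<in> R. S.expand u $$$ 0 = 0}"
      using R_intro by (simp add: S.expand_nth_0 subst0 P_def point_ideal_def)
  next
    fix r assume r: "r \<in> {u \<in> R. S.expand u $$$ 0 = 0}"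
    then obtain u v where uv: "v \<notin> P" "r = eval2 \<iota> u x y / eval2 \<iota> v x y" using R_cases by blast
    have "eval2 \<kappa> u \<gamma> 0 = 0"
      using r uv S.subst_unit[OF uv(1)] by (simp add: S.expand_nth_0 subst0)
    then have "u \<in> P" by (simp add: P_def point_ideal_def)
    with uv show "r \<in> m" unfolding m_def local_ideal_def by blast
  qed
  have pev_t: "pev \<iota> h t \<in> R \<and> S.expand (pev \<iota> h t) $$$ 0 = pev \<kappa> h \<tau>" for h
  proof (induction h)
    case 0
    then show ?case using S.expand_const[of 0] R_0 by simp
  next
    case (pCons c h)
    then show ?case using tR R_const
      by (simp add: R_add R_mult S.expand_add S.expand_mult S.expand_const exp_t)
  qed
  \<comment> \<open>For a Nisnevich coordinate, h0(x) is congruent modulo m to a polynomial in t;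
    comparing constant terms writes c = h0(\<gamma>) as a polynomial in \<tau>.\<close>
  have gen': "\<exists>h. c = pev \<kappa> h \<tau>" for c
    using gen
  proof
    assume "nisnevich_coordinate \<iota> R m (\<iota> a * x + \<iota> b * y)"
    then have nis: "\<forall>u\<in>R. \<exists>h. u - pev \<iota> h t \<in> m"
      unfolding nisnevich_coordinate_def pev_eq_poly t_def by blast
    obtain h0 where h0: "c = pev \<kappa> h0 \<gamma>" using generated_\<gamma> by blast
    obtain h where h: "pev \<iota> h0 x - pev \<iota> h t \<in> m" using nis R_poly_x by blast
    have "S.expand (pev \<iota> h0 x) $$$ 0 = pev \<kappa> h0 \<gamma>"
      using S.expand_eval2[of "[:h0:]"] subst0[of "[:h0:]"] by (simp add: eval2_x eval2_residue)
    moreover have "S.expand (pev \<iota> h0 x) = S.expand (pev \<iota> h0 x - pev \<iota> h t) + S.expand (pev \<iota> h t)"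
      using S.expand_add[OF R_diff[OF R_poly_x conjunct1[OF pev_t]] conjunct1[OF pev_t], of h0 h h] by simp
    moreover have "S.expand (pev \<iota> h0 x - pev \<iota> h t) $$$ 0 = 0" using h m_eq by simp
    ultimately have "c = pev \<kappa> h \<tau>" using pev_t[of h] by (simp add: h0)
    then show ?thesis by blast
  qed (simp add: \<tau>_def)
  \<comment> \<open>Algebraicity of \<tau>: for a = 0 it is 0, otherwise it is a root of
    f(T/a).\<close>
  have "\<exists>F. F \<noteq> 0 \<and> pev \<kappa> F \<tau> = 0"
  proof (cases "a = 0")
    case True
    then show ?thesis by (intro exI[of _ "[:0, 1:]"]) (simp add: \<tau>_def)
  next
    case False
    have "\<tau> * \<kappa> (inverse a) = \<gamma> * \<kappa> (a * inverse a)" by (simp only: \<tau>_def res.hom_mult mult_ac)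
    then have "\<tau> * \<kappa> (inverse a) = \<gamma>" using False by simp
    then have "pev \<kappa> (f \<circ>\<^sub>p [:0, inverse a:]) \<tau> = 0"
      using root_\<gamma> by (simp add: res.pev_pcompose)
    moreover have "f \<circ>\<^sub>p [:0, inverse a:] \<noteq> 0"
    proof
      assume "f \<circ>\<^sub>p [:0, inverse a:] = 0"
      then have "f = 0" by (rule pcompose_eq_0) (use False in simp)
      with odd_degree show False by simp
    qed
    ultimately show ?thesis by blast
  qed
  then obtain p where p: "lead_coeff p = 1" "pev \<kappa> p \<tau> = 0" "\<forall>h. pev \<kappa> h \<tau> = 0 \<longrightarrow> p dvd h"
    using res.minimal_polynomial by blast
  have "local_chart \<kappa> \<tau> p \<iota> R m t y S.expand"
  proof
    show "lead_coeff p = 1" "pev \<kappa> p \<tau> = 0" by (rule p)+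
    show "p dvd h" if "pev \<kappa> h \<tau> = 0" for h using p(3) that by blast
    show "pev \<kappa> (pderiv p) \<tau> \<noteq> 0" by (rule res.perfect_imp_separable[OF perfect p])
    show "\<exists>h. c = pev \<kappa> h \<tau>" for c by (rule gen')
    show "inverse u \<in> R" if "u \<in> R" "S.expand u $$$ 0 \<noteq> 0" for u
      using that(1)
    proof (rule R_cases)
      fix w v assume wv: "v \<notin> P" "u = eval2 \<iota> w x y / eval2 \<iota> v x y"
      then have "w \<notin> P" using that(2) by (auto simp: S.expand_nth_0 subst0 P_def point_ideal_def)
      from R_intro[OF this, of v] show ?thesis by (simp add: wv(2))
    qed
    show "\<exists>v\<in>R. u = y * v" if "u \<in> m" for u
      using that
    proof (rule m_cases)
      fix w v assume wv: "w \<in> P" "v \<notin> P" "u = eval2 \<iota> w x y / eval2 \<iota> v x y"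
      from vanishing_numerator(1)[OF wv(1)] obtain r where "r \<in> R" "eval2 \<iota> w x y = y * r" by blast
      then have "u = y * (r * inverse (eval2 \<iota> v x y))" "r * inverse (eval2 \<iota> v x y) \<in> R"
        using R_mult inverse_in_R[OF wv(2)] by (simp_all add: wv(3) divide_inverse)
      then show ?thesis by blast
    qed
    show "S.expand y $$$ 1 \<noteq> 0" using leadsD(2)[OF lead(1)] b by (simp add: S.expand_y)
  qed (simp_all add: R_const R_add R_mult S.expand_const S.expand_add S.expand_mult tR exp_t m_eq[symmetric] y_in_m,
      (rule m_eq)?)
  then show ?thesis using exp_x S.expand_y lead unfolding \<tau>_def t_def by blast
qed

end

text \<open>Euclidean algorithm: h is replaced by h mod p or by p mod h, whichever has smaller
  degree than h; the latter agrees at c with a multiple of h(c). It cannot vanish at c, since p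
  would then divide p div h and h would be a unit of value handled directly.\<close>

lemma (in field_hom) inverse_generated:
  assumes p: "p \<noteq> 0" "pev hom p c = 0" "\<forall>h. pev hom h c = 0 \<longrightarrow> p dvd h"
    and h: "pev hom h c \<noteq> 0"
  shows "\<exists>w. pev hom h c * pev hom w c = 1"
  using h
proof (induction "degree h" arbitrary: h rule: less_induct)
  case less
  show ?case
  proof (cases "degree p \<le> degree h")
    case True
    have "pev hom (h div p * p + h mod p) c = pev hom h c" by simp
    then have eq: "pev hom (h mod p) c = pev hom h c" using p(2) by (simp only: pev_add pev_mult) simp
    then have nz: "h mod p \<noteq> 0" using less.prems by auto
    have "degree (h mod p) < degree h" using degree_mod_less'[OF p(1) nz] True by simp
    from less.hyps[OF this] less.prems show ?thesis unfolding eq .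
  next
    case False
    have "pev hom (p div h * h + p mod h) c = 0" using p(2) by simp
    then have sum: "pev hom (p div h) c * pev hom h c + pev hom (p mod h) c = 0"
      by (simp only: pev_add pev_mult)
    have h0: "h \<noteq> 0" using less.prems by auto
    show ?thesis
    proof (cases "pev hom (p mod h) c = 0")
      case True
      then have "p dvd p mod h" using p(3) by blast
      then have "p mod h = 0" using dvd_imp_degree_le[of p "p mod h"] degree_mod_less'[OF h0, of p] False by force
      then have ph: "p = p div h * h" by (metis add.right_neutral div_mult_mod_eq)
      have "pev hom (p div h) c = 0" using sum True less.prems by simp
      then obtain k where "p div h = p * k" using p(3) by (blast elim: dvdE)
      with ph have "p * 1 = p * (k * h)" by (metis mult.assoc mult_1_right)
      then have "k * h = 1" unfolding mult_left_cancel[OF p(1)] by (rule sym)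
      from arg_cong[OF this, of "\<lambda>h. pev hom h c"] have "pev hom k c * pev hom h c = 1"
        by (simp only: pev_mult) simp
      then show ?thesis by (metis mult.commute)
    next
      case False
      then have nz: "p mod h \<noteq> 0" by auto
      obtain w where w: "pev hom (p mod h) c * pev hom w c = 1"
        using less.hyps[OF degree_mod_less'[OF h0 nz] False] by blast
      have "pev hom (p mod h) c = - (pev hom (p div h) c * pev hom h c)"
        using sum by (simp add: eq_neg_iff_add_eq_0 add.commute)
      then have "pev hom h c * pev hom (- (p div h * w)) c = 1"
        using w by (simp add: pev_uminus pev_mult mult_ac)
      then show ?thesis by blast
    qed
  qed
qed

text \<open>For algebraic c the polynomial expressions in c are closed under inverses, so they form
  one of the sets over which \<open>field_adjoin\<close> intersects.\<close>

lemma (in field_hom) field_adjoin_generated: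
  assumes f: "f \<noteq> 0" "pev hom f c = 0" and adjoin: "field_adjoin hom c = UNIV"
  shows "\<exists>h. u = pev hom h c"
proof -
  obtain p where p: "lead_coeff p = 1" "pev hom p c = 0" "\<forall>h. pev hom h c = 0 \<longrightarrow> p dvd h"
    using minimal_polynomial[OF f] by blast
  then have p0: "p \<noteq> 0" by auto
  define K where "K = range (\<lambda>h. pev hom h c)"
  have "hom a \<in> K" for a unfolding K_def by (rule range_eqI[of _ _ "[:a:]"]) simp
  moreover have "c \<in> K" unfolding K_def by (rule range_eqI[of _ _ "[:0, 1:]"]) simp
  moreover have "u - v \<in> K" "u * v \<in> K" if "u \<in> K" "v \<in> K" for u v
    using that by (auto simp: K_def simp flip: pev_diff pev_mult)
  moreover have "inverse u \<in> K" if uK: "u \<in> K" for u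
  proof (cases "u = 0")
    case False
    obtain h where h: "u = pev hom h c" using uK by (auto simp: K_def)
    then obtain w where "u * pev hom w c = 1" using inverse_generated[OF p0 p(2,3)] False by blast
    then have "inverse u = pev hom w c" by (rule inverse_unique)
    then show ?thesis by (simp add: K_def)
  qed (use uK in simp)
  ultimately have "field_adjoin hom c \<subseteq> K" unfolding field_adjoin_def by (intro Inter_lower) blast
  then show ?thesis using adjoin by (auto simp: K_def)
qed

context local_chart
begin

lemma series_wronskian_order:
  assumes D: "hasse_derivatives \<iota> R t D" and l: "l > g" and xy: "x \<in> R" "y \<in> R"
    and \<Theta>x: "\<Theta> x = fps_const x0 + U" and U: "leads U 2 u" "u \<noteq> 0"
    and V: "leads (\<Theta> y) 1 v" "v \<noteq> 0"
    and two: "(2::'c) \<noteq> 0" and dM: "of_int (det (binomial_matrix l g)) \<noteq> (0::'c)"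
  shows "has_order (wronskian D (series_basis l g x y)) ((g + 1) choose 2)
    ((\<Prod>j<2 * (l - g) + (g + 1). lam (l - g) u v j) *
      (2 ^ ((g + 1) choose 2) * of_int (det (binomial_matrix l g))))"
proof -
  have pow: "z ^ n \<in> R \<and> \<Theta> (z ^ n) = \<Theta> z ^ n" if "z \<in> R" for z n
    by (induction n) (simp_all add: R_1 \<Theta>_1 R_mult \<Theta>_mult that)
  have lam: "lam k x y j \<in> R \<and> \<Theta> (lam k x y j) = lam k (\<Theta> x) (\<Theta> y) j" for k j
    by (simp add: lam_def pow xy R_mult \<Theta>_mult)
  have len: "length (series_basis l g x y) = 2 * (l - g) + (g + 1)"
    using l by (simp add: length_series_basis)
  have sub: "set (series_basis l g x y) \<subseteq> R"
    using lam nth_series_basis[of _ l g x y] by (auto simp: set_conv_nth)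
  show ?thesis
    using wronskian_order[OF D l len sub _ U V two dM, of x0] lam nth_series_basis[of _ l g x y]
    by (simp only: len sum_lessThan_choose_two \<Theta>x)
qed

lemma euler_index_unique:
  assumes two: "(2::'c) \<noteq> 0" and N: "N > 0"
    and order: "\<And>D. hasse_derivatives \<iota> R t D \<Longrightarrow> has_order (wronskian D ls) N \<delta>"
    and w: "euler_index_via \<iota> R m t ls w"
  shows "w = gw_trace \<kappa> ((\<Sum>_<N div 2. gw_hyperbolic) + (if odd N then gw_unary (1 / \<delta>) else 0))"
  using w unfolding euler_index_via_def pev_eq_poly
proof (elim exE conjE)
  fix D \<phi> n G \<eta> es
  assume *: "hasse_derivatives \<iota> R t D" "\<phi> = wronskian D ls" "ideal_pow R m n \<subseteq> principal_ideal R \<phi>"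
    "pev \<iota> G t - \<phi> \<in> ideal_pow R m (2 * n)" "ekl_functional \<iota> R t \<phi> G \<eta>" "quotient_basis \<iota> R \<phi> es"
    and w: "w = gw_class (mat (length es) (length es) (\<lambda>(i, j). \<eta> (es ! i * es ! j)))"
  have "has_order \<phi> N \<delta>" unfolding *(2) by (rule order[OF *(1)])
  from index_class[OF two this *(3,4) N *(5,6)] show ?thesis unfolding w .
qed

lemma euler_index_exists:
  assumes two: "(2::'c) \<noteq> 0" and N: "N > 0"
    and D: "hasse_derivatives \<iota> R t D" and order: "has_order (wronskian D ls) N \<delta>"
  shows "\<exists>w. euler_index_via \<iota> R m t ls w"
proof -
  obtain n G \<eta> es where *: "ideal_pow R m n \<subseteq> principal_ideal R (wronskian D ls)"
     "pev \<iota> G t - wronskian D ls \<in> ideal_pow R m (2 * n)"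
     "ekl_functional \<iota> R t (wronskian D ls) G \<eta>" "quotient_basis \<iota> R (wronskian D ls) es"
    using index_exists[OF order N] by blast
  have "wronskian D ls \<in> m" using order N by (auto simp: has_order_def M_def m_eq)
  then show ?thesis unfolding euler_index_via_def pev_eq_poly using D * by blast
qed

end

context ramification_point
begin

text \<open>A coordinate enters only through its chart, and every Nisnevich coordinate has one
  because its b is nonzero; all of them lead to the same class. The coordinate x + y shows that the
  description is inhabited.\<close>

theorem local_euler_index_eq:
  fixes g l :: nat
  defines "N \<equiv> (g + 1) choose 2"
  assumes perfect: "perfect_field TYPE('a)" and two: "(2::'c) \<noteq> 0" and l: "l > g" "g > 0"
    and dM: "of_int (det (binomial_matrix l g)) \<noteq> (0::'c)"
    and parity: "odd N \<Longrightarrow> even (l - g) \<and> even (g + 1)"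
  shows "local_euler_index \<iota> x y P (series_basis l g x y) =
    gw_trace \<kappa> ((\<Sum>_<N div 2. gw_hyperbolic) +
      (if odd N then gw_unary (2 * of_int (det (binomial_matrix l g)) * pev \<kappa> (pderiv f) \<gamma>) else 0))"
    (is "_ = ?E")
proof -
  define d where "d = pev \<kappa> (pderiv f) \<gamma>"
  define e where "e = (of_int (det (binomial_matrix l g)) :: 'c)"
  have N: "N > 0" using l(2) by (simp add: N_def)
  have d: "d \<noteq> 0" using simple_root by (simp add: d_def)
  have xR: "x \<in> R" using R_poly_x[of "[:0, 1:]"] by simp
  have index: "nisnevich_coordinate \<iota> R m (\<iota> a * x + \<iota> b * y) \<and>
      (\<forall>w. euler_index_via \<iota> R m (\<iota> a * x + \<iota> b * y) (series_basis l g x y) w \<longrightarrow> w = ?E) \<and>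
      (\<forall>D. hasse_derivatives \<iota> R (\<iota> a * x + \<iota> b * y) D \<longrightarrow>
        (\<exists>w. euler_index_via \<iota> R m (\<iota> a * x + \<iota> b * y) (series_basis l g x y) w))"
    if b: "b \<noteq> 0" and gen: "(\<forall>c. \<exists>h. c = pev \<kappa> h (\<kappa> a * \<gamma>)) \<or>
      nisnevich_coordinate \<iota> R m (\<iota> a * x + \<iota> b * y)" for a b
  proof -
    define t where "t = \<iota> a * x + \<iota> b * y"
    define v where "v = 1 / \<kappa> b"
    define u where "u = v\<^sup>2 / d"
    define \<delta> where "\<delta> = (\<Prod>j<2 * (l - g) + (g + 1). lam (l - g) u v j) * (2 ^ N * e)"
    have v0: "v \<noteq> 0" using b by (simp add: v_def)
    have u0: "u \<noteq> 0" using v0 d by (simp add: u_def)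
    obtain p \<Theta> U where chart: "local_chart \<kappa> (\<kappa> a * \<gamma>) p \<iota> R m t y \<Theta>"
      and \<Theta>x: "\<Theta> x = fps_const \<gamma> + U" and U: "leads U 2 u" and V: "leads (\<Theta> y) 1 v"
      using chart_exists[OF b perfect gen] unfolding t_def u_def v_def d_def by blast
    interpret C: local_chart \<kappa> "\<kappa> a * \<gamma>" p \<iota> R m t y \<Theta> by (rule chart)
    have order: "C.has_order (wronskian D (series_basis l g x y)) N \<delta>"
      if "hasse_derivatives \<iota> R t D" for D
      unfolding N_def \<delta>_def e_def
      by (rule C.series_wronskian_order[OF that l(1) xR y_in_R \<Theta>x U u0 V v0 two dM])
    have "gw_unary (1 / \<delta>) = gw_unary (2 * e * d)" if odd: "odd N"
    proof -
      obtain n where n: "N = 2 * n + 1" using odd by (rule oddE)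
      have "odd (\<Sum>i<g + 1. i)" using odd unfolding N_def sum_lessThan_choose_two .
      then obtain s where s: "s \<noteq> 0" "(\<Prod>j<2 * (l - g) + (g + 1). lam (l - g) u v j) = d * s\<^sup>2"
        using prod_lam_square_class[OF _ _ _ u_def v0 d] parity[OF odd] by blast
      have e0: "e \<noteq> 0" using dM by (simp add: e_def)
      \<comment> \<open>Here \<delta> = d s^2 2^N e with N = 2 n + 1, so 1/\<delta> and 2 e d differ
        by the square of r.\<close>
      define r where "r = 1 / (2 * 2 ^ n * (d * s * e))"
      have pow: "(2::'c) ^ N = 2 * (2 ^ n)\<^sup>2" by (simp add: n power_even_eq)
      have "1 / (d * s\<^sup>2 * (z * k\<^sup>2 * e)) = z * e * d * (1 / (z * k * (d * s * e)))\<^sup>2"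
        if "z \<noteq> 0" "k \<noteq> 0" for z k
        using that d e0 s(1) by (simp add: field_simps power2_eq_square)
      from this[OF two, of "2 ^ n"] have "1 / \<delta> = 2 * e * d * r\<^sup>2"
        using two unfolding \<delta>_def s(2) r_def pow by simp
      moreover have "r \<noteq> 0" using d e0 s(1) two by (simp add: r_def)
      ultimately show ?thesis using gw_unary_mult_square[of "2 * e * d" r] d e0 two by simp
    qed
    then have E: "?E = gw_trace \<kappa> ((\<Sum>_<N div 2. gw_hyperbolic) + (if odd N then gw_unary (1 / \<delta>) else 0))"
      unfolding d_def[symmetric] e_def[symmetric] by simp
    show ?thesis
      unfolding t_def[symmetric] E
      using C.nisnevich C.euler_index_unique[OF two N order] C.euler_index_exists[OF two N _ order]
      by blast
  qed
  \<comment> \<open>Witness for existence: a = b = 1, where \<tau> = \<gamma> generates k.\<close>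
  have 1: "(1::'a) \<noteq> 0" by simp
  have gen1: "(\<forall>c. \<exists>h. c = pev \<kappa> h (\<kappa> 1 * \<gamma>)) \<or> nisnevich_coordinate \<iota> R m (\<iota> 1 * x + \<iota> 1 * y)"
    using generated_\<gamma> by simp
  obtain D where D: "hasse_derivatives \<iota> R (\<iota> 1 * x + \<iota> 1 * y) D"
    using hasse_derivatives_exist by auto
  note index1 = index[OF 1 gen1]
  then obtain w where w: "euler_index_via \<iota> R m (\<iota> 1 * x + \<iota> 1 * y) (series_basis l g x y) w"
    using D by blast
  moreover have "w = ?E" using index1 w by blast
  ultimately have ex: "\<exists>a b. nisnevich_coordinate \<iota> R m (\<iota> a * x + \<iota> b * y) \<and>
      euler_index_via \<iota> R m (\<iota> a * x + \<iota> b * y) (series_basis l g x y) ?E"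
    using index1 by blast
  have un: "w = ?E" if "\<exists>a b. nisnevich_coordinate \<iota> R m (\<iota> a * x + \<iota> b * y) \<and>
      euler_index_via \<iota> R m (\<iota> a * x + \<iota> b * y) (series_basis l g x y) w" for w
    using that
  proof (elim exE conjE)
    fix a b
    assume nis: "nisnevich_coordinate \<iota> R m (\<iota> a * x + \<iota> b * y)"
      and w: "euler_index_via \<iota> R m (\<iota> a * x + \<iota> b * y) (series_basis l g x y) w"
    show "w = ?E" using index[OF nisnevich_b_nonzero[OF nis] disjI2[OF nis]] w by blast
  qed
  show ?thesis
    unfolding local_euler_index_def Let_def R_def[symmetric] m_def[symmetric]
    using ex un by (rule the_equality)
qed

end

theorem theorem3p7:
  fixes f :: "'a::field poly" and g l :: nat
    and \<iota> :: "'a \<Rightarrow> 'b::field" and x y :: 'b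
    and \<kappa> :: "'a \<Rightarrow> 'c::field" and \<gamma> :: 'c
  assumes "perfect_field TYPE('a)" and "(2::'a) \<noteq> 0"
    and "degree f = 2 * g + 1" and "smooth_affine_model f"
    and "hyperelliptic_functions \<iota> f x y"
    and "field_hom \<kappa>" and "poly (map_poly \<kappa> f) \<gamma> = 0" and "field_adjoin \<kappa> \<gamma> = UNIV"
    and "l > g" and "(2 * l - g) mod 4 = 1"
    and "of_int (det (binomial_matrix l g)) \<noteq> (0::'a)"
  shows
    "(even l \<and> g mod 4 = 3 \<longrightarrow>
        local_euler_index \<iota> x y (point_ideal \<kappa> \<gamma> 0) (series_basis l g x y) =
        gw_trace \<kappa> (\<Sum>_<((g + 1) choose 2) div 2. gw_hyperbolic)) \<and>
     (odd l \<and> g mod 4 = 1 \<longrightarrow>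
        local_euler_index \<iota> x y (point_ideal \<kappa> \<gamma> 0) (series_basis l g x y) =
        gw_trace \<kappa> ((\<Sum>_<(((g + 1) choose 2) - 1) div 2. gw_hyperbolic) +
          gw_unary (2 * of_int (det (binomial_matrix l g)) * poly (map_poly \<kappa> (pderiv f)) \<gamma>)))"
proof -
  interpret res: field_hom \<kappa> by (rule assms(6))
  have root: "pev \<kappa> f \<gamma> = 0" using assms(7) by (simp only: pev_eq_poly)
  have f0: "f \<noteq> 0" using assms(3) by auto
  have simple: "pev \<kappa> (pderiv f) \<gamma> \<noteq> 0"
  proof
    assume zero: "pev \<kappa> (pderiv f) \<gamma> = 0"
    obtain A B C :: "'a poly poly" where
      *: "A * ([:0, 1:]\<^sup>2 - [:f:]) + B * (2 * [:0, 1:]) + C * [:pderiv f:] = 1"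
      using assms(4) unfolding smooth_affine_model_def by blast
    \<comment> \<open>Setting y = 0 in the Jacobian identity removes the term with B. At \<gamma>
      both f and, by assumption, its derivative vanish, which leaves 0 = 1.\<close>
    have "coeff A 0 * (- f) + coeff C 0 * pderiv f = 1"
      using arg_cong[OF *, of "\<lambda>h. coeff h 0"] by (simp add: coeff_mult_0 power2_eq_square mult.commute)
    from arg_cong[OF this, of "\<lambda>h. pev \<kappa> h \<gamma>"] show False
      using root zero by (simp add: res.pev_diff res.pev_add res.pev_mult res.pev_uminus)
  qed
  have \<iota>: "field_hom \<iota>" "transcendental_over \<iota> x" "y\<^sup>2 = pev \<iota> f x"
    using assms(5) unfolding hyperelliptic_functions_def pev_eq_poly by blast+
  interpret emb: field_hom \<iota> by (rule \<iota>(1))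
  interpret ramification_point \<iota> f x y \<kappa> \<gamma>
  proof
    show "h = 0" if "pev \<iota> h x = 0" for h
      using \<iota>(2) that unfolding transcendental_over_def pev_eq_poly by blast
    show "odd (degree f)" by (simp add: assms(3))
    show "\<exists>h. c = pev \<kappa> h \<gamma>" for c by (rule res.field_adjoin_generated[OF f0 root assms(8)])
  qed (rule \<iota>(3) root simple)+
  have "\<kappa> 2 = 2" by (simp only: one_add_one[symmetric] res.hom_add res.hom_one)
  then have two: "(2::'c) \<noteq> 0" using assms(2) res.hom_0_iff[of 2] by metis
  have "\<kappa> (of_int (det (binomial_matrix l g))) \<noteq> 0" using assms(11) by simp
  then have dM: "of_int (det (binomial_matrix l g)) \<noteq> (0::'c)" by (simp add: res.hom_of_int)
  note index = local_euler_index_eq[OF assms(1) two assms(9) _ dM, unfolded P_def pev_eq_poly[symmetric]]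
  have choose: "(g + 1) choose 2 = (g + 1) * g div 2" by (simp add: choose_two)
  show ?thesis
  proof (intro conjI impI)
    assume "even l \<and> g mod 4 = 3"
    then obtain q where q: "g = 4 * q + 3" by (metis mult_div_mod_eq)
    have *: "(g + 1) * g = 2 * (2 * ((q + 1) * g))" by (simp add: q algebra_simps)
    have "(g + 1) choose 2 = 2 * ((q + 1) * g)" unfolding choose * by simp
    then have "even ((g + 1) choose 2)" by simp
    then show "local_euler_index \<iota> x y (point_ideal \<kappa> \<gamma> 0) (series_basis l g x y) =
        gw_trace \<kappa> (\<Sum>_<((g + 1) choose 2) div 2. gw_hyperbolic)"
      using index q by simp
  next
    assume l: "odd l \<and> g mod 4 = 1"
    then obtain q where q: "g = 4 * q + 1" by (metis mult_div_mod_eq)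
    have "(g + 1) choose 2 = (2 * q + 1) * g" unfolding choose by (simp add: q)
    then have N: "odd ((g + 1) choose 2)" by (simp add: q)
    \<comment> \<open>Both l and g are odd here, which provides the parities of l - g and g + 1
      required by the square class computation.\<close>
    have g: "g > 0" "even (l - g) \<and> even (g + 1)" using l assms(9) by (simp_all add: q)
    have "((g + 1) choose 2) div 2 = (((g + 1) choose 2) - 1) div 2" using N by (auto elim: oddE)
    then show "local_euler_index \<iota> x y (point_ideal \<kappa> \<gamma> 0) (series_basis l g x y) =
        gw_trace \<kappa> ((\<Sum>_<(((g + 1) choose 2) - 1) div 2. gw_hyperbolic) +
          gw_unary (2 * of_int (det (binomial_matrix l g)) * poly (map_poly \<kappa> (pderiv f)) \<gamma>))"
      using index[OF g] N by (simp only: pev_eq_poly if_True not_False_eq_True)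
  qed
qed

end
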